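(* The Hecke polynomial $H_w(z)$ is $$\begin{aligned}H_w(z)=\ &z^6-t_{g''}t_{g'''}^{-1}t_{h'}t_{h''}^{-1}\,z^5\\ &+q\left(t_{g'}t_{g'''}^{-1}t_{h'}^2t_{h''}^{-2}+t_{g''}^2t_{g'''}^{-2}t_{h''}^{-1}-2q\,t_{g'}t_{g'''}^{-1}t_{h''}^{-1}\right)z^4\\ &-q^2\left(t_{g'}t_{g''}t_{g'''}^{-2}t_{h'}t_{h''}^{-2}+q\,t_{g'''}^{-1}t_{h'}^3t_{h''}^{-3}-3q^2\,t_{g'''}^{-1}t_{h'}t_{h''}^{-2}\right)z^3\\ &+q^4\left(t_{g''}t_{g'''}^{-2}t_{h'}^2t_{h''}^{-3}+t_{g'}^2t_{g'''}^{-2}t_{h''}^{-2}-2q\,t_{g''}t_{g'''}^{-2}t_{h''}^{-2}\right)z^2\\ &-q^6\,t_{g'}t_{g'''}^{-2}t_{h'}t_{h''}^{-3}\,z+q^9\,t_{g'''}^{-2}t_{h''}^{-3}.\end{aligned}$$ In particular, the coefficients of $H_w(z)$ lie in $\mathcal H(G,K)$ and not just in $\mathcal H(G,K)\otimes\mathbb Z[q^{\pm1/2}]$.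
   Context: $k_0$ is a non-archimedean local field of characteristic $0$ (it is $F_\tau=E_w$ for a place $\tau$ of a totally real field $F$ split in a totally imaginary quadratic extension $E$) with ring of integers $\mathcal O$, uniformizer $\varpi$, residue field of cardinality $q$. $G=\mathrm{GL}_3(k_0)\times\mathrm{GL}_2(k_0)$, $K=\mathrm{GL}_3(\mathcal O)\times\mathrm{GL}_2(\mathcal O)$, $T$ the diagonal torus of $G$, $T_c=T\cap K$, $B\supset T$ the upper triangular Borel with unipotent radical $U$, $\Omega(T)=S_3\times S_2$ the Weyl group. $\mathcal H(G,K)$ is the convolution algebra of compactly supported $K$-bi-invariant $\mathbb Z$-valued functions on $G$ (Haar measure giving $K$ volume $1$), and $\mathcal H(T,T_c)$ is defined similarly, so $\mathcal{H}(T,T_c)=\mathbb{Z}[T/T_c]$. The (normalized) Satake isomorphism $\widehat{\cdot}\colon\mathcal H(G,K)\otimes\mathbb Z[q^{\pm1/2}]\to\mathcal H(T,T_c)^{\Omega(T)}\otimes\mathbb Z[q^{\pm1/2}]$ is $\widehat f(t)=\delta(t)^{1/2}\int_Uf(tu)\,du$, with $\delta(t)=|\det(\mathrm{Ad}(t)|_{\mathrm{Lie}(U)})|$, $|\varpi|=q^{-1}$, and $U\cap K$ of volume $1$. $\mathcal H(T,T_c)\otimes\mathbb C$ is identified with the ring of algebraic functions on the dual torus $\widehat T$ of diagonal elements $(\mathrm{diag}(x_1,x_2,x_3),\mathrm{diag}(y_1,y_2))$ of $\widehat G=\mathrm{GL}_3(\mathbb C)\times\mathrm{GL}_2(\mathbb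 C)$, the function $x_i$ corresponding to $\mathbf 1_{(g_i,1)T_c}$ and $y_j$ to $\mathbf 1_{(1,h_j)T_c}$, where $g_i$ (resp. $h_j$) is the diagonal matrix with $\varpi$ in position $i$ (resp. $j$) and $1$ elsewhere. The Hecke polynomial $H_w(z)\in(\mathcal H(G,K)\otimes\mathbb Z[q^{\pm1/2}])[z]$ attached to the Shimura datum for $\mathrm U(2,1)\times\mathrm U(1,1)$ is the polynomial whose coefficients correspond under the Satake isomorphism to those of $\det(z-q^{3/2}\rho(\cdot))$ restricted to $\widehat T$, where $\rho\colon\widehat G\to\mathrm{GL}_6(\mathbb C)$, $\rho(A_V,A_W)={}^tA_V^{-1}\otimes{}^tA_W^{-1}$; that is, the Satake transform of $H_w(z)$ is $$\prod_{i=1}^3\prod_{j=1}^2\left(z-q^{3/2}x_i^{-1}y_j^{-1}\right).$$ Hecke operators: $t_{g'},t_{g''},t_{g'''}$ are the characteristic functions of $K(a,1)K$ with $a=\mathrm{diag}(\varpi,1,1)$, $\mathrm{diag}(\varpi,\varpi,1)$, $\mathrm{diag}(\varpi,\varpi,\varpi)$ respectively; $t_{h'},t_{h''}$ are the characteristic functions of $K(1,b)K$ with $b=\mathrm{diag}(\varpi,1)$, $\mathrm{diag}(\varpi,\varpi)$ respectively ($t_{g'''}$ and $t_{h''}$ are invertible in $\mathcal H(G,K)$). *)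

theory Defs
  imports "HOL-Analysis.Analysis" "HOL-Algebra.UnivPoly"
begin

section \<open>Non-archimedean local fields\<close>

text \<open>
  Characteristic zero and a complete metric; the two structures are related only in the class
  \<open>nonarch_local_field\<close> below. The absolute value is the distance to \<open>0\<close>.
\<close>

class complete_metric_field = field_char_0 + complete_space

context complete_metric_field
begin

definition absval :: "'a \<Rightarrow> real"
  where "absval x = dist x 0"

definition integers :: "'a set"
  where "integers = {x. absval x \<le> 1}"

definition max_ideal :: "'a set"
  where "max_ideal = {x. absval x < 1}"

definition residue_field :: "'a set set"
  where "residue_field = integers // {(x, y). x \<in> integers \<and> y \<in> integers \<and> x - y \<in> max_ideal}"

definition uniformizer :: "'a \<Rightarrow> bool"
  where "uniformizer p \<longleftrightarrow> p \<noteq> 0 \<and> max_ideal = (\<lambda>x. p * x) ` integers"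

end

text \<open>
  Completeness for a non-archimedean absolute value that is discrete, has finite residue field,
  and is normalized by \<open>absval p = 1 / q\<close> for a uniformizer \<open>p\<close>, with \<open>q\<close> the cardinality of the
  residue field. Discreteness and nontriviality follow from the existence of a uniformizer.
\<close>

class nonarch_local_field = complete_metric_field +
  assumes dist_eq_absval: "dist x y = absval (x - y)"
    and absval_mult: "absval (x * y) = absval x * absval y"
    and absval_add_le: "absval (x + y) \<le> max (absval x) (absval y)"
    and finite_residue_field: "finite (residue_field :: 'a set set)"
    and ex_normalized_uniformizer:
      "\<exists>p::'a. uniformizer p \<and> absval p = 1 / real (card (residue_field :: 'a set set))"

section \<open>Haar measures and Hecke algebras\<close>

text \<open>
  A group is a HOL-Algebra group whose carrier is a subset of a topological type and has the
  subspace topology.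
\<close>

definition haar_measure_on :: "('g::topological_space, 'b) monoid_scheme \<Rightarrow> 'g measure \<Rightarrow> bool"
  where "haar_measure_on G \<mu> \<longleftrightarrow>
    sets \<mu> = sets (restrict_space borel (carrier G)) \<and>
    (\<forall>g\<in>carrier G. \<forall>A\<in>sets \<mu>. emeasure \<mu> (g <#\<^bsub>G\<^esub> A) = emeasure \<mu> A) \<and>
    (\<forall>C. compact C \<and> C \<subseteq> carrier G \<longrightarrow> emeasure \<mu> C < \<infinity>) \<and>
    emeasure \<mu> (carrier G) \<noteq> 0"

text \<open>
  The convolution algebra of compactly supported \<open>K\<close>-bi-invariant functions on \<open>G\<close> with values in
  a subring \<open>A\<close> of the complex numbers; functions are extended by \<open>0\<close> outside \<open>G\<close>. For
  \<open>A = \<int>\<close> this is \<open>\<H>(G,K)\<close>, and for general \<open>A\<close> it is \<open>\<H>(G,K) \<otimes> A\<close>, since \<open>\<H>(G,K)\<close> is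
  free over \<open>\<int>\<close> on the characteristic functions of the double cosets. The unit is the
  characteristic function of \<open>K\<close> because \<open>K\<close> is meant to have volume \<open>1\<close>.
\<close>

definition hecke_algebra ::
  "('g::topological_space, 'b) monoid_scheme \<Rightarrow> 'g measure \<Rightarrow> 'g set \<Rightarrow> complex set \<Rightarrow> ('g \<Rightarrow> complex) ring"
  where "hecke_algebra G \<mu> K A =
   \<lparr>carrier = {f. (\<exists>C. compact C \<and> C \<subseteq> carrier G \<and> (\<forall>x. x \<notin> C \<longrightarrow> f x = 0)) \<and>
                  (\<forall>k\<in>K. \<forall>x\<in>carrier G. \<forall>k'\<in>K. f (k \<otimes>\<^bsub>G\<^esub> x \<otimes>\<^bsub>G\<^esub> k') = f x) \<and>
                  range f \<subseteq> A},
    mult = (\<lambda>f1 f2 g. if g \<in> carrier G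
                      then (LINT x|\<mu>. f1 x * f2 (inv\<^bsub>G\<^esub> x \<otimes>\<^bsub>G\<^esub> g)) else 0),
    one = indicator K,
    zero = (\<lambda>_. 0),
    add = (\<lambda>f1 f2 g. f1 g + f2 g)\<rparr>"

definition double_coset_fun ::
  "('g, 'b) monoid_scheme \<Rightarrow> 'g set \<Rightarrow> 'g \<Rightarrow> 'g \<Rightarrow> complex"
  where "double_coset_fun G K a = indicator {k \<otimes>\<^bsub>G\<^esub> a \<otimes>\<^bsub>G\<^esub> k' | k k'. k \<in> K \<and> k' \<in> K}"

text \<open>The subring \<open>\<int>[q\<^sup>1\<^sup>/\<^sup>2, q\<^sup>-\<^sup>1\<^sup>/\<^sup>2]\<close> of the complex numbers.\<close>

definition Z_sqrt :: "nat \<Rightarrow> complex set"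
  where "Z_sqrt q = {\<Sum>n\<in>{-m..m}. of_int (c n) * complex_of_real (sqrt (real q)) powi n
                     | (m::int) (c::int \<Rightarrow> int). True}"

section \<open>The group \<open>GL\<^sub>3 \<times> GL\<^sub>2\<close>\<close>

text \<open>
  Matrix indices are written out as \<open>1, 2, 3\<close>: in the library's index type \<open>3\<close> one has \<open>3 = 0\<close>,
  so its order is not the order of rows and columns.
\<close>

type_synonym 'a mat32 = "('a^3^3) \<times> ('a^2^2)"

definition GL :: "('a::field^'n^'n) monoid"
  where "GL = \<lparr>carrier = {A. invertible A}, mult = (**), one = mat 1\<rparr>"

definition GL_integers :: "('a::complete_metric_field^'n^'n) set"
  where "GL_integers = {A \<in> carrier GL. \<forall>i j. A $ i $ j \<in> integers \<and> matrix_inv A $ i $ j \<in> integers}"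

definition GL32 :: "('a::field) mat32 monoid"
  where "GL32 = GL \<times>\<times> GL"

definition GL32_integers :: "('a::complete_metric_field) mat32 set"
  where "GL32_integers = GL_integers \<times> GL_integers"

definition torus :: "('a::field) mat32 set"
  where "torus = {(A, B) \<in> carrier GL32.
    (\<forall>i j. i \<noteq> j \<longrightarrow> A $ i $ j = 0) \<and> (\<forall>i j. i \<noteq> j \<longrightarrow> B $ i $ j = 0)}"

definition unipotent_radical :: "('a::field) mat32 set"
  where "unipotent_radical = {(A, B) \<in> carrier GL32.
    (\<forall>i. A $ i $ i = 1) \<and> A $ 2 $ 1 = 0 \<and> A $ 3 $ 1 = 0 \<and> A $ 3 $ 2 = 0 \<and>
    (\<forall>i. B $ i $ i = 1) \<and> B $ 2 $ 1 = 0}"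

abbreviation unipotent_group :: "('a::field) mat32 monoid"
  where "unipotent_group \<equiv> GL32\<lparr>carrier := unipotent_radical\<rparr>"

definition diag :: "'a::zero^'n \<Rightarrow> 'a^'n^'n"
  where "diag v = (\<chi> i j. if i = j then v $ i else 0)"

section \<open>The Satake transform\<close>

text \<open>\<open>Lie(U)\<close> is coordinatized by the entries in positions \<open>12, 13, 23\<close> and \<open>12\<close>.\<close>

definition lie_embed :: "'a::field^4 \<Rightarrow> 'a mat32"
  where "lie_embed v =
    (vector [vector [0, v $ 1, v $ 2], vector [0, 0, v $ 3], vector [0, 0, 0]],
     vector [vector [0, v $ 4], vector [0, 0]])"

definition lie_coords :: "('a::field) mat32 \<Rightarrow> 'a^4"
  where "lie_coords X = vector [fst X $ 1 $ 2, fst X $ 1 $ 3, fst X $ 2 $ 3, snd X $ 1 $ 2]"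

definition Ad :: "('a::field) mat32 \<Rightarrow> 'a mat32 \<Rightarrow> 'a mat32"
  where "Ad t X = (fst t ** fst X ** matrix_inv (fst t), snd t ** snd X ** matrix_inv (snd t))"

definition modulus :: "('a::complete_metric_field) mat32 \<Rightarrow> real"
  where "modulus t = absval (det (matrix (\<lambda>v. lie_coords (Ad t (lie_embed v)))))"

text \<open>\<open>\<nu>\<close> is the Haar measure on \<open>U\<close>; the values matter only for \<open>t\<close> in the torus.\<close>

definition satake ::
  "('a::complete_metric_field) mat32 measure \<Rightarrow> ('a mat32 \<Rightarrow> complex)
    \<Rightarrow> 'a mat32 \<Rightarrow> complex"
  where "satake \<nu> f t = complex_of_real (sqrt (modulus t)) * (LINT u|\<nu>. f (t \<otimes>\<^bsub>GL32\<^esub> u))"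

text \<open>
  The identification of \<open>\<H>(T,T\<^sub>c) \<otimes> \<complex> = \<complex>[T/T\<^sub>c]\<close> with the algebraic functions on the dual
  torus. The diagonal matrices with powers of \<open>\<pi>\<close> on the diagonal represent \<open>T/T\<^sub>c\<close>, and the
  characteristic function of the coset with exponents \<open>a, b\<close> goes to the monomial
  \<open>x\<^sup>a y\<^sup>b\<close>; in particular that of \<open>(g\<^sub>i, 1)T\<^sub>c\<close> goes to \<open>x\<^sub>i\<close>, and that of \<open>(1, h\<^sub>j)T\<^sub>c\<close> to \<open>y\<^sub>j\<close>.
  The sum is finite for compactly supported \<open>\<phi>\<close>.
\<close>

definition dual_torus_fun ::
  "'a::field \<Rightarrow> ('a mat32 \<Rightarrow> complex) \<Rightarrow> complex mat32 \<Rightarrow> complex"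
  where "dual_torus_fun \<pi> \<phi> s =
    (let c = (\<lambda>(a, b). \<phi> (diag (\<chi> i. \<pi> powi (a $ i)), diag (\<chi> j. \<pi> powi (b $ j))))
     in \<Sum>(a, b)\<in>{e :: (int^3) \<times> (int^2). c e \<noteq> 0}.
          c (a, b) * (\<Prod>i\<in>UNIV. (fst s $ i $ i) powi (a $ i)) * (\<Prod>j\<in>UNIV. (snd s $ j $ j) powi (b $ j)))"

section \<open>The Hecke polynomial\<close>

definition kronecker :: "'a::times^'n^'n \<Rightarrow> 'a^'m^'m \<Rightarrow> 'a^('n \<times> 'm)^('n \<times> 'm)"
  where "kronecker M N = (\<chi> i j. M $ fst i $ fst j * N $ snd i $ snd j)"

definition rho :: "complex mat32 \<Rightarrow> complex^(3 \<times> 2)^(3 \<times> 2)"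
  where "rho s = kronecker (transpose (matrix_inv (fst s))) (transpose (matrix_inv (snd s)))"

text \<open>\<open>det(z - c \<rho>(s))\<close> as a polynomial in \<open>z\<close>.\<close>

definition char_poly_rho :: "complex \<Rightarrow> complex mat32 \<Rightarrow> complex poly"
  where "char_poly_rho c s = det (mat [:0, 1:] - (\<chi> i j. [:c * rho s $ i $ j:]))"

text \<open>
  \<open>H\<close> is a polynomial over \<open>\<H>(G,K) \<otimes> \<int>[q\<^sup>1\<^sup>/\<^sup>2, q\<^sup>-\<^sup>1\<^sup>/\<^sup>2]\<close> whose coefficients correspond under the
  Satake transform to those of \<open>det(z - q\<^sup>3\<^sup>/\<^sup>2 \<rho>(\<sqdot>))\<close> on the dual torus.
\<close>

definition is_hecke_polynomial ::
  "('a::complete_metric_field) mat32 measure \<Rightarrow> 'a mat32 measure \<Rightarrow> 'a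
    \<Rightarrow> (nat \<Rightarrow> 'a mat32 \<Rightarrow> complex) \<Rightarrow> bool"
  where "is_hecke_polynomial \<mu> \<nu> \<pi> H \<longleftrightarrow>
    (let q = card (residue_field :: 'a set set);
         P = UP (hecke_algebra GL32 \<mu> GL32_integers (Z_sqrt q))
     in H \<in> carrier P \<and>
        (\<forall>n. \<forall>s\<in>torus.
           dual_torus_fun \<pi> (satake \<nu> (up_ring.coeff P H n)) s =
           Polynomial.coeff (char_poly_rho (complex_of_real (real q powr (3/2))) s) n))"

end

theory Submission
  imports Defs
begin

text \<open>
  By the Iwasawa decomposition \<open>G = TUK\<close>, the Satake transform of \<open>f\<close> evaluated at a point \<open>s\<close> of the
  dual torus is the finite sum of \<open>f(g) \<psi>\<^sub>s(g)\<close> over \<open>gK \<in> G/K\<close>, where \<open>\<psi>\<^sub>s(t u k) = \<delta>(t)\<^sup>1\<^sup>/\<^sup>2 t(s)\<close>.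
  Since \<open>\<psi>\<^sub>s(b g) = \<psi>\<^sub>s(b) \<psi>\<^sub>s(g)\<close> for \<open>b \<in> TU\<close>, this sum is multiplicative for the convolution, and
  the family over all \<open>s\<close> is injective: on the support of \<open>f\<close> take the exponent of \<open>T/T\<^sub>c\<close> that is minimal
  in a lexicographic order; \<open>f\<close> is constant on the part of its support lying over it, so the coefficient
  of the corresponding character does not vanish. Hence the Hecke algebra is a commutative ring, and
  identities in it can be checked after evaluation at \<open>s\<close>. Counting cosets gives the transforms \<open>q e\<^sub>1(x)\<close>,
  \<open>q e\<^sub>2(x)\<close>, \<open>e\<^sub>3(x)\<close>, \<open>q\<^sup>1\<^sup>/\<^sup>2 e\<^sub>1(y)\<close>, \<open>e\<^sub>2(y)\<close> of the five operators, with \<open>e\<^sub>i\<close> the elementary symmetric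
  polynomials, and the formula becomes the expansion of \<open>\<Prod>(z - q\<^sup>3\<^sup>/\<^sup>2 x\<^sub>i\<^sup>-\<^sup>1 y\<^sub>j\<^sup>-\<^sup>1)\<close> in these.
\<close>

section \<open>Local fields\<close>

text \<open>The analysis is confined to one observation: every function that gets integrated is
  constant on cosets of an open compact subgroup of volume 1, so each Haar integral is a finite sum
  over coset representatives. The representatives are explicit. One transversal \<open>T\<close> of
  the field modulo its integers, with 0 standing for the integral class, supplies the entries above
  the diagonal both for \<open>G/K\<close> and for \<open>U/(U \<inter> K)\<close>. The two families
  therefore match under multiplication by torus elements, and counting cosets means counting
  elements of \<open>T\<close>, of which exactly q become integral after multiplication by the
  uniformizer. Injectivity is proved for complex-valued functions, while the ring is set up over the
  integers. A polynomial over the larger coefficient ring can thus be compared with the integral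
  one, and integrality follows from uniqueness. The half-integral powers of q cancel by parity: the
  coefficient of \<open>z^(6-n)\<close> carries \<open>q^(3n/2)\<close> and has degree n in the
  inverses of the \<open>y_j\<close>, so each of its terms contains \<open>th1\<close> to a power of
  the same parity as n, and every factor \<open>th1\<close> absorbs one square root of q.\<close>

lemma absval_0 [simp]: "absval (0::'k::nonarch_local_field) = 0"
  by (simp add: absval_def)

lemma absval_nonneg [simp]: "0 \<le> absval (x::'k::nonarch_local_field)"
  by (simp add: absval_def)

lemma absval_eq_0_iff [simp]: "absval (x::'k::nonarch_local_field) = 0 \<longleftrightarrow> x = 0"
  by (simp add: absval_def)

lemma absval_pos_iff [simp]: "0 < absval (x::'k::nonarch_local_field) \<longleftrightarrow> x \<noteq> 0"
  by (simp add: absval_def)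

lemma absval_1 [simp]: "absval (1::'k::nonarch_local_field) = 1"
  using absval_mult[of 1 "1::'k"] by simp

lemma absval_minus [simp]: "absval (- x::'k::nonarch_local_field) = absval x"
proof -
  have "absval (-1::'k) * absval (-1::'k) = 1"
    using absval_mult[of "-1" "-1::'k"] by simp
  then have "absval (-1::'k) = 1"
    using absval_nonneg[of "-1::'k"] unfolding square_eq_1_iff by linarith
  then show ?thesis
    using absval_mult[of "-1" x] by simp
qed

lemma absval_diff_le: "absval (x - y::'k::nonarch_local_field) \<le> max (absval x) (absval y)"
  using absval_add_le[of x "-y"] by simp

lemma absval_inverse: "absval (inverse x::'k::nonarch_local_field) = inverse (absval x)"
proof (cases "x = 0")
  case False
  then have "absval x * absval (inverse x) = 1"
    using absval_mult[of x "inverse x"] by simp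
  then show ?thesis
    by (simp add: inverse_unique)
qed simp

lemma absval_divide: "absval (x / y::'k::nonarch_local_field) = absval x / absval y"
  by (simp add: divide_inverse absval_mult absval_inverse)

lemma absval_power: "absval (x ^ n::'k::nonarch_local_field) = absval x ^ n"
  by (induction n) (simp_all add: absval_mult)

lemma absval_powi: "absval (x powi n::'k::nonarch_local_field) = absval x powi n"
  by (simp add: power_int_def absval_power absval_inverse)

lemma absval_add_eq:
  fixes x :: "'k::nonarch_local_field"
  assumes "absval y < absval x"
  shows "absval (x + y) = absval x"
  using absval_add_le[of x y] absval_diff_le[of "x + y" y] assms by (auto simp: max_def split: if_splits)

lemma integers_iff: "x \<in> integers \<longleftrightarrow> absval (x::'k::nonarch_local_field) \<le> 1"
  by (simp add: integers_def)

lemma integers_0 [simp]: "(0::'k::nonarch_local_field) \<in> integers"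
  and integers_1 [simp]: "(1::'k::nonarch_local_field) \<in> integers"
  by (simp_all add: integers_iff)

lemma integers_add: "x \<in> integers \<Longrightarrow> y \<in> integers \<Longrightarrow> x + y \<in> integers"
  and integers_diff: "x \<in> integers \<Longrightarrow> y \<in> integers \<Longrightarrow> x - y \<in> integers"
  and integers_mult: "x \<in> integers \<Longrightarrow> y \<in> integers \<Longrightarrow> x * y \<in> integers"
  and integers_minus: "x \<in> integers \<Longrightarrow> - x \<in> integers"
  for x :: "'k::nonarch_local_field"
  using absval_add_le[of x y] absval_diff_le[of x y]
  by (auto simp: integers_iff absval_mult mult_le_one)

lemma integers_minus_iff [simp]: "- x \<in> integers \<longleftrightarrow> (x::'k::nonarch_local_field) \<in> integers"
  by (simp add: integers_iff)

lemma integers_sum: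
  "(\<And>i. i \<in> I \<Longrightarrow> f i \<in> integers) \<Longrightarrow> (\<Sum>i\<in>I. f i) \<in> (integers :: 'k::nonarch_local_field set)"
  by (induction I rule: infinite_finite_induct) (auto intro: integers_add)

lemma integers_prod:
  "(\<And>i. i \<in> I \<Longrightarrow> f i \<in> integers) \<Longrightarrow> (\<Prod>i\<in>I. f i) \<in> (integers :: 'k::nonarch_local_field set)"
  by (induction I rule: infinite_finite_induct) (auto intro: integers_mult)

lemma integers_of_int: "of_int m \<in> (integers :: 'k::nonarch_local_field set)"
proof -
  have "of_nat n \<in> (integers :: 'k set)" for n
    by (induction n) (auto intro: integers_add)
  then show ?thesis
    by (cases m) (auto simp: integers_minus simp del: of_nat_Suc)
qed

section \<open>Uniformizers and discreteness of the valuation\<close>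

lemma uniformizer_nonzero: "uniformizer p \<Longrightarrow> p \<noteq> 0"
  by (simp add: uniformizer_def)

text \<open>The maximal ideal is \<open>p\<close> times the integers, so no absolute value lies
  strictly between \<open>absval p\<close> and 1. This is the form in which discreteness is
  used.\<close>

lemma absval_less_1_iff:
  fixes p x :: "'k::nonarch_local_field"
  assumes "uniformizer p"
  shows "absval x < 1 \<longleftrightarrow> absval x \<le> absval p"
proof
  assume "absval x < 1"
  then obtain y where "y \<in> integers" "x = p * y"
    using assms by (auto simp: uniformizer_def max_ideal_def)
  then show "absval x \<le> absval p"
    by (simp add: absval_mult integers_iff mult_left_le)
next
  have "p \<in> max_ideal"
    using assms by (auto simp: uniformizer_def intro!: image_eqI[of _ _ 1])
  moreover assume "absval x \<le> absval p"
  ultimately show "absval x < 1"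
    by (simp add: max_ideal_def)
qed

lemma card_residue_field_gt_1: "1 < card (residue_field :: 'k::nonarch_local_field set set)"
proof -
  let ?r = "{(x::'k, y). x \<in> integers \<and> y \<in> integers \<and> x - y \<in> max_ideal}"
  have "?r `` {0} \<noteq> ?r `` {1}"
  proof
    assume "?r `` {0} = ?r `` {1}"
    moreover have "0 \<in> ?r `` {0}"
      by (simp add: max_ideal_def)
    ultimately have "0 \<in> ?r `` {1}"
      by blast
    then show False
      by (simp add: max_ideal_def)
  qed
  then have "card {?r `` {0}, ?r `` {1}} = 2"
    by simp
  moreover have "{?r `` {0}, ?r `` {1}} \<subseteq> residue_field"
    unfolding residue_field_def by (intro insert_subsetI quotientI) simp_all
  ultimately show ?thesis
    using card_mono[OF finite_residue_field, of "{?r `` {0}, ?r `` {1}}"] by linarith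
qed

text \<open>The class provides one normalized uniformizer. Every uniformizer has the largest
  absolute value below 1, so the normalization passes to all of them.\<close>

lemma absval_uniformizer:
  fixes p :: "'k::nonarch_local_field"
  assumes "uniformizer p"
  shows "absval p = 1 / real (card (residue_field :: 'k set set))"
proof -
  obtain p' :: 'k where p': "uniformizer p'" "absval p' = 1 / real (card (residue_field :: 'k set set))"
    using ex_normalized_uniformizer by blast
  show ?thesis
    using absval_less_1_iff[OF assms, of p] absval_less_1_iff[OF assms, of p']
      absval_less_1_iff[OF p'(1), of p] absval_less_1_iff[OF p'(1), of p'] p' by simp
qed

lemma absval_uniformizer_less_1: "uniformizer (p::'k::nonarch_local_field) \<Longrightarrow> absval p < 1"
  using absval_less_1_iff by blast

lemma ex_absval_powi:
  fixes p x :: "'k::nonarch_local_field"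
  assumes p: "uniformizer p" and x: "x \<noteq> 0"
  obtains m where "absval x = absval p powi m"
proof -
  let ?r = "absval p"
  have r: "0 < ?r" "?r < 1"
    using uniformizer_nonzero[OF p] absval_uniformizer_less_1[OF p] by auto
  \<comment> \<open>With this floor the quotient \<open>y\<close> of \<open>x\<close> by
    \<open>p powi m\<close> satisfies \<open>absval p < absval y \<le> 1\<close>; the negative sign
    of \<open>ln (absval p)\<close> reverses both inequalities. Discreteness then leaves only
    \<open>absval y = 1\<close>.\<close>
  define m where "m = \<lfloor>ln (absval x) / ln ?r\<rfloor>"
  define y where "y = x * p powi (-m)"
  have ln_r: "ln ?r < 0"
    using r by simp
  have ln_y: "ln (absval y) = ln (absval x) - m * ln ?r"
  proof -
    have "absval y = absval x * absval p powr real_of_int (- m)"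
      using r powr_real_of_int'[of "absval p" "- m"] by (simp add: y_def absval_mult absval_powi)
    then show ?thesis
      using r x by (simp add: ln_mult_pos ln_powr)
  qed
  have m: "of_int m \<le> ln (absval x) / ln ?r" "ln (absval x) / ln ?r < of_int m + 1"
    by (auto simp: m_def)
  have "ln (absval x) \<le> of_int m * ln ?r" "(of_int m + 1) * ln ?r < ln (absval x)"
    using m ln_r by (auto simp: field_simps)
  then have "ln (absval y) \<le> 0" "ln ?r < ln (absval y)"
    by (auto simp: ln_y field_simps)
  moreover have "0 < absval y"
    using x r by (simp add: y_def)
  ultimately have "absval y \<le> 1" "\<not> absval y \<le> ?r"
    using r by (auto simp: not_le)
  then have "absval y = 1"
    using absval_less_1_iff[OF p, of y] by auto
  then have "absval x = ?r powi m"
    using r by (simp add: y_def absval_mult absval_inverse absval_divide absval_powi power_int_minus field_simps)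
  then show ?thesis ..
qed

lemma uniformizer_powi_le_iff:
  fixes p :: "'k::nonarch_local_field"
  assumes "uniformizer p"
  shows "absval p powi m \<le> absval p powi n \<longleftrightarrow> n \<le> m"
proof -
  have "0 < absval p" "absval p < 1"
    using assms by (auto simp: uniformizer_nonzero absval_uniformizer_less_1)
  then show ?thesis
    using power_int_strict_decreasing[of m n "absval p"] power_int_decreasing[of n m "absval p"]
    by (cases "n \<le> m") auto
qed

lemma uniformizer_powi_eq_iff:
  fixes p :: "'k::nonarch_local_field"
  assumes "uniformizer p"
  shows "absval p powi m = absval p powi n \<longleftrightarrow> m = n"
  using uniformizer_powi_le_iff[OF assms, of m n] uniformizer_powi_le_iff[OF assms, of n m]
  by (metis order_antisym order_refl)

section \<open>Compactness of the integers and the topology of the field\<close>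

lemma residue_field_finite_reps:
  obtains X :: "'k::nonarch_local_field set" where "finite X"
    "\<And>x. x \<in> integers \<Longrightarrow> \<exists>r\<in>X. x - r \<in> max_ideal"
proof -
  let ?r = "{(x::'k, y). x \<in> integers \<and> y \<in> integers \<and> x - y \<in> max_ideal}"
  define X where "X = (\<lambda>C. SOME x. x \<in> C) ` (residue_field :: 'k set set)"
  have "\<exists>r\<in>X. x - r \<in> max_ideal" if "x \<in> integers" for x
  proof -
    have "x \<in> ?r `` {x}"
      using that by (simp add: max_ideal_def)
    then have "(SOME y. y \<in> ?r `` {x}) \<in> ?r `` {x}"
      by (rule someI)
    moreover have "?r `` {x} \<in> residue_field"
      unfolding residue_field_def using that by (rule quotientI)
    ultimately show ?thesis
      unfolding X_def by blast
  qed
  moreover have "finite X"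
    unfolding X_def by (intro finite_imageI finite_residue_field)
  ultimately show ?thesis
    using that by blast
qed

text \<open>Truncated digit expansions: a point of the finer net is a residue representative plus
  \<open>p\<close> times a point of the coarser net.\<close>

lemma integers_finite_net:
  fixes p :: "'k::nonarch_local_field"
  assumes "uniformizer p"
  shows "\<exists>X. finite X \<and> (\<forall>x\<in>integers. \<exists>y\<in>X. absval (x - y :: 'k) \<le> absval p ^ n)"
proof (induction n)
  case 0
  show ?case
    by (auto intro!: exI[of _ "{0}"] simp: integers_iff)
next
  case (Suc n)
  then obtain X :: "'k set" where X: "finite X" "\<forall>x\<in>integers. \<exists>y\<in>X. absval (x - y) \<le> absval p ^ n"
    by blast
  obtain R :: "'k set" where R: "finite R" "\<And>x. x \<in> integers \<Longrightarrow> \<exists>r\<in>R. x - r \<in> max_ideal"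
    by (rule residue_field_finite_reps) blast
  have "\<exists>y\<in>(\<lambda>(r, y). r + p * y) ` (R \<times> X). absval (x - y) \<le> absval p ^ Suc n" if x: "x \<in> integers" for x
  proof -
    obtain r where r: "r \<in> R" "x - r \<in> max_ideal"
      using R(2)[OF x] by blast
    then obtain z where z: "z \<in> integers" "x - r = p * z"
      using assms by (auto simp: uniformizer_def)
    then obtain y where y: "y \<in> X" "absval (z - y) \<le> absval p ^ n"
      using X(2) by blast
    have "x - (r + p * y) = p * (z - y)"
      using z(2) by (simp add: algebra_simps)
    then show ?thesis
      using r(1) y by (intro bexI[of _ "r + p * y"]) (auto simp: absval_mult mult_left_mono)
  qed
  then show ?case
    using X(1) R(1) by (intro exI[of _ "(\<lambda>(r, y). r + p * y) ` (R \<times> X)"]) auto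
qed

text \<open>The integers are a closed ball in a complete space, and the nets of truncated digit
  expansions make them totally bounded.\<close>

lemma compact_integers: "compact (integers :: 'k::nonarch_local_field set)"
  unfolding compact_eq_totally_bounded
proof (intro conjI allI impI)
  have "integers = cball (0::'k) 1"
    by (auto simp: integers_iff absval_def dist_commute)
  then show "complete (integers :: 'k set)"
    by (metis complete_eq_closed closed_cball)
next
  obtain p :: 'k where p: "uniformizer p"
    using ex_normalized_uniformizer by blast
  fix e :: real assume "0 < e"
  then obtain n where n: "absval p ^ n < e"
    using real_arch_pow_inv absval_uniformizer_less_1[OF p] by blast
  obtain X :: "'k set" where X: "finite X" "\<forall>x\<in>integers. \<exists>y\<in>X. absval (x - y) \<le> absval p ^ n"
    using integers_finite_net[OF p] by blast
  have "(integers :: 'k set) \<subseteq> (\<Union>x\<in>X. ball x e)"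
  proof
    fix x :: 'k assume "x \<in> integers"
    then obtain y where "y \<in> X" "absval (x - y) \<le> absval p ^ n"
      using X by blast
    then show "x \<in> (\<Union>x\<in>X. ball x e)"
      using n by (intro UN_I[of y]) (auto simp: dist_commute[of y] dist_eq_absval[of x])
  qed
  then show "\<exists>k. finite k \<and> (integers :: 'k set) \<subseteq> (\<Union>x\<in>k. ball x e)"
    using X(1) by blast
qed

text \<open>Together with continuity of multiplication, this brings polynomial maps such as
  determinants and matrix products under the general continuity rules.\<close>

instance nonarch_local_field \<subseteq> topological_ab_group_add
proof
  fix a b :: "'a::nonarch_local_field"
  show "LIM x (nhds a \<times>\<^sub>F nhds b). fst x + snd x :> nhds (a + b)"
    unfolding tendsto_iff
  proof (intro allI impI)
    fix e :: real assume "0 < e"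
    then have "eventually (\<lambda>x. dist x a < e) (nhds a)" "eventually (\<lambda>x. dist x b < e) (nhds b)"
      by (auto simp: eventually_nhds_metric)
    then have "eventually (\<lambda>x. dist (fst x) a < e \<and> dist (snd x) b < e) (nhds a \<times>\<^sub>F nhds b)"
      unfolding eventually_prod_filter by fastforce
    then show "eventually (\<lambda>x. dist (fst x + snd x) (a + b) < e) (nhds a \<times>\<^sub>F nhds b)"
    proof eventually_elim
      case (elim x)
      then show ?case
        using absval_add_le[of "fst x - a" "snd x - b"]
        by (auto simp: dist_eq_absval algebra_simps max_def split: if_splits)
    qed
  qed
  show "(uminus \<longlongrightarrow> - a) (nhds a)"
    unfolding tendsto_iff
  proof (intro allI impI)
    fix e :: real assume "0 < e"
    then have "eventually (\<lambda>x. dist x a < e) (nhds a)"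
      by (auto simp: eventually_nhds_metric)
    then show "eventually (\<lambda>x. dist (- x) (- a) < e) (nhds a)"
    proof eventually_elim
      case (elim x)
      then show ?case
        using absval_minus[of "x - a"] by (simp add: dist_eq_absval)
    qed
  qed
qed

instance nonarch_local_field \<subseteq> topological_comm_monoid_mult
proof
  fix a b :: "'a::nonarch_local_field"
  show "LIM x (nhds a \<times>\<^sub>F nhds b). fst x * snd x :> nhds (a * b)"
    unfolding tendsto_iff
  proof (intro allI impI)
    fix e :: real assume e: "0 < e"
    \<comment> \<open>\<open>M\<close> bounds \<open>absval a\<close> and, because
      \<open>d \<le> 1\<close>, also \<open>absval (snd x)\<close>. By the ultrametric inequality
      the error is at most \<open>d * M\<close>, and the factor 2 in \<open>d\<close> keeps this
      strictly below \<open>e\<close>.\<close>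
    define M where "M = absval a + absval b + 1"
    define d where "d = min 1 (e / (2 * M))"
    have M: "0 < M" "absval a \<le> M" "absval b + 1 \<le> M"
      by (auto simp: M_def add_nonneg_pos)
    have d: "0 < d" "d \<le> 1" "d * M < e"
      using e M by (auto simp: d_def min_def field_simps)
    have "eventually (\<lambda>x. dist x a < d) (nhds a)" "eventually (\<lambda>x. dist x b < d) (nhds b)"
      using d by (auto simp: eventually_nhds_metric)
    then have "eventually (\<lambda>x. dist (fst x) a < d \<and> dist (snd x) b < d) (nhds a \<times>\<^sub>F nhds b)"
      unfolding eventually_prod_filter by fastforce
    then show "eventually (\<lambda>x. dist (fst x * snd x) (a * b) < e) (nhds a \<times>\<^sub>F nhds b)"
    proof eventually_elim
      case (elim x)
      then have x: "absval (fst x - a) < d" "absval (snd x - b) < d"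
        by (auto simp: dist_eq_absval)
      have y: "absval (snd x) \<le> M"
        using absval_add_le[of "snd x - b" b] x(2) d M absval_nonneg[of b] unfolding diff_add_cancel by linarith
      have "fst x * snd x - a * b = (fst x - a) * snd x + a * (snd x - b)"
        by (simp add: algebra_simps)
      moreover have "absval (fst x - a) * absval (snd x) \<le> d * M" "absval a * absval (snd x - b) \<le> M * d"
        using x y M d by (auto intro!: mult_mono)
      ultimately have "absval (fst x * snd x - a * b) \<le> d * M"
        using absval_add_le[of "(fst x - a) * snd x" "a * (snd x - b)"]
        by (simp add: absval_mult mult.commute[of M d])
      then show ?case
        using d by (simp add: dist_eq_absval)
    qed
  qed
qed

text \<open>A high power of \<open>p\<close> moves a bounded sequence into the compact ring of
  integers; the limit of a convergent subsequence is moved back by the inverse power.\<close>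

instance nonarch_local_field \<subseteq> heine_borel
proof
  fix f :: "nat \<Rightarrow> 'a::nonarch_local_field"
  assume "bounded (range f)"
  then obtain e where e: "\<forall>n. absval (f n) \<le> e"
    by (auto simp: bounded_any_center[of _ 0] absval_def dist_commute)
  obtain p :: 'a where p: "uniformizer p"
    using ex_normalized_uniformizer by blast
  have p': "0 < absval p" "absval p < 1"
    using p by (auto simp: uniformizer_nonzero absval_uniformizer_less_1)
  obtain N where N: "e < (1 / absval p) ^ N"
    using real_arch_pow[of "1 / absval p"] p' by auto
  have "f n * p ^ N \<in> integers" for n
  proof -
    have "absval (f n) \<le> 1 / absval p ^ N"
      using e N by (metis less_imp_le order_trans power_one_over)
    then show ?thesis
      using p' by (simp add: integers_iff absval_mult absval_power field_simps)
  qed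
  moreover have "seq_compact (integers :: 'a set)"
    using compact_integers compact_eq_seq_compact_metric by blast
  ultimately obtain l r where lr: "strict_mono (r :: nat \<Rightarrow> nat)" "((\<lambda>n. f n * p ^ N) \<circ> r) \<longlonglongrightarrow> l"
    unfolding seq_compact_def by meson
  have "(\<lambda>n. ((\<lambda>n. f n * p ^ N) \<circ> r) n * inverse (p ^ N)) \<longlonglongrightarrow> l * inverse (p ^ N)"
    by (intro tendsto_mult lr tendsto_const)
  then have "(f \<circ> r) \<longlonglongrightarrow> l * inverse (p ^ N)"
    using uniformizer_nonzero[OF p] by (simp add: o_def mult.assoc)
  then show "\<exists>l r. strict_mono (r :: nat \<Rightarrow> nat) \<and> (f \<circ> r) \<longlonglongrightarrow> l"
    using lr(1) by blast
qed

text \<open>Representatives of \<open>k/\<O>\<close>: those lying in \<open>p\<^sup>-\<^sup>1\<O>\<close> correspond to the residue field.\<close>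

lemma ex_fractional_reps:
  fixes p :: "'k::nonarch_local_field"
  assumes p: "uniformizer p"
  obtains T :: "'k set" where "0 \<in> T" "\<And>x. \<exists>!t. t \<in> T \<and> x - t \<in> integers"
    "card {t \<in> T. p * t \<in> integers} = card (residue_field :: 'k set set)"
proof -
  define S where "S = {(x::'k, y). x - y \<in> integers}"
  have S: "equiv UNIV S"
  proof (intro equivI refl_onI symI transI)
    fix x y z assume "(x, y) \<in> S" "(y, z) \<in> S"
    then show "(x, z) \<in> S"
      using integers_add[of "x - y" "y - z"] by (simp add: S_def)
  next
    fix x y assume "(x, y) \<in> S"
    then show "(y, x) \<in> S"
      using integers_minus[of "x - y"] by (simp add: S_def)
  qed (auto simp: S_def)
  \<comment> \<open>The class of the integers is represented by 0 and not by an arbitrary element,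
    so that an integral member of \<open>T\<close> must vanish.\<close>
  define rep where "rep x = (if x \<in> integers then 0 else (SOME y. (x, y) \<in> S))" for x :: 'k
  have rep: "(x, rep x) \<in> S" for x
    using someI[of "\<lambda>y. (x, y) \<in> S" x] by (auto simp: rep_def S_def)
  have rep_eq: "rep x = rep y" if "(x, y) \<in> S" for x y
  proof -
    have "x \<in> integers \<longleftrightarrow> y \<in> integers"
      using that integers_add[of "x - y" y] integers_diff[of x "x - y"] by (auto simp: S_def)
    moreover have "(\<lambda>z. (x, z) \<in> S) = (\<lambda>z. (y, z) \<in> S)"
      using equiv_class_eq[OF S that] by (auto simp: fun_eq_iff)
    ultimately show ?thesis
      by (simp add: rep_def)
  qed
  define T where "T = range rep"
  have uniq: "\<exists>!t. t \<in> T \<and> x - t \<in> integers" for x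
  proof (rule ex1I[of _ "rep x"])
    show "rep x \<in> T \<and> x - rep x \<in> integers"
      using rep[of x] by (auto simp: T_def S_def)
    fix t assume "t \<in> T \<and> x - t \<in> integers"
    then obtain y where y: "t = rep y" "(x, t) \<in> S"
      by (auto simp: T_def S_def)
    then have "(x, y) \<in> S"
      using rep[of y] S unfolding equiv_def sym_def trans_def by blast
    then show "t = rep x"
      using rep_eq y by simp
  qed
  have 0: "0 \<in> T"
    unfolding T_def by (rule image_eqI[of _ _ 0]) (auto simp: rep_def)
  let ?r = "{(x::'k, y). x \<in> integers \<and> y \<in> integers \<and> x - y \<in> max_ideal}"
  have r: "equiv integers ?r"
  proof (intro equivI refl_onI symI transI)
    fix x y z assume "(x, y) \<in> ?r" "(y, z) \<in> ?r"
    then show "(x, z) \<in> ?r"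
      using absval_add_le[of "x - y" "y - z"] by (auto simp: max_ideal_def)
  next
    fix x y assume "(x, y) \<in> ?r"
    then show "(y, x) \<in> ?r"
      using absval_minus[of "x - y"] by (simp add: max_ideal_def)
  qed (auto simp: max_ideal_def)
  have pm: "p * x \<in> max_ideal \<longleftrightarrow> x \<in> integers" for x
    using absval_less_1_iff[OF p, of "p * x"] uniformizer_nonzero[OF p]
    by (simp add: max_ideal_def integers_iff absval_mult)
  have "bij_betw (\<lambda>t. ?r `` {p * t}) {t \<in> T. p * t \<in> integers} residue_field"
  proof (rule bij_betw_imageI)
    show "inj_on (\<lambda>t. ?r `` {p * t}) {t \<in> T. p * t \<in> integers}"
    proof (rule inj_onI)
      fix t u assume tu: "t \<in> {t \<in> T. p * t \<in> integers}" "u \<in> {t \<in> T. p * t \<in> integers}"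
        "?r `` {p * t} = ?r `` {p * u}"
      then have "(p * t, p * u) \<in> ?r"
        using eq_equiv_class[OF _ r] by blast
      then have "t - u \<in> integers"
        using pm[of "t - u"] by (simp add: algebra_simps)
      then show "t = u"
        using uniq[of t] tu by auto
    qed
    show "(\<lambda>t. ?r `` {p * t}) ` {t \<in> T. p * t \<in> integers} = residue_field"
    proof (intro equalityI subsetI)
      fix C :: "'k set" assume "C \<in> residue_field"
      then obtain x where x: "x \<in> integers" "C = ?r `` {x}"
        unfolding residue_field_def by (auto elim: quotientE)
      obtain t where t: "t \<in> T" "x / p - t \<in> integers"
        using uniq by blast
      have d: "x - p * t \<in> max_ideal"
        using pm[of "x / p - t"] t uniformizer_nonzero[OF p] by (simp add: algebra_simps)
      then have "x - p * t \<in> integers"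
        by (simp add: max_ideal_def integers_def)
      then have pt: "p * t \<in> integers"
        using integers_diff[of x "x - p * t"] x by simp
      then have "?r `` {x} = ?r `` {p * t}"
        using x d by (intro equiv_class_eq[OF r]) auto
      then show "C \<in> (\<lambda>t. ?r `` {p * t}) ` {t \<in> T. p * t \<in> integers}"
        using x t pt by auto
    next
      fix C assume "C \<in> (\<lambda>t. ?r `` {p * t}) ` {t \<in> T. p * t \<in> integers}"
      then show "C \<in> residue_field"
        unfolding residue_field_def by (elim imageE) (simp only: quotientI mem_Collect_eq)
    qed
  qed
  then have "card {t \<in> T. p * t \<in> integers} = card (residue_field :: 'k set set)"
    by (rule bij_betw_same_card)
  then show ?thesis
    using that 0 uniq by blast
qed

section \<open>Sums over cosets\<close>

lemma infsum_eq_sum_support: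
  fixes F :: "'g \<Rightarrow> 'b::{topological_comm_monoid_add, t2_space}"
  assumes "finite S" "S \<subseteq> R" "\<And>r. r \<in> R \<Longrightarrow> r \<notin> S \<Longrightarrow> F r = 0"
  shows "infsum F R = sum F S"
proof -
  have "infsum F R = infsum F S"
    using assms by (intro infsum_cong_neutral) auto
  then show ?thesis
    using assms(1) by simp
qed

lemma infsum_finite_sum:
  fixes f :: "'b \<Rightarrow> 'g \<Rightarrow> complex"
  assumes "finite S" "\<And>x. x \<in> S \<Longrightarrow> f x summable_on A"
  shows "(\<Sum>\<^sub>\<infinity>g\<in>A. \<Sum>x\<in>S. f x g) = (\<Sum>x\<in>S. infsum (f x) A)"
proof -
  have "(\<lambda>g. \<Sum>x\<in>S. f x g) summable_on A \<and> (\<Sum>\<^sub>\<infinity>g\<in>A. \<Sum>x\<in>S. f x g) = (\<Sum>x\<in>S. infsum (f x) A)"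
    using assms by (induction S rule: finite_induct) (auto simp: infsum_add intro!: summable_on_add)
  then show ?thesis ..
qed

text \<open>\<open>R\<close> is a transversal of the left cosets \<open>gK\<close>. The setting is
  abstract because it serves twice: for the full group and for the unipotent radical with its
  integral points.\<close>

locale coset_reps = group G + K: subgroup K G
  for G (structure) and K +
  fixes R
  assumes R_subset: "R \<subseteq> carrier G"
    and ex1_rep: "g \<in> carrier G \<Longrightarrow> \<exists>!r. r \<in> R \<and> inv r \<otimes> g \<in> K"
begin

definition rep :: "'a \<Rightarrow> 'a"
  where "rep g = (THE r. r \<in> R \<and> inv r \<otimes> g \<in> K)"

definition right_invariant :: "('a \<Rightarrow> complex) \<Rightarrow> bool"
  where "right_invariant F \<longleftrightarrow> (\<forall>g\<in>carrier G. \<forall>k\<in>K. F (g \<otimes> k) = F g)"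

text \<open>Finite support on \<open>R\<close> stands in for compact support;
  \<open>hecke_algebra_iff_hecke_fun\<close> shows that the two agree. Complex values are allowed so
  that one notion covers every coefficient ring.\<close>

definition hecke_fun :: "('a \<Rightarrow> complex) \<Rightarrow> bool"
  where "hecke_fun f \<longleftrightarrow> (\<forall>x. x \<notin> carrier G \<longrightarrow> f x = 0) \<and>
    (\<forall>k\<in>K. \<forall>x\<in>carrier G. \<forall>k'\<in>K. f (k \<otimes> x \<otimes> k') = f x) \<and> finite {r \<in> R. f r \<noteq> 0}"

text \<open>Convolution with the Haar integral already replaced by a sum over cosets. For
  bi-invariant functions the summand depends only on the coset of \<open>x\<close>.\<close>

definition conv :: "('a \<Rightarrow> complex) \<Rightarrow> ('a \<Rightarrow> complex) \<Rightarrow> 'a \<Rightarrow> complex"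
  where "conv f1 f2 g = (if g \<in> carrier G then \<Sum>\<^sub>\<infinity>x\<in>R. f1 x * f2 (inv x \<otimes> g) else 0)"

lemma R_carrier: "r \<in> R \<Longrightarrow> r \<in> carrier G"
  using R_subset by blast

lemma rep_mem: "g \<in> carrier G \<Longrightarrow> rep g \<in> R"
  and rep_inv_mult: "g \<in> carrier G \<Longrightarrow> inv (rep g) \<otimes> g \<in> K"
  unfolding rep_def using theI'[OF ex1_rep] by blast+

lemma rep_carrier: "g \<in> carrier G \<Longrightarrow> rep g \<in> carrier G"
  using rep_mem R_carrier by blast

lemma rep_eqI: "g \<in> carrier G \<Longrightarrow> r \<in> R \<Longrightarrow> inv r \<otimes> g \<in> K \<Longrightarrow> rep g = r"
  using ex1_rep[of g] rep_mem[of g] rep_inv_mult[of g] by blast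

lemma rep_of_rep: "r \<in> R \<Longrightarrow> rep r = r"
  by (intro rep_eqI) (auto simp: R_carrier)

lemma rep_mult_right:
  assumes "g \<in> carrier G" "k \<in> K"
  shows "rep (g \<otimes> k) = rep g"
proof (rule rep_eqI)
  have "inv (rep g) \<otimes> (g \<otimes> k) = (inv (rep g) \<otimes> g) \<otimes> k"
    using assms by (simp add: m_assoc rep_carrier)
  then show "inv (rep g) \<otimes> (g \<otimes> k) \<in> K"
    using assms by (simp add: rep_inv_mult)
qed (use assms in \<open>auto simp: rep_mem\<close>)

lemma eq_rep_mult: "g \<in> carrier G \<Longrightarrow> g = rep g \<otimes> (inv (rep g) \<otimes> g)"
  by (simp add: rep_carrier flip: m_assoc)

lemma right_invariantD: "right_invariant F \<Longrightarrow> g \<in> carrier G \<Longrightarrow> k \<in> K \<Longrightarrow> F (g \<otimes> k) = F g"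
  by (simp add: right_invariant_def)

lemma right_invariant_rep: "right_invariant F \<Longrightarrow> g \<in> carrier G \<Longrightarrow> F (rep g) = F g"
  using right_invariantD[of F "rep g" "inv (rep g) \<otimes> g"] eq_rep_mult[of g]
  by (simp add: rep_carrier rep_inv_mult)

lemma right_invariant_mult:
  "right_invariant F1 \<Longrightarrow> right_invariant F2 \<Longrightarrow> right_invariant (\<lambda>g. F1 g * F2 g)"
  by (simp add: right_invariant_def)

section \<open>Left translation on the set of cosets\<close>

lemma rep_translate_inverse:
  assumes "a \<in> carrier G" "r \<in> R"
  shows "rep (inv a \<otimes> rep (a \<otimes> r)) = r"
proof -
  define k where "k = inv (rep (a \<otimes> r)) \<otimes> (a \<otimes> r)"
  have k: "k \<in> K" "a \<otimes> r = rep (a \<otimes> r) \<otimes> k"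
    using assms by (auto simp: k_def rep_inv_mult R_carrier intro!: eq_rep_mult)
  have cl: "rep (a \<otimes> r) \<in> carrier G" "r \<in> carrier G"
    using assms by (auto simp: rep_carrier R_carrier)
  have "(inv a \<otimes> rep (a \<otimes> r)) \<otimes> k = inv a \<otimes> (a \<otimes> r)"
    using k cl assms by (simp add: m_assoc)
  also have "\<dots> = r"
    using assms cl by (simp flip: m_assoc)
  finally have "rep (inv a \<otimes> rep (a \<otimes> r)) = rep r"
    using rep_mult_right[of "inv a \<otimes> rep (a \<otimes> r)" k] k cl assms by simp
  then show ?thesis
    using rep_of_rep assms by simp
qed

lemma bij_betw_rep_translate:
  assumes "a \<in> carrier G"
  shows "bij_betw (\<lambda>r. rep (a \<otimes> r)) R R"
  using rep_translate_inverse[of a] rep_translate_inverse[of "inv a"] assms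
  by (intro bij_betw_byWitness[of _ "\<lambda>r. rep (inv a \<otimes> r)"]) (auto simp: rep_mem R_carrier)

text \<open>Left translation permutes the cosets \<open>gK\<close>. This is the discrete counterpart
  of left invariance of the Haar measure.\<close>

lemma infsum_translate:
  assumes "right_invariant F" "a \<in> carrier G"
  shows "(\<Sum>\<^sub>\<infinity>r\<in>R. F (a \<otimes> r)) = infsum F R"
proof -
  have "(\<Sum>\<^sub>\<infinity>r\<in>R. F (a \<otimes> r)) = (\<Sum>\<^sub>\<infinity>r\<in>R. F (rep (a \<otimes> r)))"
    using assms by (intro infsum_cong) (simp add: right_invariant_rep R_carrier)
  also have "\<dots> = infsum F R"
    using bij_betw_rep_translate[OF assms(2)] by (rule infsum_reindex_bij_betw)
  finally show ?thesis .
qed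

lemma finite_support_translate:
  assumes "right_invariant F" "a \<in> carrier G" "finite {r \<in> R. F r \<noteq> 0}"
  shows "finite {r \<in> R. F (a \<otimes> r) \<noteq> 0}"
proof (rule inj_on_finite)
  show "inj_on (\<lambda>r. rep (a \<otimes> r)) {r \<in> R. F (a \<otimes> r) \<noteq> 0}"
    using bij_betw_rep_translate[OF assms(2)] by (auto simp: bij_betw_def inj_on_def)
  show "(\<lambda>r. rep (a \<otimes> r)) ` {r \<in> R. F (a \<otimes> r) \<noteq> 0} \<subseteq> {r \<in> R. F r \<noteq> 0}"
    using assms by (auto simp: rep_mem R_carrier right_invariant_rep)
qed (rule assms)

lemma finite_support_mult:
  "finite {r \<in> R. F r \<noteq> 0} \<Longrightarrow> finite {r \<in> R. F r * H r \<noteq> (0::complex)}"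
  by (rule finite_subset[rotated]) auto

lemma infsum_finite_support:
  fixes F :: "'a \<Rightarrow> complex"
  assumes "finite {r \<in> R. F r \<noteq> 0}"
  shows "infsum F R = (\<Sum>r | r \<in> R \<and> F r \<noteq> 0. F r)"
  using assms by (intro infsum_eq_sum_support) auto

lemma summable_finite_support:
  fixes F :: "'a \<Rightarrow> complex"
  assumes "finite {r \<in> R. F r \<noteq> 0}"
  shows "F summable_on R"
proof -
  have "F summable_on {r \<in> R. F r \<noteq> 0} \<longleftrightarrow> F summable_on R"
    by (rule summable_on_cong_neutral) auto
  then show ?thesis
    using assms by simp
qed

section \<open>Convolution of bi-invariant functions\<close>

lemma hecke_fun_outside: "hecke_fun f \<Longrightarrow> x \<notin> carrier G \<Longrightarrow> f x = 0"
  and hecke_fun_bi_invariant: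
    "hecke_fun f \<Longrightarrow> k \<in> K \<Longrightarrow> x \<in> carrier G \<Longrightarrow> k' \<in> K \<Longrightarrow> f (k \<otimes> x \<otimes> k') = f x"
  and hecke_fun_finite: "hecke_fun f \<Longrightarrow> finite {r \<in> R. f r \<noteq> 0}"
  by (simp_all add: hecke_fun_def)

lemma hecke_fun_left: "hecke_fun f \<Longrightarrow> k \<in> K \<Longrightarrow> x \<in> carrier G \<Longrightarrow> f (k \<otimes> x) = f x"
  using hecke_fun_bi_invariant[of f k x \<one>] by simp

lemma hecke_fun_right_invariant: "hecke_fun f \<Longrightarrow> right_invariant f"
  using hecke_fun_bi_invariant[of f \<one>] by (auto simp: right_invariant_def)

lemma hecke_fun_right: "hecke_fun f \<Longrightarrow> k \<in> K \<Longrightarrow> x \<in> carrier G \<Longrightarrow> f (x \<otimes> k) = f x"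
  using hecke_fun_right_invariant right_invariantD by blast

text \<open>Replacing \<open>x\<close> by \<open>x \<otimes> k\<close> puts \<open>inv k\<close> in
  front of the argument of \<open>f2\<close>, where left invariance absorbs it.\<close>

lemma conv_integrand_right_invariant:
  assumes f1: "hecke_fun f1" and f2: "hecke_fun f2" and g: "g \<in> carrier G"
  shows "right_invariant (\<lambda>x. f1 x * f2 (inv x \<otimes> g))"
  unfolding right_invariant_def
proof (intro ballI)
  fix x k assume x: "x \<in> carrier G" and k: "k \<in> K"
  have "inv (x \<otimes> k) \<otimes> g = inv k \<otimes> (inv x \<otimes> g)"
    using x k g by (simp add: inv_mult_group m_assoc)
  then show "f1 (x \<otimes> k) * f2 (inv (x \<otimes> k) \<otimes> g) = f1 x * f2 (inv x \<otimes> g)"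
    using x k g f1 f2 by (simp add: hecke_fun_left hecke_fun_right)
qed

lemma conv_eq_sum:
  assumes "hecke_fun f1" "g \<in> carrier G"
  shows "conv f1 f2 g = (\<Sum>x | x \<in> R \<and> f1 x \<noteq> 0. f1 x * f2 (inv x \<otimes> g))"
  unfolding conv_def using assms hecke_fun_finite[of f1] by (auto intro!: infsum_eq_sum_support)

lemma conv_in_Ints:
  assumes "hecke_fun f1" "range f1 \<subseteq> \<int>" "range f2 \<subseteq> \<int>"
  shows "range (conv f1 f2) \<subseteq> \<int>"
proof -
  have "conv f1 f2 g \<in> \<int>" for g
  proof (cases "g \<in> carrier G")
    case True
    then show ?thesis
      using assms by (auto simp: conv_eq_sum intro!: Ints_sum Ints_mult)
  qed (simp add: conv_def)
  then show ?thesis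
    by blast
qed

text \<open>Left invariance comes from substituting \<open>inv k \<otimes> y\<close> for the
  summation variable. The support is finite because it is covered by translates of the support of
  \<open>f2\<close>, one for each of the finitely many \<open>x\<close> in \<open>R\<close> with
  \<open>f1 x \<noteq> 0\<close>.\<close>

lemma hecke_fun_conv:
  assumes f1: "hecke_fun f1" and f2: "hecke_fun f2"
  shows "hecke_fun (conv f1 f2)"
  unfolding hecke_fun_def
proof (intro conjI ballI allI impI)
  fix k x k' assume k: "k \<in> K" and x: "x \<in> carrier G" and k': "k' \<in> K"
  have *: "f1 y * f2 (inv y \<otimes> (k \<otimes> x \<otimes> k')) = (\<lambda>z. f1 z * f2 (inv z \<otimes> x)) (inv k \<otimes> y)" if y: "y \<in> R" for y
  proof -
    have "inv y \<otimes> (k \<otimes> x \<otimes> k') = (inv y \<otimes> k \<otimes> x) \<otimes> k'"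
      using x k k' y by (simp add: m_assoc R_carrier)
    moreover have "inv (inv k \<otimes> y) \<otimes> x = inv y \<otimes> k \<otimes> x"
      using x k k' y by (simp add: inv_mult_group R_carrier)
    ultimately show ?thesis
      using x k k' y f1 f2 by (simp add: hecke_fun_left hecke_fun_right R_carrier)
  qed
  have "conv f1 f2 (k \<otimes> x \<otimes> k') = (\<Sum>\<^sub>\<infinity>y\<in>R. (\<lambda>z. f1 z * f2 (inv z \<otimes> x)) (inv k \<otimes> y))"
    unfolding conv_def using x k k' * by (auto intro!: infsum_cong)
  also have "\<dots> = conv f1 f2 x"
    using x k conv_integrand_right_invariant[OF f1 f2 x] by (subst infsum_translate) (auto simp: conv_def)
  finally show "conv f1 f2 (k \<otimes> x \<otimes> k') = conv f1 f2 x" .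
next
  have "{r \<in> R. conv f1 f2 r \<noteq> 0} \<subseteq> (\<Union>x\<in>{x \<in> R. f1 x \<noteq> 0}. {r \<in> R. f2 (inv x \<otimes> r) \<noteq> 0})"
  proof
    fix r assume r: "r \<in> {r \<in> R. conv f1 f2 r \<noteq> 0}"
    then have "(\<Sum>x | x \<in> R \<and> f1 x \<noteq> 0. f1 x * f2 (inv x \<otimes> r)) \<noteq> 0"
      using conv_eq_sum[OF f1, of r f2] by (auto simp: R_carrier)
    then obtain x where "x \<in> R" "f1 x \<noteq> 0" "f1 x * f2 (inv x \<otimes> r) \<noteq> 0"
      by (auto elim: sum.not_neutral_contains_not_neutral)
    then show "r \<in> (\<Union>x\<in>{x \<in> R. f1 x \<noteq> 0}. {r \<in> R. f2 (inv x \<otimes> r) \<noteq> 0})"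
      using r by auto
  qed
  moreover have "finite \<dots>"
    using f1 f2 by (intro finite_UN_I finite_support_translate)
      (auto simp: hecke_fun_finite hecke_fun_right_invariant R_carrier)
  ultimately show "finite {r \<in> R. conv f1 f2 r \<noteq> 0}"
    by (rule finite_subset)
qed (simp add: conv_def)

text \<open>The sum over the finite support of \<open>f1\<close> is moved outside, and the inner sum
  is translated by \<open>inv x\<close>. Multiplicativity is asked only for left factors in
  \<open>R\<close>, since the intended \<open>\<psi>\<close> is a character on the triangular part
  and not on the whole group.\<close>

lemma infsum_conv_character:
  assumes f1: "hecke_fun f1" and f2: "hecke_fun f2" and \<psi>: "right_invariant \<psi>"
    and mult: "\<And>r g. r \<in> R \<Longrightarrow> g \<in> carrier G \<Longrightarrow> \<psi> (r \<otimes> g) = \<psi> r * \<psi> g"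
  shows "(\<Sum>\<^sub>\<infinity>g\<in>R. conv f1 f2 g * \<psi> g) = (\<Sum>\<^sub>\<infinity>g\<in>R. f1 g * \<psi> g) * (\<Sum>\<^sub>\<infinity>g\<in>R. f2 g * \<psi> g)"
proof -
  let ?S = "{x \<in> R. f1 x \<noteq> 0}"
  have inv2: "right_invariant (\<lambda>g. f2 g * \<psi> g)"
    using hecke_fun_right_invariant[OF f2] \<psi> by (rule right_invariant_mult)
  have eq: "\<psi> g * f2 (inv x \<otimes> g) = \<psi> x * (f2 (inv x \<otimes> g) * \<psi> (inv x \<otimes> g))" if "x \<in> R" "g \<in> R" for x g
    using mult[of x "inv x \<otimes> g"] that by (simp add: R_carrier flip: m_assoc)
  have summ: "(\<lambda>g. f2 (inv x \<otimes> g) * \<psi> (inv x \<otimes> g)) summable_on R" if "x \<in> R" for x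
  proof (rule summable_finite_support)
    show "finite {g \<in> R. f2 (inv x \<otimes> g) * \<psi> (inv x \<otimes> g) \<noteq> 0}"
      using f2 that by (intro finite_support_mult finite_support_translate)
        (auto simp: hecke_fun_finite hecke_fun_right_invariant R_carrier)
  qed
  have "(\<Sum>\<^sub>\<infinity>g\<in>R. conv f1 f2 g * \<psi> g)
      = (\<Sum>\<^sub>\<infinity>g\<in>R. \<Sum>x\<in>?S. f1 x * \<psi> x * (f2 (inv x \<otimes> g) * \<psi> (inv x \<otimes> g)))"
    using f1 by (intro infsum_cong)
      (auto simp: conv_eq_sum R_carrier sum_distrib_right eq mult.assoc mult.commute[of "f2 _" "\<psi> _"] intro!: sum.cong)
  also have "\<dots> = (\<Sum>x\<in>?S. \<Sum>\<^sub>\<infinity>g\<in>R. f1 x * \<psi> x * (f2 (inv x \<otimes> g) * \<psi> (inv x \<otimes> g)))"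
    using summ hecke_fun_finite[OF f1] by (intro infsum_finite_sum summable_on_cmult_right) auto
  also have "\<dots> = (\<Sum>x\<in>?S. f1 x * \<psi> x * (\<Sum>\<^sub>\<infinity>g\<in>R. f2 g * \<psi> g))"
  proof (intro sum.cong refl)
    fix x assume "x \<in> ?S"
    then show "(\<Sum>\<^sub>\<infinity>g\<in>R. f1 x * \<psi> x * (f2 (inv x \<otimes> g) * \<psi> (inv x \<otimes> g))) = f1 x * \<psi> x * (\<Sum>\<^sub>\<infinity>g\<in>R. f2 g * \<psi> g)"
      using infsum_translate[OF inv2, of "inv x"] by (simp add: infsum_cmult_right' R_carrier)
  qed
  also have "\<dots> = (\<Sum>x\<in>?S. f1 x * \<psi> x) * (\<Sum>\<^sub>\<infinity>g\<in>R. f2 g * \<psi> g)"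
    by (simp add: sum_distrib_right)
  also have "(\<Sum>x\<in>?S. f1 x * \<psi> x) = (\<Sum>\<^sub>\<infinity>g\<in>R. f1 g * \<psi> g)"
    using f1 by (intro infsum_eq_sum_support[symmetric]) (auto simp: hecke_fun_finite)
  finally show ?thesis .
qed

end

locale haar_coset_reps = coset_reps +
  fixes \<mu>
  assumes space_eq: "space \<mu> = carrier G"
    and left_invariant: "g \<in> carrier G \<Longrightarrow> A \<in> sets \<mu> \<Longrightarrow> emeasure \<mu> (g <# A) = emeasure \<mu> A"
    and emeasure_K: "emeasure \<mu> K = 1"
begin

lemma K_in_sets: "K \<in> sets \<mu>"
  using emeasure_K emeasure_notin_sets[of K \<mu>] by auto

lemma emeasure_coset: "g \<in> carrier G \<Longrightarrow> emeasure \<mu> (g <# K) = 1"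
  using left_invariant K_in_sets emeasure_K by simp

text \<open>Sets outside the \<open>\<sigma>\<close>-algebra have measure \<open>0\<close>, so the cosets are measurable.\<close>

lemma coset_in_sets: "g \<in> carrier G \<Longrightarrow> g <# K \<in> sets \<mu>"
  using emeasure_coset[of g] emeasure_notin_sets[of "g <# K" \<mu>] by auto

lemma mem_coset_iff:
  assumes "r \<in> R" "x \<in> carrier G"
  shows "x \<in> r <# K \<longleftrightarrow> rep x = r"
proof
  assume "x \<in> r <# K"
  then obtain k where "k \<in> K" "x = r \<otimes> k"
    by (auto simp: l_coset_def)
  then show "rep x = r"
    using assms by (simp add: rep_mult_right R_carrier rep_of_rep)
next
  assume "rep x = r"
  then have "x = r \<otimes> (inv r \<otimes> x)" "inv r \<otimes> x \<in> K"
    using eq_rep_mult[OF assms(2)] rep_inv_mult[OF assms(2)] by auto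
  then show "x \<in> r <# K"
    unfolding l_coset_def by blast
qed

text \<open>On the group, \<open>F\<close> is a finite linear combination of indicators of cosets
  \<open>r <# K\<close>, each of which has measure 1 by left invariance.\<close>

lemma integral_eq_infsum:
  assumes F: "right_invariant F" and fin: "finite {r \<in> R. F r \<noteq> 0}"
  shows "(LINT x|\<mu>. F x) = infsum F R"
proof -
  let ?S = "{r \<in> R. F r \<noteq> 0}"
  have "(LINT x|\<mu>. F x) = (LINT x|\<mu>. (\<Sum>r\<in>?S. indicator (r <# K) x *\<^sub>R F r))"
  proof (intro Bochner_Integration.integral_cong refl)
    fix x assume "x \<in> space \<mu>"
    then have x: "x \<in> carrier G"
      by (simp add: space_eq)
    have "(\<Sum>r\<in>?S. indicator (r <# K) x *\<^sub>R F r) = (\<Sum>r\<in>?S. if rep x = r then F r else 0)"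
      using x by (intro sum.cong) (auto simp: mem_coset_iff indicator_def)
    also have "\<dots> = (if rep x \<in> ?S then F (rep x) else 0)"
      using fin by (simp add: sum.delta')
    also have "\<dots> = F x"
      using F x by (auto simp: right_invariant_rep rep_mem)
    finally show "F x = (\<Sum>r\<in>?S. indicator (r <# K) x *\<^sub>R F r)"
      by simp
  qed
  also have "\<dots> = (\<Sum>r\<in>?S. F r)"
  proof -
    have "has_bochner_integral \<mu> (\<lambda>x. indicator (r <# K) x *\<^sub>R F r) (measure \<mu> (r <# K) *\<^sub>R F r)" if "r \<in> ?S" for r
      using that coset_in_sets emeasure_coset by (intro has_bochner_integral_indicator) (auto simp: R_carrier)
    then have "has_bochner_integral \<mu> (\<lambda>x. \<Sum>r\<in>?S. indicator (r <# K) x *\<^sub>R F r)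
        (\<Sum>r\<in>?S. measure \<mu> (r <# K) *\<^sub>R F r)"
      by (rule has_bochner_integral_sum)
    moreover have "measure \<mu> (r <# K) = 1" if "r \<in> ?S" for r
      using that emeasure_coset by (simp add: R_carrier measure_def)
    ultimately show ?thesis
      by (simp add: has_bochner_integral_integral_eq)
  qed
  finally show ?thesis
    using infsum_finite_support[OF fin] by simp
qed

end

section \<open>General linear groups over a local field\<close>

lemma integers_det:
  fixes A :: "'k::nonarch_local_field^'n^'n"
  assumes "\<And>i j. A $ i $ j \<in> integers"
  shows "det A \<in> integers"
  unfolding det_def using assms by (intro integers_sum integers_mult integers_prod integers_of_int)

lemma matrix_inv_mult:
  fixes A :: "'k::field^'n^'n"
  assumes "invertible A"
  shows "A ** matrix_inv A = mat 1" "matrix_inv A ** A = mat 1"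
  using someI_ex[OF assms[unfolded invertible_def]] by (auto simp: matrix_inv_def)

lemma invertible_matrix_inv: "invertible A \<Longrightarrow> invertible (matrix_inv (A::'k::field^'n^'n))"
  unfolding invertible_def[of "matrix_inv A"] by (blast intro: matrix_inv_mult)

lemma matrix_inv_unique:
  fixes A :: "'k::field^'n^'n"
  assumes "A ** B = mat 1"
  shows "matrix_inv A = B"
proof -
  have "invertible A"
    using assms matrix_left_right_inverse by (auto simp: invertible_def)
  then have "matrix_inv A ** (A ** B) = B"
    by (simp add: matrix_mul_assoc matrix_inv_mult)
  then show ?thesis
    using assms by simp
qed

lemma group_GL: "group (GL :: ('k::field^'n^'n) monoid)"
proof (rule groupI)
  fix A :: "'k^'n^'n" assume "A \<in> carrier GL"
  then show "\<exists>B\<in>carrier GL. B \<otimes>\<^bsub>GL\<^esub> A = \<one>\<^bsub>GL\<^esub>"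
    by (intro bexI[of _ "matrix_inv A"]) (auto simp: GL_def matrix_inv_mult invertible_matrix_inv)
qed (auto simp: GL_def invertible_mult matrix_mul_assoc invertible_det_nz det_mul)

lemma carrier_GL: "A \<in> carrier GL \<longleftrightarrow> invertible A"
  by (simp add: GL_def)

lemma carrier_GL_det: "(A::'k::field^'n^'n) \<in> carrier GL \<longleftrightarrow> det A \<noteq> 0"
  by (simp add: GL_def invertible_det_nz)

lemma mult_GL: "A \<otimes>\<^bsub>GL\<^esub> B = A ** B"
  and one_GL: "\<one>\<^bsub>GL\<^esub> = mat 1"
  by (simp_all add: GL_def)

lemma inv_GL: "(A::'k::field^'n^'n) \<in> carrier GL \<Longrightarrow> inv\<^bsub>GL\<^esub> A = matrix_inv A"
  by (rule group.inv_equality[OF group_GL]) (auto simp: GL_def matrix_inv_mult invertible_matrix_inv)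

text \<open>If matrix and inverse are both integral, two numbers of absolute value at most 1 have
  product of absolute value 1. Conversely, Cramer's rule writes the entries of the inverse as
  integral determinants divided by a unit. The criterion avoids the inverse, so it suits both
  topology and explicit matrices.\<close>

lemma GL_integers_iff:
  fixes A :: "'k::nonarch_local_field^'n^'n"
  shows "A \<in> GL_integers \<longleftrightarrow> (\<forall>i j. A $ i $ j \<in> integers) \<and> absval (det A) = 1"
proof
  assume A: "A \<in> GL_integers"
  then have "det A * det (matrix_inv A) = 1"
    using matrix_inv_mult[of A] by (simp add: GL_integers_def carrier_GL flip: det_mul)
  then have "absval (det A) * absval (det (matrix_inv A)) = 1"
    by (metis absval_1 absval_mult)
  moreover have "absval (det A) \<le> 1" "absval (det (matrix_inv A)) \<le> 1"
    using A integers_det[of A] integers_det[of "matrix_inv A"] by (auto simp: GL_integers_def integers_iff)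
  ultimately have "absval (det A) = 1"
    by (metis absval_nonneg mult_left_le mult.commute order_antisym)
  then show "(\<forall>i j. A $ i $ j \<in> integers) \<and> absval (det A) = 1"
    using A by (simp add: GL_integers_def)
next
  assume A: "(\<forall>i j. A $ i $ j \<in> integers) \<and> absval (det A) = 1"
  then have d: "det A \<noteq> 0"
    by auto
  then have inv: "invertible A"
    by (simp add: invertible_det_nz)
  have "matrix_inv A $ i $ j \<in> integers" for i j
  proof -
    have "A *v column j (matrix_inv A) = axis j 1"
      using matrix_inv_mult(1)[OF inv]
      by (simp add: vec_eq_iff matrix_vector_mult_def matrix_matrix_mult_def column_def mat_def axis_def)
    then have "column j (matrix_inv A) $ i = det (\<chi> k l. if l = i then axis j 1 $ k else A $ k $ l) / det A"
      using cramer[OF d] by auto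
    moreover have "det (\<chi> k l. if l = i then axis j 1 $ k else A $ k $ l) \<in> integers"
      using A by (intro integers_det) (auto simp: axis_def)
    ultimately show ?thesis
      using A by (simp add: column_def integers_iff absval_divide)
  qed
  then show "A \<in> GL_integers"
    using A inv by (simp add: GL_integers_def carrier_GL)
qed

lemma subgroup_GL_integers: "subgroup (GL_integers :: ('k::nonarch_local_field^'n^'n) set) GL"
proof
  fix A B :: "'k^'n^'n" assume "A \<in> GL_integers" "B \<in> GL_integers"
  then show "A \<otimes>\<^bsub>GL\<^esub> B \<in> GL_integers"
    unfolding GL_integers_iff mult_GL det_mul absval_mult
    by (auto simp: matrix_matrix_mult_def intro!: integers_sum integers_mult)
next
  fix A :: "'k^'n^'n" assume A: "A \<in> GL_integers"
  then have "matrix_inv (matrix_inv A) = A"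
    by (intro matrix_inv_unique matrix_inv_mult) (simp add: GL_integers_def carrier_GL)
  then show "inv\<^bsub>GL\<^esub> A \<in> GL_integers"
    using A by (auto simp: GL_integers_def inv_GL carrier_GL invertible_matrix_inv)
next
  show "GL_integers \<subseteq> carrier (GL :: ('k^'n^'n) monoid)"
    by (auto simp: GL_integers_def)
  show "\<one>\<^bsub>GL\<^esub> \<in> (GL_integers :: ('k^'n^'n) set)"
    unfolding GL_integers_iff one_GL by (simp add: mat_def[of "1::'k"]) (simp flip: mat_def)
qed

section \<open>Topology of the integral points\<close>

lemma open_integers: "open (integers :: 'k::nonarch_local_field set)"
proof -
  have "integers = (\<Union>x\<in>integers. ball (x::'k) 1)"
  proof (intro equalityI subsetI)
    fix y :: 'k assume "y \<in> (\<Union>x\<in>integers. ball x 1)"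
    then obtain x where "x \<in> integers" "absval (x - y) < 1"
      by (auto simp: dist_eq_absval)
    then show "y \<in> integers"
      using integers_diff[of x "x - y"] by (simp add: integers_iff)
  next
    fix y :: 'k assume "y \<in> integers"
    then show "y \<in> (\<Union>x\<in>integers. ball x 1)"
      by (intro UN_I[of y]) auto
  qed
  then show ?thesis
    by (metis open_UN open_ball)
qed

lemma absval_1_sets:
  "open {x::'k::nonarch_local_field. absval x = 1}" "closed {x::'k::nonarch_local_field. absval x = 1}"
proof -
  have "closed {x::'k. absval x = 1}"
    unfolding absval_def by (intro closed_Collect_eq continuous_intros)
  moreover have "{x::'k. absval x = 1} = integers \<inter> {x. 1 \<le> absval x}"
    by (auto simp: integers_iff)
  moreover have "open {x::'k. 1 \<le> absval x}"
  proof -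
    have "{x::'k. 1 \<le> absval x} = (\<Union>x\<in>{x. 1 \<le> absval x}. ball (x::'k) 1)"
    proof (intro equalityI subsetI)
      fix y :: 'k assume "y \<in> (\<Union>x\<in>{x. 1 \<le> absval x}. ball x 1)"
      then obtain x where x: "1 \<le> absval x" "absval (x - y) < 1"
        by (auto simp: dist_eq_absval)
      \<comment> \<open>A perturbation \<open>x - y\<close> smaller than \<open>x\<close> does not
        change the absolute value, so the unit ball around \<open>x\<close> stays in the
        set.\<close>
      then have "absval (x - (x - y)) = absval x"
        using absval_add_eq[of "- (x - y)" x] absval_minus[of "x - y"] by simp
      then show "y \<in> {x. 1 \<le> absval x}"
        using x by simp
    qed auto
    then show ?thesis
      by (metis open_UN open_ball)
  qed
  ultimately show "open {x::'k. absval x = 1}" "closed {x::'k. absval x = 1}"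
    using open_integers by (metis open_Int)+
qed

lemma continuous_on_det:
  "continuous_on UNIV (\<lambda>A::'k::nonarch_local_field^'n^'n. det A)"
  unfolding det_def by (intro continuous_intros continuous_on_prod')

lemma GL_integers_eq:
  "(GL_integers :: ('k::nonarch_local_field^'n^'n) set)
    = (\<Inter>i. \<Inter>j. (\<lambda>A. A $ i $ j) -` integers) \<inter> det -` {x. absval x = 1}"
  by (auto simp: GL_integers_iff)

lemma open_GL_integers: "open (GL_integers :: ('k::nonarch_local_field^'n^'n) set)"
  unfolding GL_integers_eq
  by (intro open_Int open_INT open_vimage finite ballI continuous_on_det absval_1_sets open_integers continuous_intros)

lemma closed_GL_integers: "closed (GL_integers :: ('k::nonarch_local_field^'n^'n) set)"
  unfolding GL_integers_eq
  by (intro closed_Int closed_INT closed_vimage ballI continuous_on_det absval_1_sets continuous_intros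
      compact_imp_closed compact_integers)

lemma dist_vec_le_sum: "dist x y \<le> (\<Sum>i\<in>UNIV. dist (x $ i) (y $ i))"
  unfolding dist_vec_def by (rule L2_set_le_sum) simp

lemma compact_GL_integers: "compact (GL_integers :: ('k::nonarch_local_field^'n^'n) set)"
proof -
  have "dist 0 A \<le> (\<Sum>i\<in>(UNIV::'n set). \<Sum>j\<in>(UNIV::'n set). 1)" if "A \<in> GL_integers" for A :: "'k^'n^'n"
  proof -
    have "dist 0 A \<le> (\<Sum>i\<in>UNIV. \<Sum>j\<in>UNIV. dist (0 $ i $ j) (A $ i $ j))"
      by (rule order_trans[OF dist_vec_le_sum sum_mono[OF dist_vec_le_sum]])
    also have "\<dots> \<le> (\<Sum>i\<in>(UNIV::'n set). \<Sum>j\<in>(UNIV::'n set). 1)"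
      using that by (intro sum_mono) (auto simp: GL_integers_iff integers_iff dist_commute[of 0] absval_def)
    finally show ?thesis .
  qed
  then have "bounded (GL_integers :: ('k^'n^'n) set)"
    unfolding bounded_any_center[of _ 0] by blast
  then show ?thesis
    using closed_GL_integers compact_eq_bounded_closed by blast
qed

lemma continuous_on_matrix_mult:
  fixes f g :: "'b::topological_space \<Rightarrow> 'k::nonarch_local_field^'n^'n"
  assumes "continuous_on S f" "continuous_on S g"
  shows "continuous_on S (\<lambda>x. f x ** g x)"
  unfolding matrix_matrix_mult_def
  by (intro continuous_on_vec_lambda continuous_on_sum continuous_on_mult' continuous_on_component assms)

section \<open>The product group, its cosets and its Hecke functions\<close>

abbreviation mult32 :: "'a::field mat32 \<Rightarrow> 'a mat32 \<Rightarrow> 'a mat32"  (infixl "\<star>" 70)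
  where "x \<star> y \<equiv> x \<otimes>\<^bsub>GL32\<^esub> y"

lemma group_GL32: "group (GL32 :: ('k::field) mat32 monoid)"
  unfolding GL32_def by (intro DirProd_group group_GL)

lemma carrier_GL32: "(A, B) \<in> carrier GL32 \<longleftrightarrow> A \<in> carrier GL \<and> B \<in> carrier GL"
  by (simp add: GL32_def)

lemma carrier_GL32': "x \<in> carrier GL32 \<longleftrightarrow> det (fst x) \<noteq> 0 \<and> det (snd x) \<noteq> 0"
  by (cases x) (simp add: carrier_GL32 carrier_GL_det)

lemma mult_GL32: "x \<star> y = (fst x ** fst y, snd x ** snd y)"
  by (cases x; cases y) (simp add: GL32_def mult_GL)

lemma one_GL32: "\<one>\<^bsub>GL32\<^esub> = (mat 1, mat 1)"
  by (simp add: GL32_def one_GL)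

lemma subgroup_GL32_integers: "subgroup (GL32_integers :: ('k::nonarch_local_field) mat32 set) GL32"
  unfolding GL32_def GL32_integers_def by (intro DirProd_subgroups group_GL subgroup_GL_integers)

lemma open_GL32_integers: "open (GL32_integers :: ('k::nonarch_local_field) mat32 set)"
  unfolding GL32_integers_def by (intro open_Times open_GL_integers)

lemma compact_GL32_integers: "compact (GL32_integers :: ('k::nonarch_local_field) mat32 set)"
  unfolding GL32_integers_def by (intro compact_Times compact_GL_integers)

lemma continuous_on_mult_GL32:
  fixes f g :: "'b::topological_space \<Rightarrow> ('k::nonarch_local_field) mat32"
  assumes "continuous_on S f" "continuous_on S g"
  shows "continuous_on S (\<lambda>x. f x \<star> g x)"
  unfolding mult_GL32
  by (intro continuous_on_Pair continuous_on_matrix_mult continuous_on_fst continuous_on_snd assms)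

lemma compact_coset:
  fixes g :: "('k::nonarch_local_field) mat32"
  shows "compact (g <#\<^bsub>GL32\<^esub> GL32_integers)"
proof -
  have "g <#\<^bsub>GL32\<^esub> GL32_integers = (\<lambda>k. g \<star> k) ` GL32_integers"
    by (auto simp: l_coset_def)
  then show ?thesis
    by (simp add: compact_continuous_image continuous_on_mult_GL32 compact_GL32_integers)
qed

lemma mem_coset_GL32_iff:
  fixes g x :: "('k::nonarch_local_field) mat32"
  assumes "g \<in> carrier GL32" "x \<in> carrier GL32"
  shows "x \<in> g <#\<^bsub>GL32\<^esub> GL32_integers \<longleftrightarrow> inv\<^bsub>GL32\<^esub> g \<star> x \<in> GL32_integers"
proof -
  interpret G: group "GL32 :: 'k mat32 monoid" by (rule group_GL32)
  interpret K: subgroup "GL32_integers :: 'k mat32 set" GL32 by (rule subgroup_GL32_integers)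
  show ?thesis
  proof
    assume "x \<in> g <#\<^bsub>GL32\<^esub> GL32_integers"
    then show "inv\<^bsub>GL32\<^esub> g \<star> x \<in> GL32_integers"
      using assms by (auto simp: l_coset_def simp flip: G.m_assoc)
  next
    assume "inv\<^bsub>GL32\<^esub> g \<star> x \<in> GL32_integers"
    then show "x \<in> g <#\<^bsub>GL32\<^esub> GL32_integers"
      using assms unfolding l_coset_def
      by (auto intro!: bexI[of _ "inv\<^bsub>GL32\<^esub> g \<star> x"] simp flip: G.m_assoc)
  qed
qed

lemma open_coset:
  fixes g :: "('k::nonarch_local_field) mat32"
  assumes g: "g \<in> carrier GL32"
  shows "open (g <#\<^bsub>GL32\<^esub> GL32_integers)"
proof -
  interpret G: group "GL32 :: 'k mat32 monoid" by (rule group_GL32)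
  interpret K: subgroup "GL32_integers :: 'k mat32 set" GL32 by (rule subgroup_GL32_integers)
  have "g <#\<^bsub>GL32\<^esub> GL32_integers = (\<lambda>x. inv\<^bsub>GL32\<^esub> g \<star> x) -` GL32_integers" (is "?L = ?R")
  proof (intro equalityI subsetI)
    fix x assume "x \<in> ?L"
    moreover from this have "x \<in> carrier GL32"
      using g by (auto simp: l_coset_def)
    ultimately show "x \<in> ?R"
      using g by (simp add: mem_coset_GL32_iff)
  next
    fix x assume x: "x \<in> ?R"
    then have "inv\<^bsub>GL32\<^esub> g \<star> x \<in> carrier GL32"
      by auto
    \<comment> \<open>The preimage is formed among all pairs of matrices; the nonzero determinants
      of the product bring \<open>x\<close> back into the group.\<close>
    then have "x \<in> carrier GL32"
      by (auto simp: carrier_GL32' mult_GL32 det_mul)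
    then show "x \<in> ?L"
      using x g by (simp add: mem_coset_GL32_iff)
  qed
  moreover have "open ((\<lambda>x. inv\<^bsub>GL32\<^esub> g \<star> x) -` (GL32_integers :: 'k mat32 set))"
    by (intro open_vimage open_GL32_integers continuous_on_mult_GL32 continuous_intros)
  ultimately show ?thesis
    by simp
qed

text \<open>The cosets are open, so a compact set meets only finitely many of them; they are
  compact, so finitely many of them form a compact set.\<close>

lemma hecke_algebra_iff_hecke_fun:
  fixes f :: "('k::nonarch_local_field) mat32 \<Rightarrow> complex"
  assumes R: "coset_reps GL32 GL32_integers R"
  shows "f \<in> carrier (hecke_algebra GL32 \<mu> GL32_integers A) \<longleftrightarrow>
    coset_reps.hecke_fun GL32 GL32_integers R f \<and> range f \<subseteq> A"
proof -
  interpret coset_reps "GL32 :: 'k mat32 monoid" GL32_integers R by (rule R)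
  let ?K = "GL32_integers :: 'k mat32 set"
  have mem_R: "x \<in> r <#\<^bsub>GL32\<^esub> ?K \<longleftrightarrow> rep x = r" if "r \<in> R" "x \<in> carrier GL32" for r x
    using that rep_eqI[of x r] rep_inv_mult[of x] by (auto simp: mem_coset_GL32_iff R_carrier)
  have "(\<exists>C. compact C \<and> C \<subseteq> carrier GL32 \<and> (\<forall>x. x \<notin> C \<longrightarrow> f x = 0)) \<longleftrightarrow>
      (\<forall>x. x \<notin> carrier GL32 \<longrightarrow> f x = 0) \<and> finite {r \<in> R. f r \<noteq> 0}" if f: "right_invariant f"
  proof
    assume "\<exists>C. compact C \<and> C \<subseteq> carrier GL32 \<and> (\<forall>x. x \<notin> C \<longrightarrow> f x = 0)"
    then obtain C where C: "compact C" "C \<subseteq> carrier GL32" "\<And>x. x \<notin> C \<Longrightarrow> f x = 0"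
      by blast
    have "C \<subseteq> (\<Union>r\<in>R. r <#\<^bsub>GL32\<^esub> ?K)"
      using C mem_R rep_mem by blast
    then obtain S where S: "S \<subseteq> R" "finite S" "C \<subseteq> (\<Union>r\<in>S. r <#\<^bsub>GL32\<^esub> ?K)"
      using compactE_image[OF C(1), of R "\<lambda>r. r <#\<^bsub>GL32\<^esub> ?K"] open_coset R_carrier by metis
    have "{r \<in> R. f r \<noteq> 0} \<subseteq> S"
    proof
      fix r assume "r \<in> {r \<in> R. f r \<noteq> 0}"
      then have r: "r \<in> R" "r \<in> C"
        using C(3)[of r] by blast+
      then obtain r' where "r' \<in> S" "r \<in> r' <#\<^bsub>GL32\<^esub> ?K"
        using S(3) by blast
      then show "r \<in> S"
        using mem_R[of r' r] rep_of_rep[of r] S(1) r R_carrier by auto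
    qed
    then show "(\<forall>x. x \<notin> carrier GL32 \<longrightarrow> f x = 0) \<and> finite {r \<in> R. f r \<noteq> 0}"
      using C S(2) by (auto intro: finite_subset)
  next
    assume *: "(\<forall>x. x \<notin> carrier GL32 \<longrightarrow> f x = 0) \<and> finite {r \<in> R. f r \<noteq> 0}"
    let ?C = "\<Union>r\<in>{r \<in> R. f r \<noteq> 0}. r <#\<^bsub>GL32\<^esub> ?K"
    have "compact ?C"
      using * by (intro compact_UN compact_coset) auto
    moreover have "?C \<subseteq> carrier GL32"
      using R_carrier by (auto simp: l_coset_def)
    moreover have "f x = 0" if "x \<notin> ?C" for x
    proof (rule ccontr)
      assume "f x \<noteq> 0"
      moreover from this have x: "x \<in> carrier GL32"
        using * by blast
      ultimately have "f (rep x) \<noteq> 0"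
        using f by (simp add: right_invariant_rep)
      then show False
        using that mem_R[of "rep x" x] rep_mem[of x] x by blast
    qed
    ultimately show "\<exists>C. compact C \<and> C \<subseteq> carrier GL32 \<and> (\<forall>x. x \<notin> C \<longrightarrow> f x = 0)"
      by blast
  qed
  moreover have "right_invariant f"
    if "\<forall>k\<in>?K. \<forall>x\<in>carrier GL32. \<forall>k'\<in>?K. f (k \<star> x \<star> k') = f x"
    unfolding right_invariant_def using that[rule_format, of "\<one>\<^bsub>GL32\<^esub>"] by auto
  ultimately show ?thesis
    unfolding hecke_algebra_def hecke_fun_def by auto
qed

section \<open>The Iwasawa decomposition\<close>

definition mat3 :: "'a::zero \<Rightarrow> 'a \<Rightarrow> 'a \<Rightarrow> 'a \<Rightarrow> 'a \<Rightarrow> 'a \<Rightarrow> 'a \<Rightarrow> 'a \<Rightarrow> 'a \<Rightarrow> 'a^3^3"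
  where "mat3 a b c d e f g h i = vector [vector [a, b, c], vector [d, e, f], vector [g, h, i]]"

definition mat2 :: "'a::zero \<Rightarrow> 'a \<Rightarrow> 'a \<Rightarrow> 'a \<Rightarrow> 'a^2^2"
  where "mat2 a b c d = vector [vector [a, b], vector [c, d]]"

lemma mat3_nth [simp]:
  "mat3 a b c d e f g h i $ 1 $ 1 = a" "mat3 a b c d e f g h i $ 1 $ 2 = b" "mat3 a b c d e f g h i $ 1 $ 3 = c"
  "mat3 a b c d e f g h i $ 2 $ 1 = d" "mat3 a b c d e f g h i $ 2 $ 2 = e" "mat3 a b c d e f g h i $ 2 $ 3 = f"
  "mat3 a b c d e f g h i $ 3 $ 1 = g" "mat3 a b c d e f g h i $ 3 $ 2 = h" "mat3 a b c d e f g h i $ 3 $ 3 = i"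
  by (simp_all add: mat3_def)

lemma mat2_nth [simp]:
  "mat2 a b c d $ 1 $ 1 = a" "mat2 a b c d $ 1 $ 2 = b" "mat2 a b c d $ 2 $ 1 = c" "mat2 a b c d $ 2 $ 2 = d"
  by (simp_all add: mat2_def)

lemma mat3_eq_iff:
  "mat3 a b c d e f g h i = mat3 a' b' c' d' e' f' g' h' i' \<longleftrightarrow>
    a = a' \<and> b = b' \<and> c = c' \<and> d = d' \<and> e = e' \<and> f = f' \<and> g = g' \<and> h = h' \<and> i = i'"
  by (auto simp: vec_eq_iff forall_3)

lemma mat2_eq_iff: "mat2 a b c d = mat2 a' b' c' d' \<longleftrightarrow> a = a' \<and> b = b' \<and> c = c' \<and> d = d'"
  by (auto simp: vec_eq_iff forall_2)

lemma mat3_eta: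
  "A = mat3 (A$1$1) (A$1$2) (A$1$3) (A$2$1) (A$2$2) (A$2$3) (A$3$1) (A$3$2) (A$3$3)"
  by (simp add: vec_eq_iff forall_3)

lemma mat2_eta: "A = mat2 (A$1$1) (A$1$2) (A$2$1) (A$2$2)"
  by (simp add: vec_eq_iff forall_2)

lemma mat3_cases: obtains a b c d e f g h i where "A = mat3 a b c d e f g h i"
  using mat3_eta by blast

lemma mat2_cases: obtains a b c d where "A = mat2 a b c d"
  using mat2_eta by blast

lemma mat3_mult:
  fixes a :: "'a::semiring_1"
  shows "mat3 a b c d e f g h i ** mat3 a' b' c' d' e' f' g' h' i' =
    mat3 (a * a' + b * d' + c * g') (a * b' + b * e' + c * h') (a * c' + b * f' + c * i')
         (d * a' + e * d' + f * g') (d * b' + e * e' + f * h') (d * c' + e * f' + f * i')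
         (g * a' + h * d' + i * g') (g * b' + h * e' + i * h') (g * c' + h * f' + i * i')"
  by (simp add: vec_eq_iff forall_3 matrix_matrix_mult_def sum_3)

lemma mat2_mult:
  fixes a :: "'a::semiring_1"
  shows "mat2 a b c d ** mat2 a' b' c' d' = mat2 (a * a' + b * c') (a * b' + b * d') (c * a' + d * c') (c * b' + d * d')"
  by (simp add: vec_eq_iff forall_2 matrix_matrix_mult_def sum_2)

lemma det_mat3:
  fixes a :: "'a::comm_ring_1"
  shows "det (mat3 a b c d e f g h i) = a*e*i + b*f*g + c*d*h - a*f*h - b*d*i - c*e*g"
  by (simp add: det_3)

lemma det_mat2: "det (mat2 a b c d) = a * d - b * (c::'a::comm_ring_1)"
  by (simp add: det_2)

lemma mat_1_eq_mat3: "mat 1 = mat3 1 0 0 0 1 0 0 0 1"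
  and mat_1_eq_mat2: "mat 1 = mat2 1 0 0 1"
  by (simp_all add: vec_eq_iff forall_3 forall_2 mat_def)

lemma diag_eq_mat3: "diag v = mat3 (v$1) 0 0 0 (v$2) 0 0 0 (v$3)"
  and diag_eq_mat2: "diag w = mat2 (w$1) 0 0 (w$2)"
  by (simp_all add: vec_eq_iff forall_3 forall_2 diag_def)

lemma mat3_GL_integers_iff:
  fixes a :: "'k::nonarch_local_field"
  shows "mat3 a b c d e f g h i \<in> GL_integers \<longleftrightarrow>
    a \<in> integers \<and> b \<in> integers \<and> c \<in> integers \<and> d \<in> integers \<and> e \<in> integers \<and> f \<in> integers \<and>
    g \<in> integers \<and> h \<in> integers \<and> i \<in> integers \<and>
    absval (a*e*i + b*f*g + c*d*h - a*f*h - b*d*i - c*e*g) = 1"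
  by (auto simp: GL_integers_iff forall_3 det_mat3)

lemma mat2_GL_integers_iff:
  fixes a :: "'k::nonarch_local_field"
  shows "mat2 a b c d \<in> GL_integers \<longleftrightarrow>
    a \<in> integers \<and> b \<in> integers \<and> c \<in> integers \<and> d \<in> integers \<and> absval (a * d - b * c) = 1"
  by (auto simp: GL_integers_iff forall_2 det_mat2)

text \<open>The entry of larger absolute value serves as pivot, which makes the quotient integral.
  The result is the first column of a matrix over the integers with unit determinant that kills the
  first entry of the row \<open>(x, y)\<close>.\<close>

lemma ex_integral_row_reduction:
  fixes x y :: "'k::nonarch_local_field"
  obtains a b c d where "a \<in> integers" "b \<in> integers" "c \<in> integers" "d \<in> integers"
    "absval (a * d - b * c) = 1" "x * a + y * c = 0"
proof (cases "absval x \<le> absval y")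
  case True
  show ?thesis
  proof (cases "y = 0")
    case y: True
    have "absval x = 0"
      using True absval_nonneg[of x] unfolding y absval_0 by (rule order_antisym)
    then show ?thesis
      using y that[of 1 0 0 1] by simp
  next
    case False
    then show ?thesis
      using True that[of 1 0 "- (x / y)" 1] by (simp add: integers_iff absval_divide)
  qed
next
  case False
  then have "x \<noteq> 0"
    by auto
  then show ?thesis
    using False that[of "- (y / x)" 1 1 0] by (simp add: integers_iff absval_divide)
qed

lemma GL2_upper_triangular:
  fixes A :: "'k::nonarch_local_field^2^2"
  obtains k x y z where "k \<in> GL_integers" "A ** k = mat2 x y 0 z"
proof -
  obtain a b c d where A: "A = mat2 a b c d"
    by (rule mat2_cases)
  obtain p q r s where k: "p \<in> integers" "q \<in> integers" "r \<in> integers" "s \<in> integers"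
    "absval (p * s - q * r) = 1" "c * p + d * r = 0"
    by (rule ex_integral_row_reduction)
  then show ?thesis
    by (intro that[of "mat2 p q r s"]) (auto simp: mat2_GL_integers_iff A mat2_mult)
qed

text \<open>Column operations clear position 31, then 32, then 21. The last one mixes the first two
  columns, whose entries in the third row are already 0, so it destroys nothing.\<close>

lemma GL3_upper_triangular:
  fixes A :: "'k::nonarch_local_field^3^3"
  obtains k x y z u v w where "k \<in> GL_integers" "A ** k = mat3 x u v 0 y w 0 0 z"
proof -
  interpret K: subgroup "GL_integers :: ('k^3^3) set" GL
    by (rule subgroup_GL_integers)
  have red12: "\<exists>k\<in>GL_integers. \<exists>a b c d e f g h. M ** k = mat3 a b c d e f g h i \<and> g = 0"
    if "M = mat3 a0 b0 c0 d0 e0 f0 g0 h0 i" for M :: "'k^3^3" and a0 b0 c0 d0 e0 f0 g0 h0 i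
  proof -
    obtain p q r s where k: "p \<in> integers" "q \<in> integers" "r \<in> integers" "s \<in> integers"
      "absval (p * s - q * r) = 1" "g0 * p + h0 * r = 0"
      by (rule ex_integral_row_reduction)
    then show ?thesis
      by (intro bexI[of _ "mat3 p q 0 r s 0 0 0 1"]) (auto simp: mat3_GL_integers_iff that mat3_mult mat3_eq_iff)
  qed
  obtain a0 b0 c0 d0 e0 f0 g0 h0 i where A: "A = mat3 a0 b0 c0 d0 e0 f0 g0 h0 i"
    by (rule mat3_cases)
  obtain k1 a b c d e f h where k1: "k1 \<in> GL_integers" "A ** k1 = mat3 a b c d e f 0 h i"
    using red12[OF A] by blast
  obtain p q r s where k2: "p \<in> integers" "q \<in> integers" "r \<in> integers" "s \<in> integers"
    "absval (p * s - q * r) = 1" "h * p + i * r = 0"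
    by (rule ex_integral_row_reduction)
  obtain p' q' r' s' where k3: "p' \<in> integers" "q' \<in> integers" "r' \<in> integers" "s' \<in> integers"
    "absval (p' * s' - q' * r') = 1" "d * p' + (e * p + f * r) * r' = 0"
    by (rule ex_integral_row_reduction)
  let ?k2 = "mat3 1 0 0 0 p q 0 r s" and ?k3 = "mat3 p' q' 0 r' s' 0 0 0 1"
  have "?k2 \<in> GL_integers" "?k3 \<in> GL_integers"
    using k2 k3 by (auto simp: mat3_GL_integers_iff)
  then have k: "k1 ** ?k2 ** ?k3 \<in> GL_integers"
    using k1(1) K.m_closed unfolding mult_GL by blast
  have "\<exists>x y z u v w. A ** (k1 ** ?k2 ** ?k3) = mat3 x u v 0 y w 0 0 z"
    using k2 k3 by (simp add: matrix_mul_assoc k1(2) mat3_mult mat3_eq_iff)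
  then show ?thesis
    using k that by blast
qed

section \<open>The unipotent radical and representatives of \<open>G/K\<close>\<close>

definition unip :: "'k::nonarch_local_field \<Rightarrow> 'k \<Rightarrow> 'k \<Rightarrow> 'k \<Rightarrow> 'k mat32"
  where "unip a b c d = (mat3 1 a b 0 1 c 0 0 1, mat2 1 d 0 1)"

lemma unipotent_radical_eq: "unipotent_radical = {unip a b c d | a b c d. True}"
proof (intro equalityI subsetI)
  fix x :: "'a mat32" assume "x \<in> unipotent_radical"
  then have "x = unip (fst x $ 1 $ 2) (fst x $ 1 $ 3) (fst x $ 2 $ 3) (snd x $ 1 $ 2)"
    using mat3_eta[of "fst x"] mat2_eta[of "snd x"]
    by (auto simp: unipotent_radical_def unip_def forall_3 forall_2 prod_eq_iff)
  then show "x \<in> {unip a b c d | a b c d. True}"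
    by blast
qed (auto simp: unipotent_radical_def unip_def carrier_GL32 carrier_GL_det det_mat3 det_mat2 forall_3 forall_2)

lemma unip_integers_iff:
  "unip a b c d \<in> GL32_integers \<longleftrightarrow> a \<in> integers \<and> b \<in> integers \<and> c \<in> integers \<and> d \<in> integers"
  by (simp add: unip_def GL32_integers_def mat3_GL_integers_iff mat2_GL_integers_iff)

lemma unip_mult:
  "unip a b c d \<star> unip a' b' c' d' = unip (a + a') (b + a * c' + b') (c + c') (d + d')"
  by (simp add: unip_def mult_GL32 mat3_mult mat2_mult mat3_eq_iff mat2_eq_iff)

lemma unip_0: "unip 0 0 0 0 = \<one>\<^bsub>GL32\<^esub>"
  by (simp add: unip_def one_GL32 mat_1_eq_mat3 mat_1_eq_mat2)

lemma unip_inv: "inv\<^bsub>GL32\<^esub> (unip a b c d) = unip (-a) (a * c - b) (-c) (-d)"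
proof -
  interpret G: group "GL32 :: 'a mat32 monoid" by (rule group_GL32)
  show ?thesis
    by (rule G.inv_equality)
      (auto simp: unip_mult simp flip: unip_0, auto simp: unip_def carrier_GL32' det_mat3 det_mat2)
qed

type_synonym exponents = "(int^3) \<times> (int^2)"

locale fractional_reps =
  fixes \<pi> :: "'k::nonarch_local_field" and T :: "'k set"
  assumes unif: "uniformizer \<pi>"
    and zero_T: "0 \<in> T"
    and ex1_T: "\<exists>!t. t \<in> T \<and> x - t \<in> integers"
    and card_T: "card {t \<in> T. \<pi> * t \<in> integers} = card (residue_field :: 'k set set)"
begin

definition tau :: "exponents \<Rightarrow> 'k mat32"
  where "tau e = (diag (\<chi> i. \<pi> powi (fst e $ i)), diag (\<chi> j. \<pi> powi (snd e $ j)))"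

text \<open>The torus factor stands on the left, so that right multiplication by integral unipotents
  affects the four coordinates and not the exponent.\<close>

definition borel_elt :: "exponents \<Rightarrow> 'k \<Rightarrow> 'k \<Rightarrow> 'k \<Rightarrow> 'k \<Rightarrow> 'k mat32"
  where "borel_elt e a b c d = tau e \<star> unip a b c d"

definition R :: "'k mat32 set"
  where "R = {borel_elt e a b c d | e a b c d. a \<in> T \<and> b \<in> T \<and> c \<in> T \<and> d \<in> T}"

lemma pi_nonzero [simp]: "\<pi> \<noteq> 0"
  using uniformizer_nonzero[OF unif] .

sublocale G: group "GL32 :: 'k mat32 monoid"
  by (rule group_GL32)

sublocale K: subgroup "GL32_integers :: 'k mat32 set" GL32
  by (rule subgroup_GL32_integers)

lemma borel_elt_eq:
  "borel_elt e a b c d =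
    (mat3 (\<pi> powi (fst e $ 1)) (\<pi> powi (fst e $ 1) * a) (\<pi> powi (fst e $ 1) * b)
          0 (\<pi> powi (fst e $ 2)) (\<pi> powi (fst e $ 2) * c)
          0 0 (\<pi> powi (fst e $ 3)),
     mat2 (\<pi> powi (snd e $ 1)) (\<pi> powi (snd e $ 1) * d) 0 (\<pi> powi (snd e $ 2)))"
  by (simp add: borel_elt_def tau_def unip_def mult_GL32 diag_eq_mat3 diag_eq_mat2 mat3_mult mat2_mult)

lemma borel_elt_carrier [simp]: "borel_elt e a b c d \<in> carrier GL32"
  by (simp add: borel_elt_eq carrier_GL32' det_mat3 det_mat2)

lemma unip_carrier [simp]: "unip a b c d \<in> carrier (GL32 :: 'k mat32 monoid)"
  by (simp add: unip_def carrier_GL32' det_mat3 det_mat2)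

lemma tau_eq_borel_elt: "tau e = borel_elt e 0 0 0 0"
  by (simp add: borel_elt_eq tau_def diag_eq_mat3 diag_eq_mat2)

lemma tau_carrier [simp]: "tau e \<in> carrier GL32"
  by (simp add: tau_eq_borel_elt)

text \<open>Moving the second torus factor to the left conjugates the first unipotent: the entry in
  position ij is scaled by \<pi> to the power \<open>e'_j - e'_i\<close>. The witnesses combine this
  with \<open>unip_mult\<close>.\<close>

lemma borel_elt_mult:
  "\<exists>a'' b'' c'' d''. borel_elt e a b c d \<star> borel_elt e' a' b' c' d' = borel_elt (e + e') a'' b'' c'' d''"
  by (intro exI[of _ "\<pi> powi (fst e' $ 2 - fst e' $ 1) * a + a'"]
      exI[of _ "b' + \<pi> powi (fst e' $ 2 - fst e' $ 1) * a * c' + \<pi> powi (fst e' $ 3 - fst e' $ 1) * b"]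
      exI[of _ "\<pi> powi (fst e' $ 3 - fst e' $ 2) * c + c'"]
      exI[of _ "\<pi> powi (snd e' $ 2 - snd e' $ 1) * d + d'"])
    (simp add: borel_elt_eq mult_GL32 mat3_mult mat2_mult mat3_eq_iff mat2_eq_iff power_int_add power_int_diff field_simps)

lemma absval_factors_eq_1:
  fixes x y z :: 'k
  assumes "x \<in> integers" "y \<in> integers" "z \<in> integers" "absval (x * y * z) = 1"
  shows "absval x = 1" "absval y = 1" "absval z = 1"
proof -
  have *: "absval u = 1" if "u \<in> integers" "v \<in> integers" "absval (u * v) = 1" for u v :: 'k
    using that mult_left_le[of "absval v" "absval u"] by (simp add: integers_iff absval_mult)
  show "absval x = 1" "absval y = 1" "absval z = 1"
    using *[of x "y * z"] *[of y "x * z"] *[of z "x * y"] assms by (auto simp: integers_mult mult_ac)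
qed

text \<open>The uniqueness half of the decomposition. \<open>k\<close> is forced to be upper
  triangular with units on the diagonal, so the exponents agree; then its diagonal is 1, and its
  remaining entries are the listed differences, with the corner twisted as in
  \<open>unip_mult\<close>.\<close>

lemma borel_elt_cong_imp:
  assumes k: "k \<in> GL32_integers" and eq: "borel_elt e a b c d \<star> k = borel_elt e' a' b' c' d'"
  shows "e = e'" "a' - a \<in> integers" "b' - b - a * (c' - c) \<in> integers" "c' - c \<in> integers" "d' - d \<in> integers"
proof -
  obtain k11 k12 k13 k21 k22 k23 k31 k32 k33 where k3: "fst k = mat3 k11 k12 k13 k21 k22 k23 k31 k32 k33"
    by (rule mat3_cases)
  obtain l11 l12 l21 l22 where k2: "snd k = mat2 l11 l12 l21 l22"
    by (rule mat2_cases)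
  note eqs = eq[unfolded borel_elt_eq mult_GL32 fst_conv snd_conv k3 k2 mat3_mult mat2_mult prod.inject mat3_eq_iff mat2_eq_iff]
  have low: "k31 = 0" "k32 = 0" "k21 = 0" "l21 = 0"
    using eqs by auto
  have K: "fst k \<in> GL_integers" "snd k \<in> GL_integers"
    using k by (auto simp: GL32_integers_def)
  then have "absval k11 = 1" "absval k22 = 1" "absval k33 = 1"
    using low absval_factors_eq_1[of k11 k22 k33] by (auto simp: k3 mat3_GL_integers_iff)
  moreover have "absval l11 = 1" "absval l22 = 1"
    using K low absval_factors_eq_1[of l11 l22 1] by (auto simp: k2 mat2_GL_integers_iff)
  moreover have "\<pi> powi (fst e $ 1) * k11 = \<pi> powi (fst e' $ 1)" "\<pi> powi (fst e $ 2) * k22 = \<pi> powi (fst e' $ 2)"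
    "\<pi> powi (fst e $ 3) * k33 = \<pi> powi (fst e' $ 3)" "\<pi> powi (snd e $ 1) * l11 = \<pi> powi (snd e' $ 1)"
    "\<pi> powi (snd e $ 2) * l22 = \<pi> powi (snd e' $ 2)"
    using eqs low by auto
  moreover have "m = n" if "absval x = 1" "\<pi> powi m * x = \<pi> powi n" for m n x
  proof -
    have "absval \<pi> powi m = absval \<pi> powi n"
      using arg_cong[OF that(2), of absval] that(1) by (simp add: absval_mult absval_powi)
    then show ?thesis
      by (simp add: uniformizer_powi_eq_iff[OF unif])
  qed
  ultimately show e: "e = e'"
    by (simp add: prod_eq_iff vec_eq_iff forall_3 forall_2)
  have one: "k11 = 1" "k22 = 1" "k33 = 1" "l11 = 1" "l22 = 1"
    using eqs low e by auto
  have "k12 + a = a'" "k23 + c = c'" "k13 + a * k23 + b = b'" "l12 + d = d'"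
  proof -
    have "\<pi> powi (fst e $ 1) * (k12 + a) = \<pi> powi (fst e $ 1) * a'"
      "\<pi> powi (fst e $ 2) * (k23 + c) = \<pi> powi (fst e $ 2) * c'"
      "\<pi> powi (fst e $ 1) * (k13 + a * k23 + b) = \<pi> powi (fst e $ 1) * b'"
      "\<pi> powi (snd e $ 1) * (l12 + d) = \<pi> powi (snd e $ 1) * d'"
      using eqs unfolding low one e[symmetric] by (simp_all add: distrib_left mult.assoc)
    then show "k12 + a = a'" "k23 + c = c'" "k13 + a * k23 + b = b'" "l12 + d = d'"
      by simp_all
  qed
  then have "a' - a = k12" "c' - c = k23" "b' - b - a * (c' - c) = k13" "d' - d = l12"
    by (auto simp: algebra_simps)
  then show "a' - a \<in> integers" "b' - b - a * (c' - c) \<in> integers" "c' - c \<in> integers" "d' - d \<in> integers"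
    using K by (auto simp: k3 k2 mat3_GL_integers_iff mat2_GL_integers_iff)
qed

lemma ex_unit_factor: "x \<noteq> 0 \<Longrightarrow> \<exists>m u. x = \<pi> powi m * u \<and> absval u = 1" for x :: 'k
proof -
  assume x: "x \<noteq> 0"
  then obtain m where "absval x = absval \<pi> powi m"
    using ex_absval_powi[OF unif] by blast
  then show ?thesis
    by (intro exI[of _ m] exI[of _ "x / \<pi> powi m"]) (simp add: absval_divide absval_powi)
qed

lemma iwasawa:
  assumes g: "g \<in> carrier GL32"
  shows "\<exists>e a b c d k. k \<in> GL32_integers \<and> g = borel_elt e a b c d \<star> k"
proof -
  obtain k3 t1 t2 t3 x y z where k3: "k3 \<in> GL_integers" "fst g ** k3 = mat3 t1 x y 0 t2 z 0 0 t3"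
    by (rule GL3_upper_triangular)
  obtain k2 s1 s2 w where k2: "k2 \<in> GL_integers" "snd g ** k2 = mat2 s1 w 0 s2"
    by (rule GL2_upper_triangular)
  have k: "(k3, k2) \<in> GL32_integers"
    using k3 k2 by (simp add: GL32_integers_def)
  have eq: "g \<star> (k3, k2) = (mat3 t1 x y 0 t2 z 0 0 t3, mat2 s1 w 0 s2)"
    using k3 k2 by (simp add: mult_GL32)
  have "g \<star> (k3, k2) \<in> carrier GL32"
    using g k by auto
  then have "t1 \<noteq> 0" "t2 \<noteq> 0" "t3 \<noteq> 0" "s1 \<noteq> 0" "s2 \<noteq> 0"
    unfolding eq by (auto simp: carrier_GL32' det_mat3 det_mat2)
  then obtain e1 u1 e2 u2 e3 u3 f1 v1 f2 v2 where
    t: "t1 = \<pi> powi e1 * u1" "t2 = \<pi> powi e2 * u2" "t3 = \<pi> powi e3 * u3" "s1 = \<pi> powi f1 * v1" "s2 = \<pi> powi f2 * v2"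
    and u: "absval u1 = 1" "absval u2 = 1" "absval u3 = 1" "absval v1 = 1" "absval v2 = 1"
    using ex_unit_factor[of t1] ex_unit_factor[of t2] ex_unit_factor[of t3] ex_unit_factor[of s1] ex_unit_factor[of s2]
    by blast
  have nz: "u2 \<noteq> 0" "u3 \<noteq> 0" "v2 \<noteq> 0"
    using u by auto
  let ?e = "(vector [e1, e2, e3], vector [f1, f2]) :: exponents"
  let ?k = "(mat3 u1 0 0 0 u2 0 0 0 u3, mat2 v1 0 0 v2)"
  \<comment> \<open>The units on the diagonal go into the integral factor \<open>?k\<close>, which
    scales columns; hence each entry is divided by the unit of its column and by the power of \<pi>
    of its row.\<close>
  let ?b = "borel_elt ?e (x / (\<pi> powi e1 * u2)) (y / (\<pi> powi e1 * u3)) (z / (\<pi> powi e2 * u3)) (w / (\<pi> powi f1 * v2))"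
  have kk: "?k \<in> GL32_integers"
    using u by (simp add: GL32_integers_def mat3_GL_integers_iff mat2_GL_integers_iff absval_mult integers_iff)
  have "g \<star> (k3, k2) = ?b \<star> ?k"
    using nz unfolding eq borel_elt_eq by (simp add: mult_GL32 mat3_mult mat2_mult t)
  moreover have "g = h \<star> (l \<star> inv\<^bsub>GL32\<^esub> m)"
    if "g \<star> m = h \<star> l" "h \<in> carrier GL32" "l \<in> GL32_integers" "m \<in> GL32_integers" for h l m
  proof -
    have "h \<star> (l \<star> inv\<^bsub>GL32\<^esub> m) = (g \<star> m) \<star> inv\<^bsub>GL32\<^esub> m"
      unfolding that(1) using that(2-4) by (simp add: G.m_assoc)
    also have "\<dots> = g"
      using that(4) g by (simp add: G.m_assoc)
    finally show ?thesis
      by simp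
  qed
  ultimately have "g = ?b \<star> (?k \<star> inv\<^bsub>GL32\<^esub> (k3, k2))"
    using k kk borel_elt_carrier by blast
  moreover have "?k \<star> inv\<^bsub>GL32\<^esub> (k3, k2) \<in> GL32_integers"
    using k kk by (intro K.m_closed K.m_inv_closed)
  ultimately show ?thesis
    by blast
qed

lemma ex_borel_elt_rep:
  "\<exists>a'\<in>T. \<exists>b'\<in>T. \<exists>c'\<in>T. \<exists>d'\<in>T. \<exists>k\<in>GL32_integers.
     unip a b c d = unip a' b' c' d' \<star> k \<and> k \<in> unipotent_radical"
proof -
  obtain a' where a': "a' \<in> T" "a - a' \<in> integers" using ex1_T by blast
  obtain c' where c': "c' \<in> T" "c - c' \<in> integers" using ex1_T by blast
  obtain d' where d': "d' \<in> T" "d - d' \<in> integers" using ex1_T by blast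
  \<comment> \<open>An integral right factor with entry \<open>c - c'\<close> adds
    \<open>a' * (c - c')\<close> to the corner, so the representative of the corner is chosen last
    and after this correction.\<close>
  obtain b' where b': "b' \<in> T" "(b - a' * (c - c')) - b' \<in> integers" using ex1_T by blast
  have "unip a b c d = unip a' b' c' d' \<star> unip (a - a') (b - a' * (c - c') - b') (c - c') (d - d')"
    by (simp add: unip_mult)
  moreover have "unip (a - a') (b - a' * (c - c') - b') (c - c') (d - d') \<in> GL32_integers"
    using a' b' c' d' by (simp add: unip_integers_iff)
  ultimately show ?thesis
    using a' b' c' d' unipotent_radical_eq by blast
qed

lemma T_eqI: "t \<in> T \<Longrightarrow> t' \<in> T \<Longrightarrow> t' - t \<in> integers \<Longrightarrow> t = t'"
  using ex1_T[of t'] by auto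

lemma T_integers_iff: "t \<in> T \<Longrightarrow> t \<in> integers \<longleftrightarrow> t = 0"
  using T_eqI[of 0 t] zero_T by auto

lemma borel_elt_inj:
  assumes "borel_elt e a b c d \<star> k = borel_elt e' a' b' c' d'" "k \<in> GL32_integers"
    "a \<in> T" "b \<in> T" "c \<in> T" "d \<in> T" "a' \<in> T" "b' \<in> T" "c' \<in> T" "d' \<in> T"
  shows "e = e' \<and> a = a' \<and> b = b' \<and> c = c' \<and> d = d'"
  using borel_elt_cong_imp[OF assms(2,1)] assms T_eqI[of a a'] T_eqI[of c c'] T_eqI[of d d'] T_eqI[of b b'] by auto

sublocale coset_reps "GL32 :: 'k mat32 monoid" GL32_integers R
proof unfold_locales
  show "R \<subseteq> carrier GL32"
    by (auto simp: R_def)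
  fix g :: "'k mat32" assume g: "g \<in> carrier GL32"
  obtain e a b c d k where k: "k \<in> GL32_integers" "g = borel_elt e a b c d \<star> k"
    using iwasawa[OF g] by blast
  obtain a' b' c' d' k' where k': "a' \<in> T" "b' \<in> T" "c' \<in> T" "d' \<in> T" "k' \<in> GL32_integers"
    "unip a b c d = unip a' b' c' d' \<star> k'"
    using ex_borel_elt_rep by blast
  have g_eq: "g = borel_elt e a' b' c' d' \<star> (k' \<star> k)"
    using k k' by (simp add: borel_elt_def G.m_assoc)
  show "\<exists>!r. r \<in> R \<and> inv\<^bsub>GL32\<^esub> r \<star> g \<in> GL32_integers"
  proof (rule ex1I)
    have "inv\<^bsub>GL32\<^esub> (borel_elt e a' b' c' d') \<star> g = k' \<star> k"
      unfolding g_eq using k(1) k'(5) by (simp flip: G.m_assoc)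
    then show "borel_elt e a' b' c' d' \<in> R \<and> inv\<^bsub>GL32\<^esub> (borel_elt e a' b' c' d') \<star> g \<in> GL32_integers"
      using k(1) k' unfolding R_def by (intro conjI CollectI exI[of _ e] exI[of _ a'] exI[of _ b'] exI[of _ c'] exI[of _ d']) auto
  next
    fix r assume r: "r \<in> R \<and> inv\<^bsub>GL32\<^esub> r \<star> g \<in> GL32_integers"
    then obtain e1 a1 b1 c1 d1 where r_eq: "r = borel_elt e1 a1 b1 c1 d1" and T1: "a1 \<in> T" "b1 \<in> T" "c1 \<in> T" "d1 \<in> T"
      by (auto simp: R_def)
    define k1 where "k1 = inv\<^bsub>GL32\<^esub> r \<star> g"
    have k1: "k1 \<in> GL32_integers" "r \<star> k1 = g"
      using r g by (auto simp: k1_def r_eq simp flip: G.m_assoc)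
    let ?k = "k1 \<star> inv\<^bsub>GL32\<^esub> (k' \<star> k)"
    have "r \<star> ?k = g \<star> inv\<^bsub>GL32\<^esub> (k' \<star> k)"
      unfolding k1(2)[symmetric] using k1(1) k(1) k'(5) by (simp add: r_eq G.m_assoc del: G.inv_mult_group)
    also have "\<dots> = borel_elt e a' b' c' d' \<star> ((k' \<star> k) \<star> inv\<^bsub>GL32\<^esub> (k' \<star> k))"
      unfolding g_eq using k(1) k'(5) by (intro G.m_assoc) auto
    also have "\<dots> = borel_elt e a' b' c' d'"
      using k(1) k'(5) by (subst G.r_inv) auto
    finally have "borel_elt e1 a1 b1 c1 d1 \<star> ?k = borel_elt e a' b' c' d'"
      by (simp add: r_eq)
    moreover have "?k \<in> GL32_integers"
      using k1 k k' by (intro K.m_closed K.m_inv_closed)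
    ultimately show "r = borel_elt e a' b' c' d'"
      using borel_elt_inj T1 k' r_eq by metis
  qed
qed

end

section \<open>The Satake transform as a sum over cosets\<close>

lemma subgroup_unipotent_radical: "subgroup (unipotent_radical :: ('k::nonarch_local_field) mat32 set) GL32"
proof
  show "unipotent_radical \<subseteq> carrier (GL32 :: 'k mat32 monoid)"
    by (auto simp: unipotent_radical_def)
  show "\<one>\<^bsub>GL32\<^esub> \<in> (unipotent_radical :: 'k mat32 set)"
    unfolding unipotent_radical_eq unip_0[symmetric] by blast
next
  fix x y :: "'k mat32" assume "x \<in> unipotent_radical" "y \<in> unipotent_radical"
  then show "x \<star> y \<in> unipotent_radical"
    unfolding unipotent_radical_eq by (auto simp: unip_mult) blast
next
  fix x :: "'k mat32" assume "x \<in> unipotent_radical"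
  then show "inv\<^bsub>GL32\<^esub> x \<in> unipotent_radical"
    unfolding unipotent_radical_eq by (auto simp: unip_inv) blast
qed

lemma haar_measure_space: "haar_measure_on G \<mu> \<Longrightarrow> space \<mu> = carrier G"
  using sets_eq_imp_space_eq[of \<mu> "restrict_space borel (carrier G)"]
  by (simp add: haar_measure_on_def space_restrict_space)

lemma haar_measure_left_invariant:
  "haar_measure_on G \<mu> \<Longrightarrow> g \<in> carrier G \<Longrightarrow> A \<in> sets \<mu> \<Longrightarrow> emeasure \<mu> (g <#\<^bsub>G\<^esub> A) = emeasure \<mu> A"
  by (simp add: haar_measure_on_def)

lemma vector_4:
  "(vector [a, b, c, d] :: ('a::zero)^4) $ 1 = a" "(vector [a, b, c, d] :: ('a::zero)^4) $ 2 = b"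
  "(vector [a, b, c, d] :: ('a::zero)^4) $ 3 = c" "(vector [a, b, c, d] :: ('a::zero)^4) $ 4 = d"
  unfolding vector_def by simp_all

lemma prod_2: "prod f (UNIV::2 set) = f 1 * f 2"
  unfolding UNIV_2 by (simp add: ac_simps)

lemma prod_3: "prod f (UNIV::3 set) = f 1 * f 2 * f 3"
  unfolding UNIV_3 by (simp add: ac_simps)

lemma prod_4: "prod f (UNIV::4 set) = f 1 * f 2 * f 3 * f 4"
  unfolding UNIV_4 by (simp add: ac_simps)

definition monomial_at :: "complex mat32 \<Rightarrow> exponents \<Rightarrow> complex"
  where "monomial_at s e = (\<Prod>i\<in>UNIV. (fst s $ i $ i) powi (fst e $ i)) * (\<Prod>j\<in>UNIV. (snd s $ j $ j) powi (snd e $ j))"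

lemma torus_diag_nonzero:
  assumes "s \<in> torus"
  shows "fst s $ i $ i \<noteq> 0" "snd s $ j $ j \<noteq> 0"
proof -
  have "det (fst s) = fst s $ 1 $ 1 * fst s $ 2 $ 2 * fst s $ 3 $ 3" "det (snd s) = snd s $ 1 $ 1 * snd s $ 2 $ 2"
    using assms by (auto simp: torus_def det_3 det_2)
  moreover have "det (fst s) \<noteq> 0" "det (snd s) \<noteq> 0"
    using assms by (auto simp: torus_def carrier_GL32')
  ultimately have "fst s $ 1 $ 1 * fst s $ 2 $ 2 * fst s $ 3 $ 3 \<noteq> 0" "snd s $ 1 $ 1 * snd s $ 2 $ 2 \<noteq> 0"
    by simp_all
  then show "fst s $ i $ i \<noteq> 0" "snd s $ j $ j \<noteq> 0"
    using exhaust_3[of i] exhaust_2[of j] by auto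
qed

lemma monomial_at_add: "s \<in> torus \<Longrightarrow> monomial_at s (e + e') = monomial_at s e * monomial_at s e'"
  by (simp add: monomial_at_def power_int_add torus_diag_nonzero prod.distrib)

context fractional_reps
begin

text \<open>\<open>Ad\<close> acts diagonally on the four coordinates, through the positive roots.
  The three roots of the first factor add up to twice the difference of the first and third
  exponents.\<close>

lemma modulus_tau:
  "modulus (tau e) = absval \<pi> powi (2 * (fst e $ 1 - fst e $ 3) + (snd e $ 1 - snd e $ 2))"
proof -
  let ?p = "\<lambda>n. \<pi> powi n"
  have inv: "matrix_inv (fst (tau e)) = mat3 (?p (- (fst e $ 1))) 0 0 0 (?p (- (fst e $ 2))) 0 0 0 (?p (- (fst e $ 3)))"
    "matrix_inv (snd (tau e)) = mat2 (?p (- (snd e $ 1))) 0 0 (?p (- (snd e $ 2)))"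
    by (rule matrix_inv_unique;
        simp add: tau_def diag_eq_mat3 diag_eq_mat2 mat3_mult mat2_mult mat_1_eq_mat3 mat_1_eq_mat2 power_int_minus)+
  have lie: "lie_embed v = (mat3 0 (v$1) (v$2) 0 0 (v$3) 0 0 0, mat2 0 (v$4) 0 0)" for v :: "'k^4"
    by (simp add: lie_embed_def mat3_def mat2_def)
  let ?w = "vector [?p (fst e $ 1 - fst e $ 2), ?p (fst e $ 1 - fst e $ 3), ?p (fst e $ 2 - fst e $ 3),
      ?p (snd e $ 1 - snd e $ 2)] :: 'k^4"
  have "lie_coords (Ad (tau e) (lie_embed v)) = (\<chi> i. ?w $ i * v $ i)" for v :: "'k^4"
    unfolding lie_coords_def Ad_def inv lie
    by (simp add: tau_def diag_eq_mat3 diag_eq_mat2 mat3_mult mat2_mult vec_eq_iff forall_4 vector_4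
        power_int_diff power_int_minus field_simps)
  then have "det (matrix (\<lambda>v. lie_coords (Ad (tau e) (lie_embed v)))) = det (\<chi> i j. ?w $ i * (axis j 1 :: 'k^4) $ i)"
    by (simp add: matrix_def)
  also have "\<dots> = (\<Prod>i\<in>UNIV. ?w $ i)"
    by (subst det_diagonal) (auto simp: axis_def)
  also have "\<dots> = ?p (2 * (fst e $ 1 - fst e $ 3) + (snd e $ 1 - snd e $ 2))"
  proof -
    have "(\<Prod>i\<in>UNIV. ?w $ i) = ?p (fst e $ 1 - fst e $ 2) * (?p (fst e $ 1 - fst e $ 3) *
        (?p (fst e $ 2 - fst e $ 3) * ?p (snd e $ 1 - snd e $ 2)))"
      by (simp only: prod_4 vector_4 mult.assoc)
    also have "\<dots> = ?p ((fst e $ 1 - fst e $ 2) + ((fst e $ 1 - fst e $ 3) + ((fst e $ 2 - fst e $ 3) + (snd e $ 1 - snd e $ 2))))"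
      by (simp only: power_int_add pi_nonzero simp_thms)
    also have "(fst e $ 1 - fst e $ 2) + ((fst e $ 1 - fst e $ 3) + ((fst e $ 2 - fst e $ 3) + (snd e $ 1 - snd e $ 2)))
        = 2 * (fst e $ 1 - fst e $ 3) + (snd e $ 1 - snd e $ 2)"
      by simp
    finally show ?thesis .
  qed
  finally show ?thesis
    by (simp add: modulus_def absval_powi)
qed

lemma modulus_tau_pos: "0 < modulus (tau e)"
  by (simp add: modulus_tau)

lemma modulus_tau_add: "modulus (tau (e + e')) = modulus (tau e) * modulus (tau e')"
  by (simp add: modulus_tau algebra_simps flip: power_int_add)

text \<open>The square root of the modulus times the character of the torus given by
  \<open>s\<close>, as a function of the exponent; composed with \<open>ht\<close> it becomes a
  function on the group.\<close>

definition weight :: "complex mat32 \<Rightarrow> exponents \<Rightarrow> complex"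
  where "weight s e = complex_of_real (sqrt (modulus (tau e))) * monomial_at s e"

lemma weight_add: "s \<in> torus \<Longrightarrow> weight s (e + e') = weight s e * weight s e'"
  by (simp add: weight_def modulus_tau_add monomial_at_add real_sqrt_mult)

text \<open>The torus part of the Iwasawa decomposition modulo \<open>T_c\<close>.
  \<open>iwasawa\<close> and \<open>ht_eq\<close> make the description definite for every group
  element.\<close>

definition ht :: "'k mat32 \<Rightarrow> exponents"
  where "ht g = (THE e. \<exists>a b c d k. k \<in> GL32_integers \<and> g = borel_elt e a b c d \<star> k)"

lemma ht_eq:
  assumes k: "k \<in> GL32_integers"
  shows "ht (borel_elt e a b c d \<star> k) = e"
  unfolding ht_def
proof (rule the_equality)
  fix e' assume "\<exists>a' b' c' d' k'. k' \<in> GL32_integers \<and>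
    borel_elt e a b c d \<star> k = borel_elt e' a' b' c' d' \<star> k'"
  then obtain a' b' c' d' k' where k': "k' \<in> GL32_integers"
    and eq: "borel_elt e a b c d \<star> k = borel_elt e' a' b' c' d' \<star> k'"
    by blast
  have "borel_elt e' a' b' c' d' \<star> (k' \<star> inv\<^bsub>GL32\<^esub> k)
      = (borel_elt e a b c d \<star> k) \<star> inv\<^bsub>GL32\<^esub> k"
    unfolding eq using k k' by (simp add: G.m_assoc)
  also have "\<dots> = borel_elt e a b c d"
    using k by (simp add: G.m_assoc)
  finally show "e' = e"
    using k k' by (intro borel_elt_cong_imp(1)[of "k' \<star> inv\<^bsub>GL32\<^esub> k"]) auto
qed (use k in blast)

lemma ht_borel_elt [simp]: "ht (borel_elt e a b c d) = e"
  using ht_eq[of "\<one>\<^bsub>GL32\<^esub>" e a b c d] by simp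

lemma ht_mult_right:
  assumes "g \<in> carrier GL32" "k \<in> GL32_integers"
  shows "ht (g \<star> k) = ht g"
proof -
  obtain e a b c d k' where k': "k' \<in> GL32_integers" "g = borel_elt e a b c d \<star> k'"
    using iwasawa[OF assms(1)] by blast
  then have "g \<star> k = borel_elt e a b c d \<star> (k' \<star> k)"
    using assms by (simp add: G.m_assoc)
  then show ?thesis
    using k' assms by (simp add: ht_eq)
qed

text \<open>A triangular left factor does not disturb the integral right factor of \<open>g\<close>,
  and exponents of triangular elements add. This one-sided additivity is what makes
  \<open>Phi\<close> multiplicative.\<close>

lemma ht_borel_elt_mult:
  assumes "g \<in> carrier GL32"
  shows "ht (borel_elt e a b c d \<star> g) = e + ht g"
proof -
  obtain e' a' b' c' d' k where k: "k \<in> GL32_integers" "g = borel_elt e' a' b' c' d' \<star> k"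
    using iwasawa[OF assms] by blast
  obtain a'' b'' c'' d'' where
    "borel_elt e a b c d \<star> borel_elt e' a' b' c' d' = borel_elt (e + e') a'' b'' c'' d''"
    using borel_elt_mult by blast
  then have "borel_elt e a b c d \<star> g = borel_elt (e + e') a'' b'' c'' d'' \<star> k"
    using k by (simp flip: G.m_assoc)
  then show ?thesis
    using k by (simp add: ht_eq)
qed

text \<open>The Satake transform evaluated at \<open>s\<close>, written without any measure;
  \<open>dual_torus_fun_satake\<close> identifies it with the integral definition.\<close>

definition Phi :: "complex mat32 \<Rightarrow> ('k mat32 \<Rightarrow> complex) \<Rightarrow> complex"
  where "Phi s f = (\<Sum>\<^sub>\<infinity>r\<in>R. f r * weight s (ht r))"

lemma Phi_conv:
  assumes "s \<in> torus" "hecke_fun f1" "hecke_fun f2"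
  shows "Phi s (conv f1 f2) = Phi s f1 * Phi s f2"
  unfolding Phi_def
proof (rule infsum_conv_character)
  show "right_invariant (\<lambda>r. weight s (ht r))"
    by (simp add: right_invariant_def ht_mult_right)
  show "weight s (ht (r \<star> g)) = weight s (ht r) * weight s (ht g)" if "r \<in> R" "g \<in> carrier GL32" for r g
    using that assms(1) by (auto simp: R_def ht_borel_elt_mult weight_add)
qed (use assms in auto)

lemma Phi_eq_sum_support:
  assumes "finite S" "S \<subseteq> R" "\<And>r. r \<in> R \<Longrightarrow> r \<notin> S \<Longrightarrow> f r = 0"
  shows "Phi s f = (\<Sum>r\<in>S. f r * weight s (ht r))"
  unfolding Phi_def using assms by (intro infsum_eq_sum_support) auto

lemma Phi_lincomb:
  assumes "hecke_fun f1" "hecke_fun f2"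
  shows "Phi s (\<lambda>g. c1 * f1 g + c2 * f2 g) = c1 * Phi s f1 + c2 * Phi s f2"
proof -
  let ?S = "{r \<in> R. f1 r \<noteq> 0} \<union> {r \<in> R. f2 r \<noteq> 0}"
  have "finite ?S"
    using assms by (simp add: hecke_fun_finite)
  then show ?thesis
    by (subst (1 2 3) Phi_eq_sum_support[of ?S]) (auto simp: algebra_simps sum.distrib sum_distrib_left)
qed

section \<open>Cosets in the unipotent radical and the Satake integral\<close>

definition R_unip :: "'k mat32 set"
  where "R_unip = {unip a b c d | a b c d. a \<in> T \<and> b \<in> T \<and> c \<in> T \<and> d \<in> T}"

lemma R_unip_carrier: "u \<in> R_unip \<Longrightarrow> u \<in> carrier GL32"
  by (auto simp: R_unip_def)

lemma borel_elt_in_R: "a \<in> T \<Longrightarrow> b \<in> T \<Longrightarrow> c \<in> T \<Longrightarrow> d \<in> T \<Longrightarrow> borel_elt e a b c d \<in> R"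
  unfolding R_def by blast

lemma tau_mult_R_unip: "u \<in> R_unip \<Longrightarrow> tau e \<star> u \<in> R" "u \<in> R_unip \<Longrightarrow> ht (tau e \<star> u) = e"
proof -
  assume "u \<in> R_unip"
  then obtain a b c d where "u = unip a b c d" "a \<in> T" "b \<in> T" "c \<in> T" "d \<in> T"
    by (auto simp: R_unip_def)
  moreover from this have "tau e \<star> u = borel_elt e a b c d"
    by (simp add: borel_elt_def)
  ultimately show "tau e \<star> u \<in> R" "ht (tau e \<star> u) = e"
    by (simp_all add: borel_elt_in_R)
qed

lemma R_cases:
  assumes "r \<in> R"
  obtains u where "u \<in> R_unip" "r = tau (ht r) \<star> u"
proof -
  obtain e a b c d where *: "r = borel_elt e a b c d" "a \<in> T" "b \<in> T" "c \<in> T" "d \<in> T"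
    using assms by (auto simp: R_def)
  then show ?thesis
    by (intro that[of "unip a b c d"]) (auto simp: R_unip_def borel_elt_def[symmetric])
qed

lemma coset_reps_unip:
  "coset_reps unipotent_group (unipotent_radical \<inter> GL32_integers) R_unip"
proof -
  have sub: "subgroup (unipotent_radical \<inter> GL32_integers) (GL32 :: 'k mat32 monoid)"
    by (intro G.subgroups_Inter_pair subgroup_unipotent_radical K.subgroup_axioms)
  interpret U: group "unipotent_group :: 'k mat32 monoid"
    by (intro subgroup.subgroup_is_group subgroup_unipotent_radical G.group_axioms)
  show ?thesis
  proof (intro coset_reps.intro coset_reps_axioms.intro U.group_axioms)
    show "subgroup (unipotent_radical \<inter> GL32_integers) (unipotent_group :: 'k mat32 monoid)"
      by (intro G.subgroup_incl sub subgroup_unipotent_radical) auto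
    show "R_unip \<subseteq> carrier unipotent_group"
      by (auto simp: R_unip_def unipotent_radical_eq)
    fix u :: "'k mat32" assume "u \<in> carrier unipotent_group"
    then obtain a b c d where u: "u = unip a b c d"
      by (auto simp: unipotent_radical_eq)
    have inv: "inv\<^bsub>unipotent_group\<^esub> r = inv\<^bsub>GL32\<^esub> r" if "r \<in> R_unip" for r
      using that by (intro G.m_inv_consistent subgroup_unipotent_radical) (auto simp: R_unip_def unipotent_radical_eq)
    obtain a' b' c' d' k where k: "a' \<in> T" "b' \<in> T" "c' \<in> T" "d' \<in> T" "k \<in> GL32_integers" "k \<in> unipotent_radical"
      "u = unip a' b' c' d' \<star> k"
      using ex_borel_elt_rep[of a b c d] unfolding u by blast
    show "\<exists>!r. r \<in> R_unip \<and> inv\<^bsub>unipotent_group\<^esub> r \<otimes>\<^bsub>unipotent_group\<^esub> u \<in> unipotent_radical \<inter> GL32_integers"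
    proof (rule ex1I)
      have "inv\<^bsub>GL32\<^esub> (unip a' b' c' d') \<star> u = k"
        using k by (simp flip: G.m_assoc)
      moreover have R: "unip a' b' c' d' \<in> R_unip"
        using k by (auto simp: R_unip_def)
      ultimately show "unip a' b' c' d' \<in> R_unip \<and>
          inv\<^bsub>unipotent_group\<^esub> (unip a' b' c' d') \<otimes>\<^bsub>unipotent_group\<^esub> u \<in> unipotent_radical \<inter> GL32_integers"
        using k inv[OF R] by simp
    next
      fix r assume r: "r \<in> R_unip \<and>
        inv\<^bsub>unipotent_group\<^esub> r \<otimes>\<^bsub>unipotent_group\<^esub> u \<in> unipotent_radical \<inter> GL32_integers"
      then obtain a1 b1 c1 d1 where r1: "r = unip a1 b1 c1 d1" "a1 \<in> T" "b1 \<in> T" "c1 \<in> T" "d1 \<in> T"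
        by (auto simp: R_unip_def)
      define k1 where "k1 = inv\<^bsub>GL32\<^esub> r \<star> u"
      have k1: "k1 \<in> GL32_integers" "r \<star> k1 = u"
        using r inv[of r] by (auto simp: k1_def r1(1) u simp flip: G.m_assoc)
      let ?k = "k1 \<star> inv\<^bsub>GL32\<^esub> k"
      have "r \<star> ?k = u \<star> inv\<^bsub>GL32\<^esub> k"
        unfolding k1(2)[symmetric] using k1(1) k(5) by (simp add: r1(1) G.m_assoc)
      also have "\<dots> = unip a' b' c' d'"
        unfolding k(7) using k(5) by (simp add: G.m_assoc)
      finally have "unip a1 b1 c1 d1 \<star> ?k = unip a' b' c' d'"
        by (simp add: r1(1))
      \<comment> \<open>With exponent 0 the uniqueness statement for the full group specializes to
        the unipotent radical.\<close>
      then have "borel_elt 0 a1 b1 c1 d1 \<star> ?k = borel_elt 0 a' b' c' d'"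
        using k1(1) k(5) by (simp add: borel_elt_def G.m_assoc)
      then show "r = unip a' b' c' d'"
        using borel_elt_inj[of 0 a1 b1 c1 d1 ?k 0 a' b' c' d'] k1(1) k r1 by auto
    qed
  qed
qed

definition coset_sum :: "('k mat32 \<Rightarrow> complex) \<Rightarrow> exponents \<Rightarrow> complex"
  where "coset_sum f e = (\<Sum>\<^sub>\<infinity>u\<in>R_unip. f (tau e \<star> u))"

text \<open>Both transversals take their entries from the same \<open>T\<close>, so the elements of
  \<open>R\<close> of height \<open>e\<close> are exactly \<open>tau e\<close> times those of
  \<open>R_unip\<close>.\<close>

lemma bij_betw_tau_mult:
  "bij_betw (\<lambda>u. tau e \<star> u) {u \<in> R_unip. f (tau e \<star> u) \<noteq> 0} {r \<in> R. f r \<noteq> 0 \<and> ht r = e}"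
proof (rule bij_betw_imageI)
  show "inj_on (\<lambda>u. tau e \<star> u) {u \<in> R_unip. f (tau e \<star> u) \<noteq> 0}"
    by (auto intro!: inj_onI simp: R_unip_carrier)
  show "(\<lambda>u. tau e \<star> u) ` {u \<in> R_unip. f (tau e \<star> u) \<noteq> 0} = {r \<in> R. f r \<noteq> 0 \<and> ht r = e}"
  proof (intro equalityI subsetI)
    fix r assume r: "r \<in> {r \<in> R. f r \<noteq> 0 \<and> ht r = e}"
    then obtain u where "u \<in> R_unip" "r = tau (ht r) \<star> u"
      using R_cases by blast
    then show "r \<in> (\<lambda>u. tau e \<star> u) ` {u \<in> R_unip. f (tau e \<star> u) \<noteq> 0}"
      using r by (intro image_eqI[of _ _ u]) auto
  next
    fix r assume "r \<in> (\<lambda>u. tau e \<star> u) ` {u \<in> R_unip. f (tau e \<star> u) \<noteq> 0}"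
    then obtain u where "u \<in> R_unip" "f (tau e \<star> u) \<noteq> 0" "r = tau e \<star> u"
      by blast
    then show "r \<in> {r \<in> R. f r \<noteq> 0 \<and> ht r = e}"
      by (simp add: tau_mult_R_unip)
  qed
qed

lemma finite_support_tau:
  assumes "hecke_fun f"
  shows "finite {u \<in> R_unip. f (tau e \<star> u) \<noteq> 0}"
proof -
  have "finite {r \<in> R. f r \<noteq> 0 \<and> ht r = e}"
    using hecke_fun_finite[OF assms] by (rule rev_finite_subset) auto
  then show ?thesis
    using bij_betw_finite[OF bij_betw_tau_mult[of e f]] by simp
qed

lemma coset_sum_eq_sum:
  assumes "hecke_fun f"
  shows "coset_sum f e = (\<Sum>r | r \<in> R \<and> f r \<noteq> 0 \<and> ht r = e. f r)"
proof -
  have "coset_sum f e = (\<Sum>u | u \<in> R_unip \<and> f (tau e \<star> u) \<noteq> 0. f (tau e \<star> u))"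
    unfolding coset_sum_def using finite_support_tau[OF assms] by (intro infsum_eq_sum_support) auto
  also have "\<dots> = (\<Sum>r | r \<in> R \<and> f r \<noteq> 0 \<and> ht r = e. f r)"
    using bij_betw_tau_mult[of e f] by (rule sum.reindex_bij_betw)
  finally show ?thesis .
qed

lemma Phi_eq_sum_coset_sum:
  assumes "hecke_fun f" "finite E" "\<And>r. r \<in> R \<Longrightarrow> f r \<noteq> 0 \<Longrightarrow> ht r \<in> E"
  shows "Phi s f = (\<Sum>e\<in>E. coset_sum f e * weight s e)"
proof -
  let ?S = "{r \<in> R. f r \<noteq> 0}"
  have fin: "finite ?S"
    using assms by (simp add: hecke_fun_finite)
  have "Phi s f = (\<Sum>r\<in>?S. f r * weight s (ht r))"
    using fin by (intro Phi_eq_sum_support) auto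
  also have "\<dots> = (\<Sum>e\<in>E. \<Sum>r\<in>{r \<in> ?S. ht r = e}. f r * weight s (ht r))"
    using fin assms by (intro sum.group[symmetric]) auto
  also have "\<dots> = (\<Sum>e\<in>E. coset_sum f e * weight s e)"
    using assms(1) by (intro sum.cong) (auto simp: coset_sum_eq_sum sum_distrib_right conj_assoc intro!: sum.cong)
  finally show ?thesis .
qed

text \<open>For fixed \<open>e\<close> the integrand is right invariant under the integral
  unipotents, which have volume 1, so the integral over U counts cosets.\<close>

lemma satake_eq_coset_sum:
  assumes \<nu>: "haar_measure_on unipotent_group \<nu>" "emeasure \<nu> (unipotent_radical \<inter> GL32_integers) = 1"
    and f: "hecke_fun f"
  shows "satake \<nu> f (tau e) = complex_of_real (sqrt (modulus (tau e))) * coset_sum f e"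
proof -
  interpret U: haar_coset_reps "unipotent_group :: 'k mat32 monoid" "unipotent_radical \<inter> GL32_integers" R_unip \<nu>
  proof (intro haar_coset_reps.intro haar_coset_reps_axioms.intro coset_reps_unip)
    show "space \<nu> = carrier unipotent_group"
      by (rule haar_measure_space[OF \<nu>(1)])
    show "emeasure \<nu> (g <#\<^bsub>unipotent_group\<^esub> A) = emeasure \<nu> A" if "g \<in> carrier unipotent_group" "A \<in> sets \<nu>" for g A
      using haar_measure_left_invariant[OF \<nu>(1)] that by blast
  qed (rule \<nu>(2))
  have "(LINT u|\<nu>. f (tau e \<star> u)) = coset_sum f e"
    unfolding coset_sum_def
  proof (rule U.integral_eq_infsum)
    show "U.right_invariant (\<lambda>u. f (tau e \<star> u))"
      unfolding U.right_invariant_def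
    proof (intro ballI)
      fix u k :: "'k mat32" assume u: "u \<in> carrier unipotent_group" and k: "k \<in> unipotent_radical \<inter> GL32_integers"
      have "u \<in> carrier GL32"
        using u subgroup.subset[OF subgroup_unipotent_radical] by auto
      then show "f (tau e \<star> (u \<otimes>\<^bsub>unipotent_group\<^esub> k)) = f (tau e \<star> u)"
        using k f hecke_fun_right[of f k "tau e \<star> u"] by (simp add: G.m_assoc)
    qed
  qed (rule finite_support_tau[OF f])
  then show ?thesis
    by (simp add: satake_def)
qed

lemma dual_torus_fun_satake:
  assumes \<nu>: "haar_measure_on unipotent_group \<nu>" "emeasure \<nu> (unipotent_radical \<inter> GL32_integers) = 1"
    and f: "hecke_fun f"
  shows "dual_torus_fun \<pi> (satake \<nu> f) s = Phi s f"
proof -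
  let ?E = "ht ` {r \<in> R. f r \<noteq> 0}" and ?m = "\<lambda>e. complex_of_real (sqrt (modulus (tau e)))"
  let ?c = "\<lambda>e. ?m e * coset_sum f e"
  have m: "?m e \<noteq> 0" for e
    using modulus_tau_pos[of e] by simp
  have fin: "finite ?E"
    using f by (simp add: hecke_fun_finite)
  \<comment> \<open>Only an inclusion holds: the values of \<open>f\<close> at one height may
    cancel. The sum over the nonzero coefficients can still be extended to all heights.\<close>
  have "{e. ?c e \<noteq> 0} \<subseteq> ?E"
  proof
    fix e assume "e \<in> {e. ?c e \<noteq> 0}"
    then have "(\<Sum>r | r \<in> R \<and> f r \<noteq> 0 \<and> ht r = e. f r) \<noteq> 0"
      using f by (simp add: coset_sum_eq_sum)
    then show "e \<in> ?E"
      by (auto elim: sum.not_neutral_contains_not_neutral)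
  qed
  then have "(\<Sum>e | ?c e \<noteq> 0. ?c e * monomial_at s e) = (\<Sum>e\<in>?E. ?c e * monomial_at s e)"
    using fin by (intro sum.mono_neutral_left) auto
  also have "\<dots> = Phi s f"
    using f fin by (subst Phi_eq_sum_coset_sum[of f ?E]) (auto simp: weight_def mult_ac)
  finally have "(\<Sum>e | ?c e \<noteq> 0. ?c e * monomial_at s e) = Phi s f" .
  moreover have "satake \<nu> f (diag (\<chi> i. \<pi> powi (a $ i)), diag (\<chi> j. \<pi> powi (b $ j))) = ?c (a, b)" for a b
    using satake_eq_coset_sum[OF \<nu> f, of "(a, b)"] by (simp add: tau_def)
  ultimately show ?thesis
    by (simp add: dual_torus_fun_def monomial_at_def case_prod_beta mult.assoc)
qed

end

section \<open>Injectivity of the Satake transform\<close>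

text \<open>Dedekind's argument. Multiplying the variable by \<open>x\<close> and subtracting
  \<open>\<psi> e0 x\<close> times the original relation removes \<open>e0\<close> and scales the
  coefficient of \<open>e\<close> by \<open>\<psi> e x - \<psi> e0 x\<close>, which is nonzero for a
  separating \<open>x\<close>.\<close>

lemma characters_independent:
  fixes \<psi> :: "'e \<Rightarrow> 'x \<Rightarrow> complex" and c :: "'e \<Rightarrow> complex"
  assumes "finite E"
    and ne: "M \<noteq> {}" and closed: "\<And>x y. x \<in> M \<Longrightarrow> y \<in> M \<Longrightarrow> m x y \<in> M"
    and mult: "\<And>e x y. x \<in> M \<Longrightarrow> y \<in> M \<Longrightarrow> \<psi> e (m x y) = \<psi> e x * \<psi> e y"
    and nz: "\<And>e x. x \<in> M \<Longrightarrow> \<psi> e x \<noteq> 0"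
    and sep: "\<And>e e'. e \<noteq> e' \<Longrightarrow> \<exists>x\<in>M. \<psi> e x \<noteq> \<psi> e' x"
    and "\<And>x. x \<in> M \<Longrightarrow> (\<Sum>e\<in>E. c e * \<psi> e x) = 0"
  shows "\<forall>e\<in>E. c e = 0"
  using assms(1,7)
proof (induction E arbitrary: c rule: finite_induct)
  case (insert e0 E)
  have E0: "c e = 0" if e: "e \<in> E" for e
  proof -
    obtain x where x: "x \<in> M" "\<psi> e x \<noteq> \<psi> e0 x"
      using sep[of e e0] insert.hyps e by metis
    have "(\<Sum>e\<in>E. (c e * (\<psi> e x - \<psi> e0 x)) * \<psi> e y) = 0" if y: "y \<in> M" for y
    proof -
      have "(\<Sum>e\<in>insert e0 E. c e * \<psi> e (m x y)) - \<psi> e0 x * (\<Sum>e\<in>insert e0 E. c e * \<psi> e y) = 0"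
        using insert.prems[OF closed[OF x(1) y]] insert.prems[OF y] by simp
      moreover have "(\<Sum>e\<in>insert e0 E. c e * \<psi> e (m x y)) - \<psi> e0 x * (\<Sum>e\<in>insert e0 E. c e * \<psi> e y)
          = (\<Sum>e\<in>insert e0 E. (c e * (\<psi> e x - \<psi> e0 x)) * \<psi> e y)"
        using x y by (simp only: mult sum_distrib_left sum_subtractf[symmetric]) (simp add: algebra_simps)
      ultimately show ?thesis
        using insert.hyps by simp
    qed
    then have "c e * (\<psi> e x - \<psi> e0 x) = 0"
      using insert.IH[of "\<lambda>e. c e * (\<psi> e x - \<psi> e0 x)"] e by blast
    then show ?thesis
      using x by simp
  qed
  moreover obtain x where x: "x \<in> M"
    using ne by blast
  moreover from x have "c e0 * \<psi> e0 x = 0"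
    using insert.prems[OF x] insert.hyps E0 by simp
  ultimately show ?case
    using nz by simp
qed simp

lemma powi_2_inj: "(2::complex) powi m = 2 powi n \<Longrightarrow> m = n"
proof -
  assume "(2::complex) powi m = 2 powi n"
  then have "norm ((2::complex) powi m) = norm ((2::complex) powi n)"
    by simp
  then have "(2::real) powi m = 2 powi n"
    by (simp add: norm_power_int)
  then show "m = n"
    using power_int_strict_increasing[of m n "2::real"] power_int_strict_increasing[of n m "2::real"]
    by (cases m n rule: linorder_cases) auto
qed

lemma monomials_independent:
  fixes c :: "exponents \<Rightarrow> complex"
  assumes "finite E" "\<And>s. s \<in> torus \<Longrightarrow> (\<Sum>e\<in>E. c e * monomial_at s e) = 0"
  shows "\<forall>e\<in>E. c e = 0"
proof -
  define M where "M = {x :: (complex^3) \<times> (complex^2). (\<forall>i. fst x $ i \<noteq> 0) \<and> (\<forall>j. snd x $ j \<noteq> 0)}"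
  define tor where "tor x = (diag (fst x), diag (snd x))" for x :: "(complex^3) \<times> (complex^2)"
  have mon: "monomial_at (tor x) e = (\<Prod>i\<in>UNIV. (fst x $ i) powi (fst e $ i)) * (\<Prod>j\<in>UNIV. (snd x $ j) powi (snd e $ j))" for x e
    by (simp add: monomial_at_def tor_def diag_def)
  show ?thesis
  proof (rule characters_independent[where M = M and \<psi> = "\<lambda>e x. monomial_at (tor x) e"
        and m = "\<lambda>x y. (fst x * fst y, snd x * snd y)"])
    have "((\<chi> i. 1, \<chi> j. 1) :: (complex^3) \<times> (complex^2)) \<in> M"
      by (simp add: M_def)
    then show "M \<noteq> {}"
      by blast
  next
    fix e e' :: exponents assume "e \<noteq> e'"
    then consider i where "fst e $ i \<noteq> fst e' $ i" | j where "snd e $ j \<noteq> snd e' $ j"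
      by (auto simp: prod_eq_iff vec_eq_iff)
    then show "\<exists>x\<in>M. monomial_at (tor x) e \<noteq> monomial_at (tor x) e'"
    proof cases
      case 1
      \<comment> \<open>Distinct integer powers of 2 are distinct, so the point with 2 in position
        \<open>i\<close> and 1 elsewhere separates exponents that differ there.\<close>
      have *: "monomial_at (tor (\<chi> k. if k = i then 2 else 1, \<chi> k. 1)) e'' = 2 powi (fst e'' $ i)" for e''
      proof -
        have "(\<Prod>k\<in>UNIV. (if k = i then 2 else 1 :: complex) powi (fst e'' $ k)) = (\<Prod>k\<in>UNIV. if k = i then 2 powi (fst e'' $ k) else 1)"
          by (intro prod.cong) auto
        then show ?thesis
          by (simp add: mon)
      qed
      show ?thesis
        by (rule bexI[of _ "(\<chi> k. if k = i then 2 else 1, \<chi> k. 1)"])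
          (use 1 powi_2_inj in \<open>auto simp: * M_def\<close>)
    next
      case 2
      have *: "monomial_at (tor (\<chi> k. 1, \<chi> k. if k = j then 2 else 1)) e'' = 2 powi (snd e'' $ j)" for e''
      proof -
        have "(\<Prod>k\<in>UNIV. (if k = j then 2 else 1 :: complex) powi (snd e'' $ k)) = (\<Prod>k\<in>UNIV. if k = j then 2 powi (snd e'' $ k) else 1)"
          by (intro prod.cong) auto
        then show ?thesis
          by (simp add: mon)
      qed
      show ?thesis
        by (rule bexI[of _ "(\<chi> k. 1, \<chi> k. if k = j then 2 else 1)"])
          (use 2 powi_2_inj in \<open>auto simp: * M_def\<close>)
    qed
  next
    fix x assume "x \<in> M"
    then have "tor x \<in> torus"
      by (auto simp: M_def tor_def torus_def diag_def carrier_GL32' det_3 det_2)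
    then show "(\<Sum>e\<in>E. c e * monomial_at (tor x) e) = 0"
      by (rule assms)
  qed (auto simp: M_def mon power_int_mult_distrib prod.distrib assms(1))
qed

lemma ex_lexicographic_min:
  fixes p q r :: "'e \<Rightarrow> int"
  assumes "finite E" "E \<noteq> {}"
  shows "\<exists>e\<in>E. \<forall>e'\<in>E. p e \<le> p e' \<and> (p e' = p e \<longrightarrow> q e \<le> q e' \<and> (q e' = q e \<longrightarrow> r e \<le> r e'))"
proof -
  have min: "\<exists>e\<in>S. \<forall>e'\<in>S. f e \<le> f e'" if "S \<subseteq> E" "S \<noteq> {}" for S and f :: "'e \<Rightarrow> int"
    using that assms(1) arg_min_if_finite[of S f] finite_subset by (metis linorder_not_le)
  obtain e1 where e1: "e1 \<in> E" "\<forall>e'\<in>E. p e1 \<le> p e'"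
    using min[of E p] assms by blast
  obtain e2 where e2: "e2 \<in> E" "p e2 = p e1" "\<forall>e'\<in>{e \<in> E. p e = p e1}. q e2 \<le> q e'"
    using min[of "{e \<in> E. p e = p e1}" q] e1 by blast
  obtain e3 where "e3 \<in> E" "p e3 = p e1" "q e3 = q e2" "\<forall>e'\<in>{e \<in> E. p e = p e1 \<and> q e = q e2}. r e3 \<le> r e'"
    using min[of "{e \<in> E. p e = p e1 \<and> q e = q e2}" r] e2 by blast
  then show ?thesis
    using e1 e2 by (intro bexI[of _ e3]) auto
qed

context fractional_reps
begin

text \<open>The last row of a triangular times an integral matrix is a power of \<pi> times an
  integral row, so its entries bound the last exponent. When the first two entries of the third row
  vanish, the same holds for the first two entries of the second row.\<close>

lemma ht_bounds:
  assumes g: "g \<in> carrier GL32"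
  shows "absval (fst g $ 3 $ j) \<le> absval \<pi> powi (fst (ht g) $ 3)"
    and "fst g $ 3 $ 1 = 0 \<Longrightarrow> fst g $ 3 $ 2 = 0 \<Longrightarrow> absval (fst g $ 2 $ 1) \<le> absval \<pi> powi (fst (ht g) $ 2)"
    and "fst g $ 3 $ 1 = 0 \<Longrightarrow> fst g $ 3 $ 2 = 0 \<Longrightarrow> absval (fst g $ 2 $ 2) \<le> absval \<pi> powi (fst (ht g) $ 2)"
    and "absval (snd g $ 2 $ l) \<le> absval \<pi> powi (snd (ht g) $ 2)"
proof -
  obtain e a b c d k where k: "k \<in> GL32_integers" "g = borel_elt e a b c d \<star> k"
    using iwasawa[OF g] by blast
  have e: "ht g = e"
    using k by (simp add: ht_eq)
  obtain k11 k12 k13 k21 k22 k23 k31 k32 k33 where k3: "fst k = mat3 k11 k12 k13 k21 k22 k23 k31 k32 k33"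
    by (rule mat3_cases)
  obtain l11 l12 l21 l22 where k2: "snd k = mat2 l11 l12 l21 l22"
    by (rule mat2_cases)
  have le: "absval (\<pi> powi m * x) \<le> absval \<pi> powi m" if "x \<in> integers" for m x
    using that by (simp add: absval_mult absval_powi integers_iff mult_left_le)
  have int: "k31 \<in> integers" "k32 \<in> integers" "k33 \<in> integers" "k21 \<in> integers" "k22 \<in> integers"
    "l21 \<in> integers" "l22 \<in> integers"
    using k(1) by (auto simp: GL32_integers_def mem_Times_iff k3 k2 mat3_GL_integers_iff mat2_GL_integers_iff)
  note simps = k(2) borel_elt_eq mult_GL32 k3 k2 mat3_mult mat2_mult
  show "absval (fst g $ 3 $ j) \<le> absval \<pi> powi (fst (ht g) $ 3)"
    using exhaust_3[of j] int unfolding e by (auto simp: simps le)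
  show "absval (snd g $ 2 $ l) \<le> absval \<pi> powi (snd (ht g) $ 2)"
    using exhaust_2[of l] int unfolding e by (auto simp: simps le)
  show "absval (fst g $ 2 $ 1) \<le> absval \<pi> powi (fst (ht g) $ 2)" "absval (fst g $ 2 $ 2) \<le> absval \<pi> powi (fst (ht g) $ 2)"
    if "fst g $ 3 $ 1 = 0" "fst g $ 3 $ 2 = 0"
    using that int unfolding e by (auto simp: simps le)
qed

text \<open>With the torus factor on the right, integrality of the scaled entries means that the
  unipotent factor lies in \<open>K\<close> and disappears under left invariance.\<close>

lemma borel_elt_eq_left:
  "borel_elt e a b c d =
    unip (\<pi> powi (fst e $ 1 - fst e $ 2) * a) (\<pi> powi (fst e $ 1 - fst e $ 3) * b)
      (\<pi> powi (fst e $ 2 - fst e $ 3) * c) (\<pi> powi (snd e $ 1 - snd e $ 2) * d) \<star> tau e"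
  unfolding tau_eq_borel_elt borel_elt_eq
  by (simp add: unip_def mult_GL32 mat3_mult mat2_mult mat3_eq_iff mat2_eq_iff power_int_diff)

lemma ht_rep: "g \<in> carrier GL32 \<Longrightarrow> ht (rep g) = ht g"
  using ht_mult_right[of "rep g" "inv\<^bsub>GL32\<^esub> (rep g) \<star> g"] eq_rep_mult[of g]
  by (simp add: rep_carrier rep_inv_mult)

text \<open>
  For the lexicographically smallest exponent on the support, permuting rows bounds the entries
  above the diagonal, so they can be cleared by row operations over the integers.
\<close>

lemma Phi_inject_0:
  assumes f: "hecke_fun f" and 0: "\<And>s. s \<in> torus \<Longrightarrow> Phi s f = 0"
  shows "f g = 0"
proof (rule ccontr)
  assume g: "f g \<noteq> 0"
  define E where "E = ht ` {r \<in> R. f r \<noteq> 0}"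
  have fin: "finite E"
    using f by (simp add: E_def hecke_fun_finite)
  have ht_E: "ht x \<in> E" if "f x \<noteq> 0" for x
  proof -
    have x: "x \<in> carrier GL32"
      using that f hecke_fun_outside by blast
    then have "f (rep x) \<noteq> 0"
      using that f by (simp add: right_invariant_rep hecke_fun_right_invariant)
    then show ?thesis
      using x ht_rep[of x] rep_mem[of x] unfolding E_def by (intro image_eqI[of _ _ "rep x"]) auto
  qed
  obtain e where e: "e \<in> E" and min: "\<And>e'. e' \<in> E \<Longrightarrow> fst e $ 3 \<le> fst e' $ 3 \<and>
      (fst e' $ 3 = fst e $ 3 \<longrightarrow> fst e $ 2 \<le> fst e' $ 2 \<and> (fst e' $ 2 = fst e $ 2 \<longrightarrow> snd e $ 2 \<le> snd e' $ 2))"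
    using ex_lexicographic_min[OF fin, of "\<lambda>e. fst e $ 3" "\<lambda>e. fst e $ 2" "\<lambda>e. snd e $ 2"] ht_E[OF g] by blast
  have const: "f r = f (tau e)" if r: "r \<in> R" "f r \<noteq> 0" "ht r = e" for r
  proof -
    obtain a b c d where r_eq: "r = borel_elt e a b c d"
      using r by (auto simp: R_def)
    let ?r = "absval \<pi>" and ?i2 = "mat2 1 0 0 1 :: 'k^2^2" and ?i3 = "mat3 1 0 0 0 1 0 0 0 1 :: 'k^3^3"
    have swap: "f (w \<star> r) \<noteq> 0" "ht (w \<star> r) \<in> E" "w \<star> r \<in> carrier GL32" if "w \<in> GL32_integers" for w
      using that r f ht_E[of "w \<star> r"] by (auto simp: hecke_fun_left R_carrier)
    have powi: "?r powi m \<le> ?r powi n \<longleftrightarrow> n \<le> m" for m n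
      by (rule uniformizer_powi_le_iff[OF unif])
    have ab: "absval (\<pi> powi m) = ?r powi m" for m
      by (rule absval_powi)
    have c: "absval (\<pi> powi (fst e $ 2) * c) \<le> ?r powi (fst e $ 3)"
    proof -
      let ?w = "(mat3 1 0 0 0 0 1 0 1 0, ?i2)"
      have w: "?w \<in> GL32_integers"
        by (simp add: GL32_integers_def mat3_GL_integers_iff mat2_GL_integers_iff)
      have "absval (\<pi> powi (fst e $ 2) * c) \<le> ?r powi (fst (ht (?w \<star> r)) $ 3)"
        using ht_bounds(1)[OF swap(3)[OF w], of 3] by (simp add: r_eq borel_elt_eq mult_GL32 mat3_mult)
      also have "\<dots> \<le> ?r powi (fst e $ 3)"
        using min[OF swap(2)[OF w]] by (simp add: powi)
      finally show ?thesis .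
    qed
    have b: "absval (\<pi> powi (fst e $ 1) * b) \<le> ?r powi (fst e $ 3)"
    proof -
      let ?w = "(mat3 0 0 1 0 1 0 1 0 0, ?i2)"
      have w: "?w \<in> GL32_integers"
        by (simp add: GL32_integers_def mat3_GL_integers_iff mat2_GL_integers_iff)
      have "absval (\<pi> powi (fst e $ 1) * b) \<le> ?r powi (fst (ht (?w \<star> r)) $ 3)"
        using ht_bounds(1)[OF swap(3)[OF w], of 3] by (simp add: r_eq borel_elt_eq mult_GL32 mat3_mult)
      also have "\<dots> \<le> ?r powi (fst e $ 3)"
        using min[OF swap(2)[OF w]] by (simp add: powi)
      finally show ?thesis .
    qed
    have a: "absval (\<pi> powi (fst e $ 1) * a) \<le> ?r powi (fst e $ 2)"
    proof -
      let ?w = "(mat3 0 1 0 1 0 0 0 0 1, ?i2)"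
      have w: "?w \<in> GL32_integers"
        by (simp add: GL32_integers_def mat3_GL_integers_iff mat2_GL_integers_iff)
      let ?e = "ht (?w \<star> r)"
      \<comment> \<open>This swap leaves the third row alone, so the third exponent cannot increase.
        Minimality makes it equal, and only then may the second exponents be compared.\<close>
      have "?r powi (fst e $ 3) \<le> ?r powi (fst ?e $ 3)"
        using ht_bounds(1)[OF swap(3)[OF w], of 3] by (simp add: r_eq borel_elt_eq mult_GL32 mat3_mult ab)
      then have "fst ?e $ 3 = fst e $ 3"
        using min[OF swap(2)[OF w]] unfolding powi by linarith
      then have le: "fst e $ 2 \<le> fst ?e $ 2"
        using min[OF swap(2)[OF w]] by blast
      have "absval (\<pi> powi (fst e $ 1) * a) \<le> ?r powi (fst ?e $ 2)"
        using ht_bounds(3)[OF swap(3)[OF w]] by (simp add: r_eq borel_elt_eq mult_GL32 mat3_mult)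
      also have "\<dots> \<le> ?r powi (fst e $ 2)"
        using le by (simp add: powi)
      finally show ?thesis .
    qed
    have d: "absval (\<pi> powi (snd e $ 1) * d) \<le> ?r powi (snd e $ 2)"
    proof -
      let ?w = "(?i3, mat2 0 1 1 0)"
      have w: "?w \<in> GL32_integers"
        by (simp add: GL32_integers_def mat3_GL_integers_iff mat2_GL_integers_iff)
      let ?e = "ht (?w \<star> r)"
      have "?r powi (fst e $ 3) \<le> ?r powi (fst ?e $ 3)"
        using ht_bounds(1)[OF swap(3)[OF w], of 3] by (simp add: r_eq borel_elt_eq mult_GL32 mat3_mult ab)
      then have 3: "fst ?e $ 3 = fst e $ 3"
        using min[OF swap(2)[OF w]] unfolding powi by linarith
      \<comment> \<open>The swap acts on the second factor only; the first two comparisons must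
        again be shown to be ties before the last one can be used.\<close>
      have "?r powi (fst e $ 2) \<le> ?r powi (fst ?e $ 2)"
        using ht_bounds(3)[OF swap(3)[OF w]] by (simp add: r_eq borel_elt_eq mult_GL32 mat3_mult ab)
      then have "fst ?e $ 2 = fst e $ 2"
        using min[OF swap(2)[OF w]] 3 unfolding powi by linarith
      then have le: "snd e $ 2 \<le> snd ?e $ 2"
        using min[OF swap(2)[OF w]] 3 by blast
      have "absval (\<pi> powi (snd e $ 1) * d) \<le> ?r powi (snd ?e $ 2)"
        using ht_bounds(4)[OF swap(3)[OF w], of 2] by (simp add: r_eq borel_elt_eq mult_GL32 mat2_mult)
      also have "\<dots> \<le> ?r powi (snd e $ 2)"
        using le by (simp add: powi)
      finally show ?thesis .
    qed
    have int: "\<pi> powi (m - n) * x \<in> integers" if "absval (\<pi> powi m * x) \<le> ?r powi n" for m n x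
      using that by (simp add: integers_iff absval_mult absval_divide absval_powi power_int_diff field_simps)
    show ?thesis
      unfolding r_eq borel_elt_eq_left
      by (intro hecke_fun_left[OF f]) (simp_all add: unip_integers_iff int a b c d)
  qed
  obtain r where r: "r \<in> R" "f r \<noteq> 0" "ht r = e"
    using e by (auto simp: E_def)
  have "\<forall>e\<in>E. complex_of_real (sqrt (modulus (tau e))) * coset_sum f e = 0"
  proof (rule monomials_independent[OF fin])
    fix s :: "complex mat32" assume "s \<in> torus"
    then have "(\<Sum>e\<in>E. coset_sum f e * weight s e) = 0"
      using 0[of s] Phi_eq_sum_coset_sum[OF f fin] by (auto simp: E_def)
    then show "(\<Sum>e\<in>E. complex_of_real (sqrt (modulus (tau e))) * coset_sum f e * monomial_at s e) = 0"
      by (simp add: weight_def mult_ac)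
  qed
  then have "coset_sum f e = 0"
    using e modulus_tau_pos[of e] by auto
  moreover have "coset_sum f e = of_nat (card {r \<in> R. f r \<noteq> 0 \<and> ht r = e}) * f (tau e)"
  proof -
    have "coset_sum f e = (\<Sum>r | r \<in> R \<and> f r \<noteq> 0 \<and> ht r = e. f (tau e))"
      unfolding coset_sum_eq_sum[OF f] using const by (intro sum.cong) auto
    then show ?thesis
      by simp
  qed
  moreover have "card {r \<in> R. f r \<noteq> 0 \<and> ht r = e} \<noteq> 0"
  proof -
    have "finite {r \<in> R. f r \<noteq> 0 \<and> ht r = e}"
      using hecke_fun_finite[OF f] by (rule rev_finite_subset) auto
    then show ?thesis
      using r card_gt_0_iff[of "{r \<in> R. f r \<noteq> 0 \<and> ht r = e}"] by blast
  qed
  moreover have "f (tau e) \<noteq> 0"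
    using const[OF r] r by simp
  ultimately show False
    by simp
qed

lemma hecke_fun_lincomb:
  assumes "hecke_fun f1" "hecke_fun f2"
  shows "hecke_fun (\<lambda>g. c1 * f1 g + c2 * f2 g)"
proof -
  have "finite ({r \<in> R. f1 r \<noteq> 0} \<union> {r \<in> R. f2 r \<noteq> 0})"
    using assms by (simp add: hecke_fun_finite)
  then have "finite {r \<in> R. c1 * f1 r + c2 * f2 r \<noteq> 0}"
    by (rule rev_finite_subset) auto
  then show ?thesis
    using assms by (simp add: hecke_fun_def)
qed

lemma Phi_inject:
  assumes "hecke_fun f1" "hecke_fun f2" "\<And>s. s \<in> torus \<Longrightarrow> Phi s f1 = Phi s f2"
  shows "f1 = f2"
proof
  fix g
  have "1 * f1 g + (- 1) * f2 g = 0"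
    using assms Phi_lincomb[OF assms(1,2), of _ 1 "-1"]
    by (intro Phi_inject_0[of "\<lambda>g. 1 * f1 g + (- 1) * f2 g"] hecke_fun_lincomb) simp_all
  then show "f1 g = f2 g"
    by simp
qed

end

section \<open>The integral Hecke algebra is a commutative ring\<close>

locale hecke_setup = fractional_reps \<pi> T
  for \<pi> :: "'k::nonarch_local_field" and T +
  fixes \<mu> :: "'k mat32 measure"
  assumes haar: "haar_measure_on GL32 \<mu>" and vol_K: "emeasure \<mu> GL32_integers = 1"
begin

sublocale M: haar_coset_reps "GL32 :: 'k mat32 monoid" GL32_integers R \<mu>
  by unfold_locales (use haar_measure_space[OF haar] haar_measure_left_invariant[OF haar] vol_K in auto)

definition H where "H = hecke_algebra (GL32 :: 'k mat32 monoid) \<mu> GL32_integers \<int>"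

lemma carrier_H: "f \<in> carrier H \<longleftrightarrow> hecke_fun f \<and> range f \<subseteq> \<int>"
  unfolding H_def using hecke_algebra_iff_hecke_fun coset_reps_axioms by blast

lemma mult_H: "f1 \<in> carrier H \<Longrightarrow> f2 \<in> carrier H \<Longrightarrow> f1 \<otimes>\<^bsub>H\<^esub> f2 = conv f1 f2"
proof
  fix g assume f: "f1 \<in> carrier H" "f2 \<in> carrier H"
  have "(LINT x|\<mu>. f1 x * f2 (inv\<^bsub>GL32\<^esub> x \<star> g)) = (\<Sum>\<^sub>\<infinity>x\<in>R. f1 x * f2 (inv\<^bsub>GL32\<^esub> x \<star> g))"
    if "g \<in> carrier GL32"
    using f that
    by (intro M.integral_eq_infsum conv_integrand_right_invariant finite_support_mult hecke_fun_finite[of f1])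
      (simp_all add: carrier_H)
  then show "(f1 \<otimes>\<^bsub>H\<^esub> f2) g = conv f1 f2 g"
    by (simp add: H_def hecke_algebra_def conv_def)
qed

lemma one_H: "\<one>\<^bsub>H\<^esub> = indicator GL32_integers"
  and zero_H: "\<zero>\<^bsub>H\<^esub> = (\<lambda>_. 0)"
  and add_H: "f1 \<oplus>\<^bsub>H\<^esub> f2 = (\<lambda>g. f1 g + f2 g)"
  by (simp_all add: H_def hecke_algebra_def)

lemma rep_one: "r \<in> R \<Longrightarrow> r \<in> GL32_integers \<Longrightarrow> r = tau 0"
proof -
  assume r: "r \<in> R" "r \<in> GL32_integers"
  have "tau 0 = \<one>\<^bsub>GL32\<^esub>"
    by (simp add: tau_def one_GL32 mat_1_eq_mat3 mat_1_eq_mat2 diag_eq_mat3 diag_eq_mat2)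
  moreover have "\<one>\<^bsub>GL32\<^esub> \<in> R"
    using borel_elt_in_R[of 0 0 0 0 0] zero_T calculation by (simp add: tau_eq_borel_elt)
  moreover have "rep \<one>\<^bsub>GL32\<^esub> = r"
    using r by (intro rep_eqI) (auto simp: R_carrier)
  ultimately show ?thesis
    using rep_of_rep by auto
qed

lemma hecke_fun_one: "hecke_fun \<one>\<^bsub>H\<^esub>"
proof -
  have "{r \<in> R. indicator GL32_integers r \<noteq> (0::complex)} \<subseteq> {tau 0}"
    using rep_one by (blast elim: contrapos_np intro: indicator_simps(2))
  then have "finite {r \<in> R. indicator GL32_integers r \<noteq> (0::complex)}"
    by (rule finite_subset) simp
  moreover have "k \<star> x \<star> k' \<in> GL32_integers \<longleftrightarrow> x \<in> GL32_integers"
    if k: "k \<in> GL32_integers" and x: "x \<in> carrier GL32" and k': "k' \<in> GL32_integers" for k x k' :: "'k mat32"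
  proof
    assume *: "k \<star> x \<star> k' \<in> GL32_integers"
    have "inv\<^bsub>GL32\<^esub> k \<star> ((k \<star> x \<star> k') \<star> inv\<^bsub>GL32\<^esub> k') = inv\<^bsub>GL32\<^esub> k \<star> (k \<star> x)"
      using k x k' by (simp add: G.m_assoc)
    also have "\<dots> = x"
      using k x by (simp flip: G.m_assoc)
    finally show "x \<in> GL32_integers"
      using k k' * by (metis K.m_closed K.m_inv_closed)
  qed (use that in auto)
  ultimately show ?thesis
    by (auto simp: one_H hecke_fun_def indicator_def)
qed

lemma Phi_one: "s \<in> torus \<Longrightarrow> Phi s \<one>\<^bsub>H\<^esub> = 1"
proof -
  assume "s \<in> torus"
  have "tau 0 \<in> R" "tau 0 \<in> GL32_integers" "ht (tau 0) = 0"
    using borel_elt_in_R[of 0 0 0 0 0] zero_T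
    by (auto simp: tau_eq_borel_elt) (simp add: borel_elt_eq GL32_integers_def mat3_GL_integers_iff mat2_GL_integers_iff)
  moreover have "Phi s \<one>\<^bsub>H\<^esub> = (\<Sum>r\<in>{tau 0}. \<one>\<^bsub>H\<^esub> r * weight s (ht r))"
  proof (rule Phi_eq_sum_support)
    fix r assume "r \<in> R" "r \<notin> {tau 0}"
    then have "r \<notin> GL32_integers"
      using rep_one[of r] by blast
    then show "\<one>\<^bsub>H\<^esub> r = 0"
      by (simp add: one_H)
  qed (use calculation in auto)
  ultimately have "Phi s \<one>\<^bsub>H\<^esub> = weight s 0"
    by (simp add: one_H)
  also have "\<dots> = 1"
    by (simp add: weight_def modulus_tau monomial_at_def)
  finally show ?thesis .
qed

lemma H_closed:
  "\<one>\<^bsub>H\<^esub> \<in> carrier H" "\<zero>\<^bsub>H\<^esub> \<in> carrier H"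
  "f1 \<in> carrier H \<Longrightarrow> f2 \<in> carrier H \<Longrightarrow> f1 \<oplus>\<^bsub>H\<^esub> f2 \<in> carrier H"
  "f1 \<in> carrier H \<Longrightarrow> (\<lambda>g. - f1 g) \<in> carrier H"
  "f1 \<in> carrier H \<Longrightarrow> f2 \<in> carrier H \<Longrightarrow> f1 \<otimes>\<^bsub>H\<^esub> f2 \<in> carrier H"
proof -
  show "\<one>\<^bsub>H\<^esub> \<in> carrier H"
    using hecke_fun_one by (auto simp: carrier_H one_H indicator_def)
  show "\<zero>\<^bsub>H\<^esub> \<in> carrier H"
    by (simp add: carrier_H zero_H hecke_fun_def)
  show "f1 \<oplus>\<^bsub>H\<^esub> f2 \<in> carrier H" if "f1 \<in> carrier H" "f2 \<in> carrier H"
    using that hecke_fun_lincomb[of f1 f2 1 1] by (auto simp: carrier_H add_H image_subset_iff)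
  show "(\<lambda>g. - f1 g) \<in> carrier H" if "f1 \<in> carrier H"
    using that by (auto simp: carrier_H hecke_fun_def image_subset_iff)
  show "f1 \<otimes>\<^bsub>H\<^esub> f2 \<in> carrier H" if "f1 \<in> carrier H" "f2 \<in> carrier H"
    unfolding mult_H[OF that] using that conv_in_Ints[of f1 f2] hecke_fun_conv[of f1 f2] by (simp add: carrier_H)
qed

lemma Phi_mult: "s \<in> torus \<Longrightarrow> f1 \<in> carrier H \<Longrightarrow> f2 \<in> carrier H \<Longrightarrow> Phi s (f1 \<otimes>\<^bsub>H\<^esub> f2) = Phi s f1 * Phi s f2"
  using Phi_conv[of s f1 f2] by (simp add: mult_H carrier_H)

lemma Phi_add: "f1 \<in> carrier H \<Longrightarrow> f2 \<in> carrier H \<Longrightarrow> Phi s (f1 \<oplus>\<^bsub>H\<^esub> f2) = Phi s f1 + Phi s f2"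
  using Phi_lincomb[of f1 f2 s 1 1] by (simp add: add_H carrier_H)

lemma Phi_zero [simp]: "Phi s \<zero>\<^bsub>H\<^esub> = 0"
  by (simp add: Phi_def zero_H)

lemma Phi_eqI:
  "f1 \<in> carrier H \<Longrightarrow> f2 \<in> carrier H \<Longrightarrow> (\<And>s. s \<in> torus \<Longrightarrow> Phi s f1 = Phi s f2) \<Longrightarrow> f1 = f2"
  using Phi_inject by (auto simp: carrier_H)

sublocale H: cring H
proof (rule cringI)
  show "abelian_group H"
  proof (rule abelian_groupI)
    fix f assume "f \<in> carrier H"
    then show "\<exists>f'\<in>carrier H. f' \<oplus>\<^bsub>H\<^esub> f = \<zero>\<^bsub>H\<^esub>"
      by (intro bexI[of _ "\<lambda>g. - f g"]) (auto simp: H_closed add_H zero_H)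
  qed (auto simp: H_closed, auto simp: add_H zero_H algebra_simps)
  show "comm_monoid H"
  proof (rule comm_monoidI)
    fix x y z assume xyz: "x \<in> carrier H" "y \<in> carrier H" "z \<in> carrier H"
    show "x \<otimes>\<^bsub>H\<^esub> y \<otimes>\<^bsub>H\<^esub> z = x \<otimes>\<^bsub>H\<^esub> (y \<otimes>\<^bsub>H\<^esub> z)"
      using xyz by (intro Phi_eqI) (simp_all add: H_closed Phi_mult)
  next
    fix x y assume xy: "x \<in> carrier H" "y \<in> carrier H"
    show "x \<otimes>\<^bsub>H\<^esub> y = y \<otimes>\<^bsub>H\<^esub> x"
      using xy by (intro Phi_eqI) (simp_all add: H_closed Phi_mult mult.commute)
  next
    fix x assume x: "x \<in> carrier H"
    show "\<one>\<^bsub>H\<^esub> \<otimes>\<^bsub>H\<^esub> x = x"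
      using x by (intro Phi_eqI) (simp_all add: H_closed Phi_mult Phi_one)
  qed (simp_all add: H_closed)
  fix x y z assume xyz: "x \<in> carrier H" "y \<in> carrier H" "z \<in> carrier H"
  show "(x \<oplus>\<^bsub>H\<^esub> y) \<otimes>\<^bsub>H\<^esub> z = x \<otimes>\<^bsub>H\<^esub> z \<oplus>\<^bsub>H\<^esub> y \<otimes>\<^bsub>H\<^esub> z"
    using xyz by (intro Phi_eqI) (simp_all add: H_closed Phi_mult Phi_add algebra_simps)
qed

lemma Phi_uminus: "x \<in> carrier H \<Longrightarrow> Phi s (\<ominus>\<^bsub>H\<^esub> x) = - Phi s x"
  using Phi_add[of "\<ominus>\<^bsub>H\<^esub> x" x s] by (simp add: H.l_neg eq_neg_iff_add_eq_0)

lemma Phi_minus: "x \<in> carrier H \<Longrightarrow> y \<in> carrier H \<Longrightarrow> Phi s (x \<ominus>\<^bsub>H\<^esub> y) = Phi s x - Phi s y"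
  by (simp add: a_minus_def Phi_add Phi_uminus)

lemma Phi_nat_pow: "s \<in> torus \<Longrightarrow> x \<in> carrier H \<Longrightarrow> Phi s (x [^]\<^bsub>H\<^esub> (n::nat)) = Phi s x ^ n"
  by (induction n) (simp_all add: Phi_one Phi_mult)

lemma Phi_add_pow: "x \<in> carrier H \<Longrightarrow> Phi s ([n] \<cdot>\<^bsub>H\<^esub> x) = of_nat n * Phi s x" for n :: nat
proof (induction n)
  case (Suc n)
  then show ?case
    using H.add.nat_pow_Suc[of n x] by (simp add: Phi_add algebra_simps)
qed simp

lemma Phi_inv: "s \<in> torus \<Longrightarrow> x \<in> Units H \<Longrightarrow> Phi s (inv\<^bsub>H\<^esub> x) = inverse (Phi s x)"
  using Phi_mult[of s "inv\<^bsub>H\<^esub> x" x] by (simp add: H.Units_closed Phi_one) (metis inverse_unique mult.commute)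

lemma Units_nat_pow: "x \<in> Units H \<Longrightarrow> x [^]\<^bsub>H\<^esub> (n::nat) \<in> Units H"
  by (induction n) simp_all

text \<open>The exponents \<open>- numeral n\<close> and \<open>- 1\<close> are the two shapes of
  the negative literals in the final formula.\<close>

lemma Phi_neg_pow:
  assumes "s \<in> torus" "x \<in> Units H"
  shows "Phi s (x [^]\<^bsub>H\<^esub> (- numeral n :: int)) = inverse (Phi s x) ^ numeral n"
    "Phi s (x [^]\<^bsub>H\<^esub> (- 1 :: int)) = inverse (Phi s x)"
    "x [^]\<^bsub>H\<^esub> (- numeral n :: int) \<in> carrier H" "x [^]\<^bsub>H\<^esub> (- 1 :: int) \<in> carrier H"
  using assms by (simp_all add: int_pow_def2 Phi_inv Units_nat_pow Phi_nat_pow H.Units_closed power_inverse)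

end

section \<open>Satake transforms of the basic Hecke operators\<close>

lemma integers_matrix_mult:
  fixes A B :: "'k::nonarch_local_field^'n^'n"
  assumes "\<And>i j. A $ i $ j \<in> integers" "\<And>i j. B $ i $ j \<in> integers"
  shows "(A ** B) $ i $ j \<in> integers"
  using assms by (auto simp: matrix_matrix_mult_def intro!: integers_sum integers_mult)

lemma mat_mult_commute: "A ** mat c = mat c ** (A :: 'a::comm_semiring_1^'n^'n)"
  by (simp add: vec_eq_iff matrix_matrix_mult_def mat_def if_distrib if_distribR mult.commute cong: if_cong)

context hecke_setup
begin

section \<open>Characteristic functions of double cosets\<close>

abbreviation dc :: "'k mat32 \<Rightarrow> 'k mat32 \<Rightarrow> complex"
  where "dc \<equiv> double_coset_fun GL32 GL32_integers"

lemma dc_nonzero_iff: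
  "dc a x \<noteq> 0 \<longleftrightarrow> (\<exists>k\<in>GL32_integers. \<exists>k'\<in>GL32_integers. x = k \<star> a \<star> k')"
proof -
  have "dc a x \<noteq> 0 \<longleftrightarrow> x \<in> {k \<star> a \<star> k' | k k'. k \<in> GL32_integers \<and> k' \<in> GL32_integers}"
    unfolding double_coset_fun_def by (simp only: indicator_eq_0_iff not_not)
  then show ?thesis
    by blast
qed

lemma dc_nonzeroE:
  assumes "dc a x \<noteq> 0"
  obtains k k' where "k \<in> GL32_integers" "k' \<in> GL32_integers" "x = k \<star> a \<star> k'"
  using assms unfolding dc_nonzero_iff by (elim bexE) (rule that)

lemma dc_0_or_1: "dc a x = 0 \<or> dc a x = 1"
proof -
  have "indicator A y = (0::complex) \<or> indicator A y = (1::complex)" for A and y :: "'k mat32"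
    by (simp add: indicator_def)
  then show ?thesis
    unfolding double_coset_fun_def .
qed

text \<open>The double coset is the image of the compact set \<open>K \<times> K\<close> under a
  continuous map, hence compact.\<close>

lemma dc_in_H:
  assumes a: "a \<in> carrier GL32"
  shows "dc a \<in> carrier H"
proof -
  let ?K = "GL32_integers :: 'k mat32 set"
  let ?C = "(\<lambda>p. fst p \<star> a \<star> snd p) ` (?K \<times> ?K)"
  have "compact ?C"
    by (intro compact_continuous_image compact_Times compact_GL32_integers continuous_on_mult_GL32
        continuous_on_fst continuous_on_snd continuous_on_id continuous_on_const)
  moreover have "?C \<subseteq> carrier GL32"
    using a by auto
  moreover have "dc a x = 0" if "x \<notin> ?C" for x
    using that dc_nonzero_iff[of a x] by force
  ultimately have "\<exists>C. compact C \<and> C \<subseteq> carrier GL32 \<and> (\<forall>x. x \<notin> C \<longrightarrow> dc a x = 0)"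
    by blast
  moreover have "dc a (k \<star> x \<star> k') = dc a x"
    if k: "k \<in> ?K" and x: "x \<in> carrier GL32" and k': "k' \<in> ?K" for k x k'
  proof -
    have *: "dc a (l \<star> y \<star> l') \<noteq> 0" if y: "dc a y \<noteq> 0" and l: "l \<in> ?K" "l' \<in> ?K" for l y l'
    proof -
      obtain m m' where m: "m \<in> ?K" "m' \<in> ?K" "y = m \<star> a \<star> m'"
        using y by (rule dc_nonzeroE)
      then have "l \<star> y \<star> l' = (l \<star> m) \<star> a \<star> (m' \<star> l')"
        using l a by (simp add: G.m_assoc)
      then show ?thesis
        unfolding dc_nonzero_iff using m(1,2) l by (intro bexI[of _ "l \<star> m"] bexI[of _ "m' \<star> l'"]) auto
    qed
    have "inv\<^bsub>GL32\<^esub> k \<star> (k \<star> x \<star> k') \<star> inv\<^bsub>GL32\<^esub> k'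
        = inv\<^bsub>GL32\<^esub> k \<star> (k \<star> x)"
      using k x k' by (simp add: G.m_assoc)
    also have "\<dots> = x"
      using k x by (simp flip: G.m_assoc)
    finally have "dc a (k \<star> x \<star> k') \<noteq> 0 \<longleftrightarrow> dc a x \<noteq> 0"
      using *[of x k k'] *[of "k \<star> x \<star> k'" "inv\<^bsub>GL32\<^esub> k" "inv\<^bsub>GL32\<^esub> k'"] k k' by auto
    then show ?thesis
      using dc_0_or_1[of a "k \<star> x \<star> k'"] dc_0_or_1[of a x] by auto
  qed
  moreover have "range (dc a) \<subseteq> \<int>"
    by (auto simp: double_coset_fun_def indicator_def)
  ultimately show ?thesis
    by (simp add: H_def hecke_algebra_def)
qed

lemma dc_hecke_fun: "a \<in> carrier GL32 \<Longrightarrow> hecke_fun (dc a)"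
  using dc_in_H carrier_H by blast

text \<open>The interface for all coset counts: \<open>E\<close> lists the exponents that occur in
  the double coset, and \<open>N e\<close> the quadruples from \<open>T\<close> that occur above
  \<open>e\<close>. Each representative contributes 1.\<close>

lemma Phi_double_coset:
  assumes x: "x \<in> carrier GL32" and E: "finite E"
    and N: "\<And>e. e \<in> E \<Longrightarrow> N e \<subseteq> T \<times> T \<times> T \<times> T"
    and iff: "\<And>e a b c d. a \<in> T \<Longrightarrow> b \<in> T \<Longrightarrow> c \<in> T \<Longrightarrow> d \<in> T \<Longrightarrow>
      dc x (borel_elt e a b c d) \<noteq> 0 \<longleftrightarrow> e \<in> E \<and> (a, b, c, d) \<in> N e"
  shows "Phi s (dc x) = (\<Sum>e\<in>E. of_nat (card (N e)) * weight s e)"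
proof -
  have "coset_sum (dc x) e = of_nat (card (N e))" if e: "e \<in> E" for e
  proof -
    have "bij_betw (\<lambda>(a, b, c, d). borel_elt e a b c d) (N e) {r \<in> R. dc x r \<noteq> 0 \<and> ht r = e}"
    proof (rule bij_betw_imageI)
      show "inj_on (\<lambda>(a, b, c, d). borel_elt e a b c d) (N e)"
      proof (rule inj_onI)
        fix p p' assume p: "p \<in> N e" "p' \<in> N e"
          "(case p of (a, b, c, d) \<Rightarrow> borel_elt e a b c d) = (case p' of (a, b, c, d) \<Rightarrow> borel_elt e a b c d)"
        obtain a b c d a' b' c' d' where pp: "p = (a, b, c, d)" "p' = (a', b', c', d')"
          by (cases p; cases p') auto
        have m: "(a, b, c, d) \<in> N e" "(a', b', c', d') \<in> N e" and eq: "borel_elt e a b c d = borel_elt e a' b' c' d'"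
          using p by (simp_all add: pp)
        have "borel_elt e a b c d \<star> \<one>\<^bsub>GL32\<^esub> = borel_elt e a' b' c' d'"
          using eq by simp
        then have "e = e \<and> a = a' \<and> b = b' \<and> c = c' \<and> d = d'"
          by (rule borel_elt_inj) (use m N[OF e] in auto)
        then show "p = p'"
          by (simp add: pp)
      qed
      show "(\<lambda>(a, b, c, d). borel_elt e a b c d) ` N e = {r \<in> R. dc x r \<noteq> 0 \<and> ht r = e}"
      proof (intro equalityI subsetI)
        fix r assume "r \<in> (\<lambda>(a, b, c, d). borel_elt e a b c d) ` N e"
        then obtain a b c d where "(a, b, c, d) \<in> N e" "r = borel_elt e a b c d"
          by auto
        then show "r \<in> {r \<in> R. dc x r \<noteq> 0 \<and> ht r = e}"
          using N[OF e] e iff[of a b c d e] by (auto simp: borel_elt_in_R)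
      next
        fix r assume r: "r \<in> {r \<in> R. dc x r \<noteq> 0 \<and> ht r = e}"
        then obtain e' a b c d where *: "r = borel_elt e' a b c d" "a \<in> T" "b \<in> T" "c \<in> T" "d \<in> T"
          by (auto simp: R_def simp del: split_paired_Ex)
        then have "(a, b, c, d) \<in> N e" "r = borel_elt e a b c d"
          using r iff[of a b c d e'] by auto
        then show "r \<in> (\<lambda>(a, b, c, d). borel_elt e a b c d) ` N e"
          by force
      qed
    qed
    then have "card {r \<in> R. dc x r \<noteq> 0 \<and> ht r = e} = card (N e)"
      by (simp add: bij_betw_same_card)
    moreover have "coset_sum (dc x) e = (\<Sum>r | r \<in> R \<and> dc x r \<noteq> 0 \<and> ht r = e. 1)"
      unfolding coset_sum_eq_sum[OF dc_hecke_fun[OF x]] by (intro sum.cong refl) (use dc_0_or_1[of x] in blast)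
    ultimately show ?thesis
      by simp
  qed
  moreover have "Phi s (dc x) = (\<Sum>e\<in>E. coset_sum (dc x) e * weight s e)"
    using iff by (intro Phi_eq_sum_coset_sum dc_hecke_fun x E) (auto simp: R_def simp del: split_paired_Ex)
  ultimately show ?thesis
    by simp
qed

section \<open>Upper triangular elements in the double cosets\<close>

abbreviation ex :: "int \<Rightarrow> int \<Rightarrow> int \<Rightarrow> exponents" where "ex x y z \<equiv> (vector [x, y, z], 0)"
abbreviation ey :: "int \<Rightarrow> int \<Rightarrow> exponents" where "ey x y \<equiv> (0, vector [x, y])"

text \<open>The q representatives of \<pi>^-1 times the integers modulo the integers. They are the
  admissible entries in a row whose diagonal entry is \<pi>, up to further constraints.\<close>

definition Q :: "'k set" where "Q = {t \<in> T. \<pi> * t \<in> integers}"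

lemma card_Q: "card Q = card (residue_field :: 'k set set)"
  by (simp add: Q_def card_T)

lemma powi_in_integers_iff: "\<pi> powi n \<in> integers \<longleftrightarrow> 0 \<le> n"
  using uniformizer_powi_le_iff[OF unif, of n 0] by (simp add: integers_iff absval_powi)

lemma absval_powi_eq_iff: "absval (\<pi> powi m) = absval (\<pi> powi n) \<longleftrightarrow> m = n"
  by (simp add: absval_powi uniformizer_powi_eq_iff[OF unif])

lemma exponents_eq_iff:
  "e = e' \<longleftrightarrow> fst e $ 1 = fst e' $ 1 \<and> fst e $ 2 = fst e' $ 2 \<and> fst e $ 3 = fst e' $ 3 \<and>
    snd e $ 1 = snd e' $ 1 \<and> snd e $ 2 = snd e' $ 2" for e e' :: exponents
  by (auto simp: prod_eq_iff vec_eq_iff forall_3 forall_2)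

lemma snd_borel_elt_GL_integers:
  assumes "snd (borel_elt e a b c d) \<in> GL_integers" "d \<in> T"
  shows "snd e $ 1 = 0" "snd e $ 2 = 0" "d = 0"
proof -
  have "\<pi> powi (snd e $ 1) \<in> integers" "\<pi> powi (snd e $ 2) \<in> integers" "\<pi> powi (snd e $ 1) * d \<in> integers"
    "absval (\<pi> powi (snd e $ 1 + snd e $ 2)) = absval (\<pi> powi 0)"
    using assms(1) by (auto simp: borel_elt_eq mat2_GL_integers_iff power_int_add)
  then show "snd e $ 1 = 0" "snd e $ 2 = 0"
    unfolding powi_in_integers_iff absval_powi_eq_iff by linarith+
  then show "d = 0"
    using \<open>\<pi> powi (snd e $ 1) * d \<in> integers\<close> assms(2) T_integers_iff by simp
qed

lemma fst_borel_elt_GL_integers: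
  assumes "fst (borel_elt e a b c d) \<in> GL_integers" "a \<in> T" "b \<in> T" "c \<in> T"
  shows "fst e $ 1 = 0" "fst e $ 2 = 0" "fst e $ 3 = 0" "a = 0" "b = 0" "c = 0"
proof -
  have *: "\<pi> powi (fst e $ 1) \<in> integers" "\<pi> powi (fst e $ 2) \<in> integers" "\<pi> powi (fst e $ 3) \<in> integers"
    "\<pi> powi (fst e $ 1) * a \<in> integers" "\<pi> powi (fst e $ 1) * b \<in> integers" "\<pi> powi (fst e $ 2) * c \<in> integers"
    "absval (\<pi> powi (fst e $ 1 + fst e $ 2 + fst e $ 3)) = absval (\<pi> powi 0)"
    using assms(1) by (auto simp: borel_elt_eq mat3_GL_integers_iff power_int_add)
  then show e: "fst e $ 1 = 0" "fst e $ 2 = 0" "fst e $ 3 = 0"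
    unfolding powi_in_integers_iff absval_powi_eq_iff by linarith+
  then show "a = 0" "b = 0" "c = 0"
    using *(4-6) assms(2-4) T_integers_iff by auto
qed

text \<open>The unipotent factor, moved to the left of the torus, is integral. Membership in a
  double coset then only has to be checked for torus elements.\<close>

lemma dc_borel_elt_eq_dc_tau:
  assumes x: "x \<in> carrier GL32"
    and "\<pi> powi (fst e $ 1 - fst e $ 2) * a \<in> integers" "\<pi> powi (fst e $ 1 - fst e $ 3) * b \<in> integers"
      "\<pi> powi (fst e $ 2 - fst e $ 3) * c \<in> integers" "\<pi> powi (snd e $ 1 - snd e $ 2) * d \<in> integers"
  shows "dc x (borel_elt e a b c d) = dc x (tau e)"
  unfolding borel_elt_eq_left using assms
  by (intro hecke_fun_left dc_hecke_fun) (simp_all add: unip_integers_iff)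

lemma dc_nonzeroI:
  "w \<in> GL32_integers \<Longrightarrow> w' \<in> GL32_integers \<Longrightarrow> tau e = w \<star> x \<star> w' \<Longrightarrow> dc x (tau e) \<noteq> 0"
  unfolding dc_nonzero_iff by blast

lemma dc_GL3_imp:
  assumes "dc (A, mat 1) g \<noteq> 0" "\<And>i j. A $ i $ j \<in> integers"
  shows "\<And>i j. fst g $ i $ j \<in> integers" "absval (det (fst g)) = absval (det A)" "snd g \<in> GL_integers"
    "A ** A' = mat \<pi> \<Longrightarrow> (\<And>i j. A' $ i $ j \<in> integers) \<Longrightarrow>
      \<exists>h. fst g ** h = mat \<pi> \<and> (\<forall>i j. h $ i $ j \<in> integers)"
proof -
  obtain k1 k2 l1 l2 where k: "(k1, k2) \<in> GL32_integers" "(l1, l2) \<in> GL32_integers"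
    and g: "g = (k1, k2) \<star> (A, mat 1) \<star> (l1, l2)"
    using assms(1) by (auto simp: dc_nonzero_iff)
  have k1: "k1 \<in> GL_integers" "l1 \<in> GL_integers" "k2 \<in> GL_integers" "l2 \<in> GL_integers"
    using k by (auto simp: GL32_integers_def)
  have fst_g: "fst g = k1 ** A ** l1" and snd_g: "snd g = k2 ** l2"
    by (simp_all add: g mult_GL32)
  show "fst g $ i $ j \<in> integers" for i j
    unfolding fst_g using k1 assms(2) by (intro integers_matrix_mult) (auto simp: GL_integers_iff)
  show "absval (det (fst g)) = absval (det A)"
    unfolding fst_g using k1 by (simp add: det_mul absval_mult GL_integers_iff)
  show "snd g \<in> GL_integers"
    unfolding snd_g using k1 subgroup.m_closed[OF subgroup_GL_integers, of k2 l2] by (simp add: mult_GL)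
  show "\<exists>h. fst g ** h = mat \<pi> \<and> (\<forall>i j. h $ i $ j \<in> integers)"
    if A': "A ** A' = mat \<pi>" "\<And>i j. A' $ i $ j \<in> integers"
  proof (intro exI[of _ "matrix_inv l1 ** A' ** matrix_inv k1"] conjI allI)
    have inv: "invertible k1" "invertible l1"
      using k1 by (auto simp: GL_integers_def carrier_GL)
    have "fst g ** (matrix_inv l1 ** A' ** matrix_inv k1) = k1 ** A ** (l1 ** matrix_inv l1) ** A' ** matrix_inv k1"
      by (simp add: fst_g matrix_mul_assoc)
    also have "\<dots> = k1 ** (A ** A') ** matrix_inv k1"
      by (simp add: matrix_inv_mult inv matrix_mul_assoc)
    also have "\<dots> = mat \<pi> ** (k1 ** matrix_inv k1)"
      by (simp add: A' mat_mult_commute matrix_mul_assoc)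
    also have "\<dots> = mat \<pi>"
      by (simp add: matrix_inv_mult inv)
    finally show "fst g ** (matrix_inv l1 ** A' ** matrix_inv k1) = mat \<pi>" .
    show "(matrix_inv l1 ** A' ** matrix_inv k1) $ i $ j \<in> integers" for i j
      using k1 A' by (intro integers_matrix_mult) (auto simp: GL_integers_def)
  qed
qed

lemma dc_GL2_imp:
  assumes "dc (mat 1, A) g \<noteq> 0" "\<And>i j. A $ i $ j \<in> integers"
  shows "\<And>i j. snd g $ i $ j \<in> integers" "absval (det (snd g)) = absval (det A)" "fst g \<in> GL_integers"
proof -
  obtain k1 k2 l1 l2 where k: "(k1, k2) \<in> GL32_integers" "(l1, l2) \<in> GL32_integers"
    and g: "g = (k1, k2) \<star> (mat 1, A) \<star> (l1, l2)"
    using assms(1) by (auto simp: dc_nonzero_iff)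
  have k1: "k1 \<in> GL_integers" "l1 \<in> GL_integers" "k2 \<in> GL_integers" "l2 \<in> GL_integers"
    using k by (auto simp: GL32_integers_def)
  have fst_g: "fst g = k1 ** l1" and snd_g: "snd g = k2 ** A ** l2"
    by (simp_all add: g mult_GL32)
  show "snd g $ i $ j \<in> integers" for i j
    unfolding snd_g using k1 assms(2) by (intro integers_matrix_mult) (auto simp: GL_integers_iff)
  show "absval (det (snd g)) = absval (det A)"
    unfolding snd_g using k1 by (simp add: det_mul absval_mult GL_integers_iff)
  show "fst g \<in> GL_integers"
    unfolding fst_g using k1 subgroup.m_closed[OF subgroup_GL_integers, of k1 l1] by (simp add: mult_GL)
qed

lemma GL3_perm_integers:
  "(mat3 0 1 0 1 0 0 0 0 1, mat 1) \<in> (GL32_integers :: 'k mat32 set)"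
  "(mat3 0 0 1 0 1 0 1 0 0, mat 1) \<in> (GL32_integers :: 'k mat32 set)"
  "(mat 1, mat2 0 1 1 0) \<in> (GL32_integers :: 'k mat32 set)"
  unfolding mat_1_eq_mat3 mat_1_eq_mat2
  by (simp_all add: GL32_integers_def mat3_GL_integers_iff mat2_GL_integers_iff)

lemma dc_tau_self: "dc (tau e) (tau e) \<noteq> 0"
  by (rule dc_nonzeroI[of "\<one>\<^bsub>GL32\<^esub>" "\<one>\<^bsub>GL32\<^esub>"]) auto

text \<open>An element commuting with \<open>K\<close> has a double coset consisting of a single
  left coset, so the transform is one monomial.\<close>

lemma Phi_central:
  assumes central: "\<And>k. k \<in> GL32_integers \<Longrightarrow> k \<star> tau e = tau e \<star> k"
  shows "Phi s (dc (tau e)) = weight s e"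
proof -
  have "Phi s (dc (tau e)) = (\<Sum>e'\<in>{e}. of_nat (card {(0::'k, 0::'k, 0::'k, 0::'k)}) * weight s e')"
  proof (rule Phi_double_coset)
    fix e' a b c d assume T: "a \<in> T" "b \<in> T" "c \<in> T" "d \<in> T"
    show "dc (tau e) (borel_elt e' a b c d) \<noteq> 0 \<longleftrightarrow> e' \<in> {e} \<and> (a, b, c, d) \<in> {(0, 0, 0, 0)}"
    proof
      assume "dc (tau e) (borel_elt e' a b c d) \<noteq> 0"
      then obtain k k' where k: "k \<in> GL32_integers" "k' \<in> GL32_integers"
        "borel_elt e' a b c d = k \<star> tau e \<star> k'"
        by (rule dc_nonzeroE)
      then have "borel_elt e 0 0 0 0 \<star> (k \<star> k') = borel_elt e' a b c d"
        by (simp add: central G.m_assoc flip: tau_eq_borel_elt)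
      then have "e = e' \<and> 0 = a \<and> 0 = b \<and> 0 = c \<and> 0 = d"
        by (rule borel_elt_inj) (use T zero_T k in auto)
      then show "e' \<in> {e} \<and> (a, b, c, d) \<in> {(0, 0, 0, 0)}"
        by simp
    next
      assume "e' \<in> {e} \<and> (a, b, c, d) \<in> {(0, 0, 0, 0)}"
      then show "dc (tau e) (borel_elt e' a b c d) \<noteq> 0"
        using dc_tau_self[of e] by (simp add: tau_eq_borel_elt)
    qed
  qed (auto simp: zero_T)
  then show ?thesis
    by simp
qed

lemma Phi_central_cases:
  "Phi s (dc (tau (ex m m m))) = weight s (ex m m m)" "Phi s (dc (tau (ey m m))) = weight s (ey m m)"
proof -
  have *: "tau (ex m m m) = (mat (\<pi> powi m), mat 1)" "tau (ey m m) = (mat 1, mat (\<pi> powi m))"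
    by (auto simp: tau_def diag_def mat_def vec_eq_iff forall_3 forall_2)
  show "Phi s (dc (tau (ex m m m))) = weight s (ex m m m)" "Phi s (dc (tau (ey m m))) = weight s (ey m m)"
    by (rule Phi_central; simp add: * mult_GL32 mat_mult_commute)+
qed

abbreviation qq :: nat where "qq \<equiv> card Q"

lemma tau_ex: "tau (ex x y z) = (mat3 (\<pi> powi x) 0 0 0 (\<pi> powi y) 0 0 0 (\<pi> powi z), mat 1)"
  and tau_ey: "tau (ey x y) = (mat 1, mat2 (\<pi> powi x) 0 0 (\<pi> powi y))"
  by (simp_all add: tau_def diag_eq_mat3 diag_eq_mat2 mat_1_eq_mat3 mat_1_eq_mat2)

text \<open>The diagonal of an integral triangular matrix has nonnegative valuations adding up to
  that of the determinant, which leaves finitely many exponents.\<close>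

lemma dc_GL3_borel_elt:
  assumes "dc (A, mat 1) (borel_elt e a b c d) \<noteq> 0" "\<And>i j. A $ i $ j \<in> integers"
    "absval (det A) = absval (\<pi> powi m)" "d \<in> T"
  shows "0 \<le> fst e $ 1" "0 \<le> fst e $ 2" "0 \<le> fst e $ 3" "fst e $ 1 + fst e $ 2 + fst e $ 3 = m"
    "snd e $ 1 = 0" "snd e $ 2 = 0" "d = 0"
    "\<pi> powi (fst e $ 1) * a \<in> integers" "\<pi> powi (fst e $ 1) * b \<in> integers" "\<pi> powi (fst e $ 2) * c \<in> integers"
proof -
  note imp = dc_GL3_imp[OF assms(1,2)]
  show "0 \<le> fst e $ 1" "0 \<le> fst e $ 2" "0 \<le> fst e $ 3"
    using imp(1)[of 1 1] imp(1)[of 2 2] imp(1)[of 3 3] by (simp_all add: borel_elt_eq powi_in_integers_iff)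
  show "\<pi> powi (fst e $ 1) * a \<in> integers" "\<pi> powi (fst e $ 1) * b \<in> integers" "\<pi> powi (fst e $ 2) * c \<in> integers"
    using imp(1)[of 1 2] imp(1)[of 1 3] imp(1)[of 2 3] by (simp_all add: borel_elt_eq)
  have "absval (\<pi> powi (fst e $ 1 + fst e $ 2 + fst e $ 3)) = absval (\<pi> powi m)"
    using imp(2) assms(3) by (simp add: borel_elt_eq det_mat3 power_int_add)
  then show "fst e $ 1 + fst e $ 2 + fst e $ 3 = m"
    by (simp add: absval_powi_eq_iff)
  show "snd e $ 1 = 0" "snd e $ 2 = 0" "d = 0"
    using snd_borel_elt_GL_integers[OF imp(3) assms(4)] by auto
qed

text \<open>Back substitution computes \<pi> times the inverse of the triangular matrix. Its
  diagonal bounds the exponents by 1, and its corner involves \<open>a * c - b\<close> in place of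
  \<open>b\<close>.\<close>

lemma dc_GL3_inverse_borel_elt:
  assumes "dc (A, mat 1) (borel_elt e a b c d) \<noteq> 0" "\<And>i j. A $ i $ j \<in> integers"
    "A ** A' = mat \<pi>" "\<And>i j. A' $ i $ j \<in> integers"
  shows "fst e $ 1 \<le> 1" "fst e $ 2 \<le> 1" "fst e $ 3 \<le> 1"
    "\<pi> powi (1 - fst e $ 2) * a \<in> integers" "\<pi> powi (1 - fst e $ 3) * c \<in> integers"
    "\<pi> powi (1 - fst e $ 3) * (a * c - b) \<in> integers"
proof -
  obtain h where h: "fst (borel_elt e a b c d) ** h = mat \<pi>" "\<And>i j. h $ i $ j \<in> integers"
    using dc_GL3_imp(4)[OF assms] by blast
  obtain h11 h12 h13 h21 h22 h23 h31 h32 h33 where h_eq: "h = mat3 h11 h12 h13 h21 h22 h23 h31 h32 h33"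
    by (rule mat3_cases)
  have mat: "mat \<pi> = mat3 \<pi> 0 0 0 \<pi> 0 0 0 \<pi>"
    by (simp add: vec_eq_iff forall_3 mat_def)
  note eqs = h(1)[unfolded borel_elt_eq fst_conv h_eq mat mat3_mult mat3_eq_iff]
  have low: "h31 = 0" "h32 = 0" "h21 = 0"
    using eqs by auto
  have "\<pi> powi (fst e $ 1) * h11 = \<pi>" "\<pi> powi (fst e $ 2) * h22 = \<pi>" "\<pi> powi (fst e $ 3) * h33 = \<pi>"
    using eqs low by auto
  then have diag: "h11 = \<pi> powi (1 - fst e $ 1)" "h22 = \<pi> powi (1 - fst e $ 2)" "h33 = \<pi> powi (1 - fst e $ 3)"
    by (simp_all add: power_int_diff field_simps)
  have "\<pi> powi (fst e $ 1) * (h12 + a * h22) = 0" "\<pi> powi (fst e $ 2) * (h23 + c * h33) = 0"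
    "\<pi> powi (fst e $ 1) * (h13 + a * h23 + b * h33) = 0"
    using eqs low by (simp_all add: algebra_simps)
  then have "h12 + a * h22 = 0" "h23 + c * h33 = 0" "h13 + a * h23 + b * h33 = 0"
    by simp_all
  then have "h12 = - (a * h22)" "h23 = - (c * h33)" "h13 = - (a * h23) - b * h33"
    by (simp_all add: eq_neg_iff_add_eq_0 algebra_simps)
  then have up: "\<pi> powi (1 - fst e $ 2) * a = - h12" "\<pi> powi (1 - fst e $ 3) * c = - h23"
    "\<pi> powi (1 - fst e $ 3) * (a * c - b) = h13"
    by (simp_all add: diag algebra_simps)
  show "\<pi> powi (1 - fst e $ 2) * a \<in> integers" "\<pi> powi (1 - fst e $ 3) * c \<in> integers"
    "\<pi> powi (1 - fst e $ 3) * (a * c - b) \<in> integers"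
    unfolding up using h(2)[of 1 2] h(2)[of 2 3] h(2)[of 1 3] by (simp_all add: h_eq)
  show "fst e $ 1 \<le> 1" "fst e $ 2 \<le> 1" "fst e $ 3 \<le> 1"
    using h(2)[of 1 1] h(2)[of 2 2] h(2)[of 3 3] by (simp_all add: h_eq diag powi_in_integers_iff)
qed

lemma dc_GL2_borel_elt:
  assumes "dc (mat 1, A) (borel_elt e a b c d) \<noteq> 0" "\<And>i j. A $ i $ j \<in> integers"
    "absval (det A) = absval (\<pi> powi m)" "a \<in> T" "b \<in> T" "c \<in> T"
  shows "0 \<le> snd e $ 1" "0 \<le> snd e $ 2" "snd e $ 1 + snd e $ 2 = m"
    "fst e $ 1 = 0" "fst e $ 2 = 0" "fst e $ 3 = 0" "a = 0" "b = 0" "c = 0" "\<pi> powi (snd e $ 1) * d \<in> integers"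
proof -
  note imp = dc_GL2_imp[OF assms(1,2)]
  show "0 \<le> snd e $ 1" "0 \<le> snd e $ 2"
    using imp(1)[of 1 1] imp(1)[of 2 2] by (simp_all add: borel_elt_eq powi_in_integers_iff)
  show "\<pi> powi (snd e $ 1) * d \<in> integers"
    using imp(1)[of 1 2] by (simp add: borel_elt_eq)
  have "absval (\<pi> powi (snd e $ 1 + snd e $ 2)) = absval (\<pi> powi m)"
    using imp(2) assms(3) by (simp add: borel_elt_eq det_mat2 power_int_add)
  then show "snd e $ 1 + snd e $ 2 = m"
    by (simp add: absval_powi_eq_iff)
  show "fst e $ 1 = 0" "fst e $ 2 = 0" "fst e $ 3 = 0" "a = 0" "b = 0" "c = 0"
    using fst_borel_elt_GL_integers[OF imp(3) assms(4-6)] by auto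
qed

text \<open>On the first factor the modulus is a square, so its root is an integral power of
  q.\<close>

lemma weight_ex:
  "weight s (ex x y z) = complex_of_real (absval \<pi> powi (x - z)) *
    ((fst s $ 1 $ 1) powi x * (fst s $ 2 $ 2) powi y * (fst s $ 3 $ 3) powi z)"
proof -
  have "modulus (tau (ex x y z)) = (absval \<pi> powi (x - z))\<^sup>2"
  proof -
    have "modulus (tau (ex x y z)) = absval \<pi> powi ((x - z) * 2)"
      by (simp add: modulus_tau mult.commute)
    then show ?thesis
      unfolding power_int_mult by simp
  qed
  then show ?thesis
    by (simp add: weight_def monomial_at_def prod_2 prod_3 mult.assoc)
qed

text \<open>Here a genuine square root remains; it is the source of the square root of q in the
  transform of \<open>th1\<close>.\<close>

lemma weight_ey:
  "weight s (ey x y) = complex_of_real (sqrt (absval \<pi> powi (x - y))) *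
    ((snd s $ 1 $ 1) powi x * (snd s $ 2 $ 2) powi y)"
  by (simp add: weight_def monomial_at_def prod_2 prod_3 modulus_tau)

section \<open>Coset counts and transforms of the operators\<close>

lemma absval_pi: "absval \<pi> = 1 / real qq"
  unfolding card_Q by (rule absval_uniformizer[OF unif])

lemma qq_pos: "0 < qq"
  unfolding card_Q using card_residue_field_gt_1[where 'k='k] by simp

text \<open>The three exponents carry q^2, q and 1 cosets with weight factors q^-1, 1 and q, so
  every coordinate receives the same factor q.\<close>

lemma Phi_tg1:
  "Phi s (dc (tau (ex 1 0 0))) = of_nat qq * (fst s $ 1 $ 1 + fst s $ 2 $ 2 + fst s $ 3 $ 3)"
proof -
  let ?A = "mat3 \<pi> 0 0 0 1 0 0 0 1"
  have A: "tau (ex 1 0 0) = (?A, mat 1)"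
    by (simp add: tau_ex)
  have int: "?A $ i $ j \<in> integers" for i j
    using powi_in_integers_iff[of 1] exhaust_3[of i] exhaust_3[of j] by auto
  have det: "absval (det ?A) = absval (\<pi> powi 1)"
    by (simp add: det_mat3)
  \<comment> \<open>Nonzero entries are possible only in the row whose diagonal entry is \<pi>: two
    positions in the first row, one in the second, none in the third.\<close>
  define N :: "exponents \<Rightarrow> ('k \<times> 'k \<times> 'k \<times> 'k) set" where "N e = (if e = ex 1 0 0 then Q \<times> Q \<times> {0} \<times> {0} else if e = ex 0 1 0 then {0} \<times> {0} \<times> Q \<times> {0}
    else {0} \<times> {0} \<times> {0} \<times> {0})" for e
  have neq: "ex 1 0 0 \<noteq> ex 0 1 0" "ex 1 0 0 \<noteq> ex 0 0 1" "ex 0 1 0 \<noteq> ex 0 0 1"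
    unfolding exponents_eq_iff by simp_all
  have swaps: "dc (tau (ex 1 0 0)) (tau (ex 0 1 0)) \<noteq> 0" "dc (tau (ex 1 0 0)) (tau (ex 0 0 1)) \<noteq> 0"
    subgoal by (rule dc_nonzeroI[OF GL3_perm_integers(1) GL3_perm_integers(1)]) (simp add: tau_ex mult_GL32 mat3_mult)
    subgoal by (rule dc_nonzeroI[OF GL3_perm_integers(2) GL3_perm_integers(2)]) (simp add: tau_ex mult_GL32 mat3_mult)
    done
  have tau: "dc (tau (ex 1 0 0)) (tau e) \<noteq> 0" if "e \<in> {ex 1 0 0, ex 0 1 0, ex 0 0 1}" for e
    using that swaps dc_tau_self[of "ex 1 0 0"] by blast
  have "Phi s (dc (tau (ex 1 0 0))) = (\<Sum>e\<in>{ex 1 0 0, ex 0 1 0, ex 0 0 1}. of_nat (card (N e)) * weight s e)"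
  proof (rule Phi_double_coset)
    fix e a b c d assume T: "a \<in> T" "b \<in> T" "c \<in> T" "d \<in> T"
    show "dc (tau (ex 1 0 0)) (borel_elt e a b c d) \<noteq> 0 \<longleftrightarrow> e \<in> {ex 1 0 0, ex 0 1 0, ex 0 0 1} \<and> (a, b, c, d) \<in> N e"
    proof
      assume "dc (tau (ex 1 0 0)) (borel_elt e a b c d) \<noteq> 0"
      note * = dc_GL3_borel_elt[OF this[unfolded A] int det T(4)]
      consider "fst e $ 1 = 1" "fst e $ 2 = 0" "fst e $ 3 = 0" | "fst e $ 1 = 0" "fst e $ 2 = 1" "fst e $ 3 = 0"
        | "fst e $ 1 = 0" "fst e $ 2 = 0" "fst e $ 3 = 1"
        using *(1-4) by linarith
      then show "e \<in> {ex 1 0 0, ex 0 1 0, ex 0 0 1} \<and> (a, b, c, d) \<in> N e"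
      proof cases
        case 1
        then have "e = ex 1 0 0"
          using * unfolding exponents_eq_iff by simp
        then show ?thesis
          using * T 1 by (simp add: N_def Q_def T_integers_iff)
      next
        case 2
        then have "e = ex 0 1 0"
          using * unfolding exponents_eq_iff by simp
        then show ?thesis
          using * T 2 neq by (simp add: N_def Q_def T_integers_iff)
      next
        case 3
        then have "e = ex 0 0 1"
          using * unfolding exponents_eq_iff by simp
        then show ?thesis
          using * T 3 neq by (simp add: N_def Q_def T_integers_iff)
      qed
    next
      assume e: "e \<in> {ex 1 0 0, ex 0 1 0, ex 0 0 1} \<and> (a, b, c, d) \<in> N e"
      have "dc (tau (ex 1 0 0)) (borel_elt e a b c d) = dc (tau (ex 1 0 0)) (tau e)"
        using e neq by (intro dc_borel_elt_eq_dc_tau) (auto simp: N_def Q_def split: if_splits)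
      then show "dc (tau (ex 1 0 0)) (borel_elt e a b c d) \<noteq> 0"
        using tau[of e] e by simp
    qed
  qed (use zero_T in \<open>auto simp: N_def Q_def split: if_splits\<close>)
  also have "\<dots> = of_nat (qq * qq) * weight s (ex 1 0 0) + of_nat qq * weight s (ex 0 1 0) + weight s (ex 0 0 1)"
    using neq by (simp add: N_def card_cartesian_product)
  also have "\<dots> = of_nat qq * (fst s $ 1 $ 1 + fst s $ 2 $ 2 + fst s $ 3 $ 3)"
    using qq_pos by (simp add: weight_ex absval_pi power_int_minus field_simps)
  finally show ?thesis .
qed

text \<open>Again q^2, q and 1 cosets meet weight factors q^-1, 1 and q. The complementary matrix
  \<open>?A'\<close> supplies the inverse conditions, which exclude exponents equal to 2 and the
  entry \<open>a\<close> above (1, 1, 0).\<close>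

lemma Phi_tg2:
  "Phi s (dc (tau (ex 1 1 0))) = of_nat qq *
    (fst s $ 1 $ 1 * fst s $ 2 $ 2 + fst s $ 1 $ 1 * fst s $ 3 $ 3 + fst s $ 2 $ 2 * fst s $ 3 $ 3)"
proof -
  let ?A = "mat3 \<pi> 0 0 0 \<pi> 0 0 0 1" and ?A' = "mat3 1 0 0 0 1 0 0 0 \<pi>"
  have A: "tau (ex 1 1 0) = (?A, mat 1)"
    by (simp add: tau_ex)
  have int: "?A $ i $ j \<in> integers" "?A' $ i $ j \<in> integers" for i j
    using powi_in_integers_iff[of 1] exhaust_3[of i] exhaust_3[of j] by auto
  have det: "absval (det ?A) = absval (\<pi> powi 2)"
    by (simp add: det_mat3 power2_eq_square)
  have AA': "?A ** ?A' = mat \<pi>"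
    by (simp add: mat3_mult) (simp add: vec_eq_iff forall_3 mat_def)
  define N :: "exponents \<Rightarrow> ('k \<times> 'k \<times> 'k \<times> 'k) set" where "N e = (if e = ex 1 1 0 then {0} \<times> Q \<times> Q \<times> {0} else if e = ex 1 0 1 then Q \<times> {0} \<times> {0} \<times> {0}
    else {0} \<times> {0} \<times> {0} \<times> {0})" for e
  have neq: "ex 1 1 0 \<noteq> ex 1 0 1" "ex 1 1 0 \<noteq> ex 0 1 1" "ex 1 0 1 \<noteq> ex 0 1 1"
    unfolding exponents_eq_iff by simp_all
  have swap23: "(mat3 1 0 0 0 0 1 0 1 0, mat 1) \<in> (GL32_integers :: 'k mat32 set)"
    unfolding mat_1_eq_mat2 by (simp add: GL32_integers_def mat3_GL_integers_iff mat2_GL_integers_iff)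
  have swaps: "dc (tau (ex 1 1 0)) (tau (ex 1 0 1)) \<noteq> 0" "dc (tau (ex 1 1 0)) (tau (ex 0 1 1)) \<noteq> 0"
    subgoal by (rule dc_nonzeroI[OF swap23 swap23]) (simp add: tau_ex mult_GL32 mat3_mult)
    subgoal by (rule dc_nonzeroI[OF GL3_perm_integers(2) GL3_perm_integers(2)]) (simp add: tau_ex mult_GL32 mat3_mult)
    done
  have tau: "dc (tau (ex 1 1 0)) (tau e) \<noteq> 0" if "e \<in> {ex 1 1 0, ex 1 0 1, ex 0 1 1}" for e
    using that swaps dc_tau_self[of "ex 1 1 0"] by blast
  have "Phi s (dc (tau (ex 1 1 0))) = (\<Sum>e\<in>{ex 1 1 0, ex 1 0 1, ex 0 1 1}. of_nat (card (N e)) * weight s e)"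
  proof (rule Phi_double_coset)
    fix e a b c d assume T: "a \<in> T" "b \<in> T" "c \<in> T" "d \<in> T"
    show "dc (tau (ex 1 1 0)) (borel_elt e a b c d) \<noteq> 0 \<longleftrightarrow> e \<in> {ex 1 1 0, ex 1 0 1, ex 0 1 1} \<and> (a, b, c, d) \<in> N e"
    proof
      assume "dc (tau (ex 1 1 0)) (borel_elt e a b c d) \<noteq> 0"
      note nz = this[unfolded A]
      note * = dc_GL3_borel_elt[OF nz int(1) det T(4)] and inv = dc_GL3_inverse_borel_elt[OF nz int(1) AA' int(2)]
      consider "fst e $ 1 = 1" "fst e $ 2 = 1" "fst e $ 3 = 0" | "fst e $ 1 = 1" "fst e $ 2 = 0" "fst e $ 3 = 1"
        | "fst e $ 1 = 0" "fst e $ 2 = 1" "fst e $ 3 = 1"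
        using *(1-4) inv(1-3) by linarith
      then show "e \<in> {ex 1 1 0, ex 1 0 1, ex 0 1 1} \<and> (a, b, c, d) \<in> N e"
      proof cases
        case 1
        then have "e = ex 1 1 0"
          using * unfolding exponents_eq_iff by simp
        then show ?thesis
          using * inv T 1 by (simp add: N_def Q_def T_integers_iff)
      next
        case 2
        then have "e = ex 1 0 1"
          using * unfolding exponents_eq_iff by simp
        \<comment> \<open>Once \<open>c\<close> vanishes, the corner condition on
          \<open>a * c - b\<close> becomes integrality of \<open>b\<close>, which forces
          \<open>b = 0\<close>.\<close>
        moreover have "c = 0"
          using *(10) T 2 by (simp add: T_integers_iff)
        ultimately show ?thesis
          using * inv T 2 neq by (simp add: N_def Q_def T_integers_iff)
      next
        case 3
        then have "e = ex 0 1 1"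
          using * unfolding exponents_eq_iff by simp
        then show ?thesis
          using * inv T 3 neq by (simp add: N_def Q_def T_integers_iff)
      qed
    next
      assume e: "e \<in> {ex 1 1 0, ex 1 0 1, ex 0 1 1} \<and> (a, b, c, d) \<in> N e"
      have "dc (tau (ex 1 1 0)) (borel_elt e a b c d) = dc (tau (ex 1 1 0)) (tau e)"
        using e neq by (intro dc_borel_elt_eq_dc_tau) (auto simp: N_def Q_def split: if_splits)
      then show "dc (tau (ex 1 1 0)) (borel_elt e a b c d) \<noteq> 0"
        using tau[of e] e by simp
    qed
  qed (use zero_T in \<open>auto simp: N_def Q_def split: if_splits\<close>)
  also have "\<dots> = of_nat (qq * qq) * weight s (ex 1 1 0) + of_nat qq * weight s (ex 1 0 1) + weight s (ex 0 1 1)"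
    using neq by (simp add: N_def card_cartesian_product)
  also have "\<dots> = of_nat qq * (fst s $ 1 $ 1 * fst s $ 2 $ 2 + fst s $ 1 $ 1 * fst s $ 3 $ 3 + fst s $ 2 $ 2 * fst s $ 3 $ 3)"
    using qq_pos by (simp add: weight_ex absval_pi power_int_minus field_simps)
  finally show ?thesis .
qed

text \<open>The q cosets above (1, 0) have weight factor q^(-1/2), and the single one above (0, 1)
  has q^(1/2).\<close>

lemma Phi_th1:
  "Phi s (dc (tau (ey 1 0))) = complex_of_real (sqrt (real qq)) * (snd s $ 1 $ 1 + snd s $ 2 $ 2)"
proof -
  let ?A = "mat2 \<pi> 0 0 1"
  have A: "tau (ey 1 0) = (mat 1, ?A)"
    by (simp add: tau_ey)
  have int: "?A $ i $ j \<in> integers" for i j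
    using powi_in_integers_iff[of 1] exhaust_2[of i] exhaust_2[of j] by auto
  have det: "absval (det ?A) = absval (\<pi> powi 1)"
    by (simp add: det_mat2)
  define N :: "exponents \<Rightarrow> ('k \<times> 'k \<times> 'k \<times> 'k) set" where "N e = (if e = ey 1 0 then {0} \<times> {0} \<times> {0} \<times> Q else {0} \<times> {0} \<times> {0} \<times> {0})" for e
  have neq: "ey 1 0 \<noteq> ey 0 1"
    unfolding exponents_eq_iff by simp
  have swaps: "dc (tau (ey 1 0)) (tau (ey 0 1)) \<noteq> 0"
    subgoal by (rule dc_nonzeroI[OF GL3_perm_integers(3) GL3_perm_integers(3)]) (simp add: tau_ey mult_GL32 mat2_mult)
    done
  have tau: "dc (tau (ey 1 0)) (tau e) \<noteq> 0" if "e \<in> {ey 1 0, ey 0 1}" for e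
    using that swaps dc_tau_self[of "ey 1 0"] by blast
  have "Phi s (dc (tau (ey 1 0))) = (\<Sum>e\<in>{ey 1 0, ey 0 1}. of_nat (card (N e)) * weight s e)"
  proof (rule Phi_double_coset)
    fix e a b c d assume T: "a \<in> T" "b \<in> T" "c \<in> T" "d \<in> T"
    show "dc (tau (ey 1 0)) (borel_elt e a b c d) \<noteq> 0 \<longleftrightarrow> e \<in> {ey 1 0, ey 0 1} \<and> (a, b, c, d) \<in> N e"
    proof
      assume "dc (tau (ey 1 0)) (borel_elt e a b c d) \<noteq> 0"
      note * = dc_GL2_borel_elt[OF this[unfolded A] int det T(1-3)]
      consider "snd e $ 1 = 1" "snd e $ 2 = 0" | "snd e $ 1 = 0" "snd e $ 2 = 1"
        using *(1-3) by linarith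
      then show "e \<in> {ey 1 0, ey 0 1} \<and> (a, b, c, d) \<in> N e"
      proof cases
        case 1
        then have "e = ey 1 0"
          using * unfolding exponents_eq_iff by simp
        then show ?thesis
          using * T 1 by (simp add: N_def Q_def T_integers_iff)
      next
        case 2
        then have "e = ey 0 1"
          using * unfolding exponents_eq_iff by simp
        then show ?thesis
          using * T 2 neq by (simp add: N_def Q_def T_integers_iff)
      qed
    next
      assume e: "e \<in> {ey 1 0, ey 0 1} \<and> (a, b, c, d) \<in> N e"
      have "dc (tau (ey 1 0)) (borel_elt e a b c d) = dc (tau (ey 1 0)) (tau e)"
        using e neq by (intro dc_borel_elt_eq_dc_tau) (auto simp: N_def Q_def split: if_splits)
      then show "dc (tau (ey 1 0)) (borel_elt e a b c d) \<noteq> 0"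
        using tau[of e] e by simp
    qed
  qed (use zero_T in \<open>auto simp: N_def Q_def split: if_splits\<close>)
  also have "\<dots> = of_nat qq * weight s (ey 1 0) + weight s (ey 0 1)"
    using neq by (simp add: N_def card_cartesian_product)
  also have "\<dots> = complex_of_real (sqrt (real qq)) * (snd s $ 1 $ 1 + snd s $ 2 $ 2)"
  proof -
    define r where "r = complex_of_real (sqrt (real qq))"
    have r: "r \<noteq> 0" "of_nat qq = r * r"
      using qq_pos by (simp_all add: r_def flip: of_real_mult)
    show ?thesis
      using r(1) unfolding r_def[symmetric] r(2)
      by (simp add: weight_ey absval_pi power_int_minus real_sqrt_divide flip: r_def) (simp add: field_simps)
  qed
  finally show ?thesis .
qed

lemma Phi_tg3: "Phi s (dc (tau (ex 1 1 1))) = fst s $ 1 $ 1 * fst s $ 2 $ 2 * fst s $ 3 $ 3"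
  and Phi_th2: "Phi s (dc (tau (ey 1 1))) = snd s $ 1 $ 1 * snd s $ 2 $ 2"
  by (simp_all add: Phi_central_cases weight_ex weight_ey)

text \<open>The inverse is the operator with negated exponents, since the two transforms have
  product 1 at every point of the torus.\<close>

lemma central_Units: "dc (tau (ex 1 1 1)) \<in> Units H" "dc (tau (ey 1 1)) \<in> Units H"
proof -
  have *: "dc (tau e) \<in> Units H"
    if "\<And>s. s \<in> torus \<Longrightarrow> Phi s (dc (tau e)) * Phi s (dc (tau e')) = 1" for e e'
  proof -
    have "dc (tau e) \<otimes>\<^bsub>H\<^esub> dc (tau e') = \<one>\<^bsub>H\<^esub>"
      using that by (intro Phi_eqI H.m_closed) (simp_all add: dc_in_H Phi_mult Phi_one)
    then show ?thesis
      using dc_in_H[of "tau e"] dc_in_H[of "tau e'"] unfolding Units_def by (auto simp: H.m_comm)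
  qed
  show "dc (tau (ex 1 1 1)) \<in> Units H"
    by (rule *[where e' = "ex (-1) (-1) (-1)"])
      (simp add: Phi_central_cases weight_ex torus_diag_nonzero power_int_minus field_simps)
  show "dc (tau (ey 1 1)) \<in> Units H"
    by (rule *[where e' = "ey (-1) (-1)"])
      (simp add: Phi_central_cases weight_ey torus_diag_nonzero power_int_minus field_simps)
qed

end

section \<open>The Hecke polynomial\<close>

lemma matrix_inv_diagonal:
  fixes A :: "complex^'n^'n"
  assumes "\<And>i j. i \<noteq> j \<Longrightarrow> A $ i $ j = 0" "\<And>i. A $ i $ i \<noteq> 0"
  shows "matrix_inv A = (\<chi> i j. if i = j then inverse (A $ i $ i) else 0)"
proof (rule matrix_inv_unique)
  have "(\<Sum>k\<in>UNIV. A $ i $ k * (if k = j then inverse (A $ k $ k) else 0)) = (if i = j then 1 else 0)" for i j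
    using assms by (auto simp: if_distrib cong: if_cong)
  then show "A ** (\<chi> i j. if i = j then inverse (A $ i $ i) else 0) = mat 1"
    by (simp add: vec_eq_iff matrix_matrix_mult_def mat_def)
qed

lemma char_poly_rho_torus:
  assumes s: "s \<in> torus"
  shows "char_poly_rho c s =
    (\<Prod>i\<in>UNIV. \<Prod>j\<in>UNIV. [:- (c * (inverse (fst s $ i $ i) * inverse (snd s $ j $ j))), 1:])"
proof -
  have inv: "matrix_inv (fst s) = (\<chi> i j. if i = j then inverse (fst s $ i $ i) else 0)"
    "matrix_inv (snd s) = (\<chi> i j. if i = j then inverse (snd s $ i $ i) else 0)"
    using s torus_diag_nonzero[OF s] by (auto intro!: matrix_inv_diagonal simp: torus_def)
  have rho: "rho s $ i $ j =
    (if i = j then inverse (fst s $ fst i $ fst i) * inverse (snd s $ snd i $ snd i) else 0)" for i j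
    by (auto simp: rho_def kronecker_def transpose_def inv prod_eq_iff)
  let ?M = "mat [:0, 1:] - (\<chi> i j. [:c * rho s $ i $ j:])"
  have "det ?M = (\<Prod>i\<in>UNIV. ?M $ i $ i)"
    by (rule det_diagonal) (simp add: mat_def rho)
  also have "\<dots> = (\<Prod>p\<in>UNIV \<times> UNIV. [:- (c * (inverse (fst s $ fst p $ fst p) * inverse (snd s $ snd p $ snd p))), 1:])"
    by (simp add: mat_def rho)
  also have "\<dots> = (\<Prod>i\<in>UNIV. \<Prod>j\<in>UNIV. [:- (c * (inverse (fst s $ i $ i) * inverse (snd s $ j $ j))), 1:])"
    by (simp add: prod.cartesian_product case_prod_beta)
  finally show ?thesis
    by (simp add: char_poly_rho_def)
qed

text \<open>The characteristic polynomial of a tensor product in terms of the elementary symmetric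
  functions of the two factors. The variables stand for the inverses of the torus
  coordinates.\<close>

lemma prod_roots_tensor:
  fixes c X1 X2 X3 Y1 Y2 :: complex
  assumes "A1 = X1 + X2 + X3" "A2 = X1 * X2 + X1 * X3 + X2 * X3" "A3 = X1 * X2 * X3" "B1 = Y1 + Y2" "B2 = Y1 * Y2"
  shows "[:- (c * (X1 * Y1)), 1:] * [:- (c * (X1 * Y2)), 1:] * ([:- (c * (X2 * Y1)), 1:] * [:- (c * (X2 * Y2)), 1:]) *
      ([:- (c * (X3 * Y1)), 1:] * [:- (c * (X3 * Y2)), 1:]) =
    Polynomial.monom 1 6 - Polynomial.monom (c * (A1 * B1)) 5
    + Polynomial.monom (c^2 * (A2 * B1^2 + A1^2 * B2 - 2 * A2 * B2)) 4
    - Polynomial.monom (c^3 * (A1 * A2 * B1 * B2 + A3 * B1^3 - 3 * A3 * B1 * B2)) 3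
    + Polynomial.monom (c^4 * (A1 * A3 * B1^2 * B2 + A2^2 * B2^2 - 2 * A1 * A3 * B2^2)) 2
    - Polynomial.monom (c^5 * (A2 * A3 * B1 * B2^2)) 1
    + Polynomial.monom (c^6 * (A3^2 * B2^3)) 0" (is "?L = ?R")
proof -
  have "poly ?L z = poly ?R z" for z
  proof -
    \<comment> \<open>Pairing the two roots with the same \<open>X\<close> gives quadratics that
      depend on the \<open>Y\<close> only through \<open>B1\<close> and \<open>B2\<close>; this
      leaves symmetrization in the \<open>X\<close>.\<close>
    have "poly ?L z = (z^2 - c * X1 * B1 * z + c^2 * X1^2 * B2) * (z^2 - c * X2 * B1 * z + c^2 * X2^2 * B2) *
        (z^2 - c * X3 * B1 * z + c^2 * X3^2 * B2)"
      unfolding assms(4,5) by (simp add: power2_eq_square) (simp add: algebra_simps)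
    also have "\<dots> = poly ?R z"
      unfolding assms(1-3) by (simp add: poly_monom) (simp add: algebra_simps eval_nat_numeral)
    finally show ?thesis .
  qed
  then show ?thesis
    by (simp add: poly_eq_poly_eq_iff[symmetric] fun_eq_iff)
qed

context hecke_setup
begin

sublocale UP: UP_cring H "UP H"
  by unfold_locales simp_all

text \<open>Candidates have coefficients in the larger ring, whereas \<open>F\<close> is integral.
  Both kinds of coefficients are Hecke functions with complex values, so \<open>Phi_inject\<close>
  compares them directly, one degree at a time.\<close>

lemma is_hecke_polynomial_iff:
  assumes \<nu>: "haar_measure_on unipotent_group \<nu>" "emeasure \<nu> (unipotent_radical \<inter> GL32_integers) = 1"
    and F: "F \<in> carrier (UP H)"
    and Phi_F: "\<And>n s. s \<in> torus \<Longrightarrow> Phi s (up_ring.coeff (UP H) F n) =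
      Polynomial.coeff (char_poly_rho (complex_of_real (real qq powr (3/2))) s) n"
  shows "is_hecke_polynomial \<mu> \<nu> \<pi> F'\<longleftrightarrow> F' = F"
proof -
  let ?R = "hecke_algebra GL32 \<mu> GL32_integers (Z_sqrt qq) :: ('k mat32 \<Rightarrow> complex) ring"
  have Z: "\<int> \<subseteq> Z_sqrt qq"
  proof
    fix z :: complex assume "z \<in> \<int>"
    then obtain m where "z = of_int m"
      by (rule Ints_cases)
    \<comment> \<open>The range of exponents shrinks to the single value 0, so the constant
      coefficient function yields the integer itself.\<close>
    then show "z \<in> Z_sqrt qq"
      unfolding Z_sqrt_def by (intro CollectI exI[of _ 0] exI[of _ "\<lambda>_. m"]) simp
  qed
  have R: "f \<in> carrier ?R \<longleftrightarrow> hecke_fun f \<and> range f \<subseteq> Z_sqrt qq" for f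
    using hecke_algebra_iff_hecke_fun coset_reps_axioms by blast
  have carrier_UP: "x \<in> carrier (UP S) \<longleftrightarrow> (\<forall>n. x n \<in> carrier S) \<and> (\<exists>n. bound \<zero>\<^bsub>S\<^esub> n x)" for x and S :: "('k mat32 \<Rightarrow> complex) ring"
    by (simp add: UP_def up_def Pi_def)
  have coeff_UP: "up_ring.coeff (UP S) x n = x n" if "x \<in> carrier (UP S)" for x n and S :: "('k mat32 \<Rightarrow> complex) ring"
    using that by (simp add: UP_def)
  have FH: "F n \<in> carrier H" for n
    using F by (simp add: carrier_UP)
  have "\<zero>\<^bsub>?R\<^esub> = \<zero>\<^bsub>H\<^esub>"
    by (simp add: hecke_algebra_def zero_H)
  then have F': "F \<in> carrier (UP ?R)"
    using F Z unfolding carrier_UP by (auto simp: carrier_H R)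
  have iff: "is_hecke_polynomial \<mu> \<nu> \<pi> G \<longleftrightarrow> G \<in> carrier (UP ?R) \<and> (\<forall>n. \<forall>s\<in>torus. Phi s (G n) = Phi s (F n))" for G
  proof (cases "G \<in> carrier (UP ?R)")
    case True
    then have "hecke_fun (G n)" for n
      by (simp add: carrier_UP R)
    then have "dual_torus_fun \<pi> (satake \<nu> (up_ring.coeff (UP ?R) G n)) s = Phi s (G n)" for n s
      using True by (simp add: coeff_UP dual_torus_fun_satake[OF \<nu>])
    then show ?thesis
      using True Phi_F coeff_UP[OF F] by (simp add: is_hecke_polynomial_def Let_def flip: card_Q)
  qed (simp add: is_hecke_polynomial_def Let_def flip: card_Q)
  show ?thesis
  proof
    assume "is_hecke_polynomial \<mu> \<nu> \<pi> F'"
    then have F'': "F' \<in> carrier (UP ?R)" "\<And>n s. s \<in> torus \<Longrightarrow> Phi s (F' n) = Phi s (F n)"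
      by (auto simp: iff)
    show "F' = F"
    proof
      fix n
      show "F' n = F n"
        using F'' FH[of n] by (intro Phi_inject) (simp_all add: carrier_UP R carrier_H)
    qed
  next
    assume "F' = F"
    then show "is_hecke_polynomial \<mu> \<nu> \<pi> F'"
      using F' by (simp add: iff)
  qed
qed

lemma Phi_coeff_degree_6:
  assumes a: "a5 \<in> carrier H" "a4 \<in> carrier H" "a3 \<in> carrier H" "a2 \<in> carrier H" "a1 \<in> carrier H" "a0 \<in> carrier H"
    and s: "s \<in> torus"
    and F: "F = up_ring.monom (UP H) \<one>\<^bsub>H\<^esub> 6 \<ominus>\<^bsub>UP H\<^esub> up_ring.monom (UP H) a5 5 \<oplus>\<^bsub>UP H\<^esub> up_ring.monom (UP H) a4 4
      \<ominus>\<^bsub>UP H\<^esub> up_ring.monom (UP H) a3 3 \<oplus>\<^bsub>UP H\<^esub> up_ring.monom (UP H) a2 2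
      \<ominus>\<^bsub>UP H\<^esub> up_ring.monom (UP H) a1 1 \<oplus>\<^bsub>UP H\<^esub> up_ring.monom (UP H) a0 0"
  shows "F \<in> carrier (UP H)"
    and "Phi s (up_ring.coeff (UP H) F n) = Polynomial.coeff (Polynomial.monom 1 6 - Polynomial.monom (Phi s a5) 5
      + Polynomial.monom (Phi s a4) 4 - Polynomial.monom (Phi s a3) 3 + Polynomial.monom (Phi s a2) 2
      - Polynomial.monom (Phi s a1) 1 + Polynomial.monom (Phi s a0) 0) n"
proof -
  show "F \<in> carrier (UP H)"
    unfolding F by (intro UP.P.a_closed UP.P.minus_closed UP.monom_closed a H.one_closed)
  have if_closed: "(if b then x else \<zero>\<^bsub>H\<^esub>) \<in> carrier H" if "x \<in> carrier H" for b x
    using that by simp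
  have Phi_if: "Phi s (if b then x else \<zero>\<^bsub>H\<^esub>) = (if b then Phi s x else 0)" for b x
    by simp
  note cl = UP.P.a_closed UP.P.minus_closed UP.monom_closed a H.one_closed if_closed H.a_closed H.minus_closed
  show "Phi s (up_ring.coeff (UP H) F n) = Polynomial.coeff (Polynomial.monom 1 6 - Polynomial.monom (Phi s a5) 5
      + Polynomial.monom (Phi s a4) 4 - Polynomial.monom (Phi s a3) 3 + Polynomial.monom (Phi s a2) 2
      - Polynomial.monom (Phi s a1) 1 + Polynomial.monom (Phi s a0) 0) n"
    unfolding F
    by (simp only: cl UP.coeff_add UP.coeff_minus UP.coeff_monom Phi_add Phi_minus Phi_if Phi_one[OF s]
        Polynomial.coeff_add Polynomial.coeff_diff Polynomial.coeff_monom)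
qed

text \<open>Everything is expressed through \<open>r\<close>, the square root of q. Its powers match
  because the \<open>z^(6-n)\<close> coefficient carries \<open>r^(3n)\<close>, while
  \<open>tg1\<close> and \<open>tg2\<close> contribute \<open>r^2\<close>, \<open>th1\<close>
  contributes \<open>r\<close>, and the explicit powers of q supply the rest.\<close>

lemma char_poly_rho_eq:
  assumes s: "s \<in> torus"
    and tg1: "tg1 = dc (tau (ex 1 0 0))" and tg2: "tg2 = dc (tau (ex 1 1 0))" and tg3: "tg3 = dc (tau (ex 1 1 1))"
    and th1: "th1 = dc (tau (ey 1 0))" and th2: "th2 = dc (tau (ey 1 1))"
  defines "a5 \<equiv> tg2 \<otimes>\<^bsub>H\<^esub> tg3 [^]\<^bsub>H\<^esub> (-1::int) \<otimes>\<^bsub>H\<^esub> th1 \<otimes>\<^bsub>H\<^esub> th2 [^]\<^bsub>H\<^esub> (-1::int)"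
    and "a4 \<equiv> [qq] \<cdot>\<^bsub>H\<^esub> (tg1 \<otimes>\<^bsub>H\<^esub> tg3 [^]\<^bsub>H\<^esub> (-1::int) \<otimes>\<^bsub>H\<^esub> th1 [^]\<^bsub>H\<^esub> (2::nat) \<otimes>\<^bsub>H\<^esub> th2 [^]\<^bsub>H\<^esub> (-2::int)
                  \<oplus>\<^bsub>H\<^esub> tg2 [^]\<^bsub>H\<^esub> (2::nat) \<otimes>\<^bsub>H\<^esub> tg3 [^]\<^bsub>H\<^esub> (-2::int) \<otimes>\<^bsub>H\<^esub> th2 [^]\<^bsub>H\<^esub> (-1::int)
                  \<ominus>\<^bsub>H\<^esub> [(2 * qq)] \<cdot>\<^bsub>H\<^esub> (tg1 \<otimes>\<^bsub>H\<^esub> tg3 [^]\<^bsub>H\<^esub> (-1::int) \<otimes>\<^bsub>H\<^esub> th2 [^]\<^bsub>H\<^esub> (-1::int)))"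
    and "a3 \<equiv> [(qq ^ 2)] \<cdot>\<^bsub>H\<^esub> (tg1 \<otimes>\<^bsub>H\<^esub> tg2 \<otimes>\<^bsub>H\<^esub> tg3 [^]\<^bsub>H\<^esub> (-2::int) \<otimes>\<^bsub>H\<^esub> th1 \<otimes>\<^bsub>H\<^esub> th2 [^]\<^bsub>H\<^esub> (-2::int)
                  \<oplus>\<^bsub>H\<^esub> [qq] \<cdot>\<^bsub>H\<^esub> (tg3 [^]\<^bsub>H\<^esub> (-1::int) \<otimes>\<^bsub>H\<^esub> th1 [^]\<^bsub>H\<^esub> (3::nat) \<otimes>\<^bsub>H\<^esub> th2 [^]\<^bsub>H\<^esub> (-3::int))
                  \<ominus>\<^bsub>H\<^esub> [(3 * qq ^ 2)] \<cdot>\<^bsub>H\<^esub> (tg3 [^]\<^bsub>H\<^esub> (-1::int) \<otimes>\<^bsub>H\<^esub> th1 \<otimes>\<^bsub>H\<^esub> th2 [^]\<^bsub>H\<^esub> (-2::int)))"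
    and "a2 \<equiv> [(qq ^ 4)] \<cdot>\<^bsub>H\<^esub> (tg2 \<otimes>\<^bsub>H\<^esub> tg3 [^]\<^bsub>H\<^esub> (-2::int) \<otimes>\<^bsub>H\<^esub> th1 [^]\<^bsub>H\<^esub> (2::nat) \<otimes>\<^bsub>H\<^esub> th2 [^]\<^bsub>H\<^esub> (-3::int)
                  \<oplus>\<^bsub>H\<^esub> tg1 [^]\<^bsub>H\<^esub> (2::nat) \<otimes>\<^bsub>H\<^esub> tg3 [^]\<^bsub>H\<^esub> (-2::int) \<otimes>\<^bsub>H\<^esub> th2 [^]\<^bsub>H\<^esub> (-2::int)
                  \<ominus>\<^bsub>H\<^esub> [(2 * qq)] \<cdot>\<^bsub>H\<^esub> (tg2 \<otimes>\<^bsub>H\<^esub> tg3 [^]\<^bsub>H\<^esub> (-2::int) \<otimes>\<^bsub>H\<^esub> th2 [^]\<^bsub>H\<^esub> (-2::int)))"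
    and "a1 \<equiv> [(qq ^ 6)] \<cdot>\<^bsub>H\<^esub> (tg1 \<otimes>\<^bsub>H\<^esub> tg3 [^]\<^bsub>H\<^esub> (-2::int) \<otimes>\<^bsub>H\<^esub> th1 \<otimes>\<^bsub>H\<^esub> th2 [^]\<^bsub>H\<^esub> (-3::int))"
    and "a0 \<equiv> [(qq ^ 9)] \<cdot>\<^bsub>H\<^esub> (tg3 [^]\<^bsub>H\<^esub> (-2::int) \<otimes>\<^bsub>H\<^esub> th2 [^]\<^bsub>H\<^esub> (-3::int))"
  shows "a5 \<in> carrier H" "a4 \<in> carrier H" "a3 \<in> carrier H" "a2 \<in> carrier H" "a1 \<in> carrier H" "a0 \<in> carrier H"
    and "char_poly_rho (complex_of_real (real qq powr (3/2))) s =
      Polynomial.monom 1 6 - Polynomial.monom (Phi s a5) 5 + Polynomial.monom (Phi s a4) 4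
      - Polynomial.monom (Phi s a3) 3 + Polynomial.monom (Phi s a2) 2
      - Polynomial.monom (Phi s a1) 1 + Polynomial.monom (Phi s a0) 0"
proof -
  have U: "tg3 \<in> Units H" "th2 \<in> Units H"
    using central_Units by (simp_all add: tg3 th2)
  have cl: "tg1 \<in> carrier H" "tg2 \<in> carrier H" "th1 \<in> carrier H"
    by (simp_all add: tg1 tg2 th1 dc_in_H)
  note closed = cl H.m_closed H.a_closed H.minus_closed H.nat_pow_closed H.add.nat_pow_closed
    Phi_neg_pow(3,4)[OF s U(1)] Phi_neg_pow(3,4)[OF s U(2)]
  show "a5 \<in> carrier H" "a4 \<in> carrier H" "a3 \<in> carrier H" "a2 \<in> carrier H" "a1 \<in> carrier H" "a0 \<in> carrier H"
    unfolding a5_def a4_def a3_def a2_def a1_def a0_def by (intro closed)+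
  define r where "r = complex_of_real (sqrt (real qq))"
  have q: "of_nat qq = r * r"
    by (simp add: r_def flip: of_real_mult)
  have c: "complex_of_real (real qq powr (3/2)) = r ^ 3"
  proof -
    have "real qq powr (3/2) = real qq powr (1/2 + 1/2 + 1/2)"
      by simp
    also have "\<dots> = sqrt (real qq) ^ 3"
      unfolding powr_add by (simp add: powr_half_sqrt power3_eq_cube)
    finally show ?thesis
      by (simp add: r_def)
  qed
  define X1 X2 X3 Y1 Y2 where X: "X1 = inverse (fst s $ 1 $ 1)" "X2 = inverse (fst s $ 2 $ 2)"
    "X3 = inverse (fst s $ 3 $ 3)" "Y1 = inverse (snd s $ 1 $ 1)" "Y2 = inverse (snd s $ 2 $ 2)"
  define A1 A2 A3 B1 B2 where A: "A1 = X1 + X2 + X3" "A2 = X1 * X2 + X1 * X3 + X2 * X3" "A3 = X1 * X2 * X3"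
    "B1 = Y1 + Y2" "B2 = Y1 * Y2"
  have nz: "A3 \<noteq> 0" "B2 \<noteq> 0"
    by (simp_all add: A X torus_diag_nonzero[OF s])
  \<comment> \<open>The roots involve inverse coordinates, so dividing by the top symmetric function
    exchanges degrees: \<open>tg1\<close> corresponds to \<open>A2\<close> and \<open>tg2\<close> to
    \<open>A1\<close>.\<close>
  have G: "Phi s tg1 = r * r * A2 / A3" "Phi s tg2 = r * r * A1 / A3" "Phi s tg3 = 1 / A3"
    "Phi s th1 = r * B1 / B2" "Phi s th2 = 1 / B2"
    unfolding tg1 tg2 tg3 th1 th2 Phi_tg1 Phi_tg2 Phi_tg3 Phi_th1 Phi_th2 q r_def[symmetric]
    by (simp_all add: A X torus_diag_nonzero[OF s] field_simps)
  note Phi_simps = Phi_mult[OF s] Phi_add Phi_minus Phi_nat_pow[OF s] Phi_add_pow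
    Phi_neg_pow(1,2)[OF s U(1)] Phi_neg_pow(1,2)[OF s U(2)]
  have "Phi s a5 = r ^ 3 * (A1 * B1)"
    unfolding a5_def by (simp only: closed Phi_simps G) (use nz in \<open>simp add: field_simps power3_eq_cube\<close>)
  moreover have "Phi s a4 = (r ^ 3)^2 * (A2 * B1^2 + A1^2 * B2 - 2 * A2 * B2)"
    unfolding a4_def by (simp only: closed Phi_simps G of_nat_mult of_nat_numeral q)
      (use nz in \<open>simp add: field_simps eval_nat_numeral\<close>)
  moreover have "Phi s a3 = (r ^ 3)^3 * (A1 * A2 * B1 * B2 + A3 * B1^3 - 3 * A3 * B1 * B2)"
    unfolding a3_def by (simp only: closed Phi_simps G of_nat_mult of_nat_power of_nat_numeral q)
      (use nz in \<open>simp add: field_simps eval_nat_numeral\<close>)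
  moreover have "Phi s a2 = (r ^ 3)^4 * (A1 * A3 * B1^2 * B2 + A2^2 * B2^2 - 2 * A1 * A3 * B2^2)"
    unfolding a2_def by (simp only: closed Phi_simps G of_nat_mult of_nat_power of_nat_numeral q)
      (use nz in \<open>simp add: field_simps eval_nat_numeral\<close>)
  moreover have "Phi s a1 = (r ^ 3)^5 * (A2 * A3 * B1 * B2^2)"
    unfolding a1_def by (simp only: closed Phi_simps G of_nat_mult of_nat_power of_nat_numeral q)
      (use nz in \<open>simp add: field_simps eval_nat_numeral\<close>)
  moreover have "Phi s a0 = (r ^ 3)^6 * (A3^2 * B2^3)"
    unfolding a0_def by (simp only: closed Phi_simps G of_nat_mult of_nat_power of_nat_numeral q)
      (use nz in \<open>simp add: field_simps eval_nat_numeral\<close>)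
  moreover have "char_poly_rho (r ^ 3) s =
      [:- (r^3 * (X1 * Y1)), 1:] * [:- (r^3 * (X1 * Y2)), 1:] * ([:- (r^3 * (X2 * Y1)), 1:] * [:- (r^3 * (X2 * Y2)), 1:]) *
      ([:- (r^3 * (X3 * Y1)), 1:] * [:- (r^3 * (X3 * Y2)), 1:])"
    by (simp only: char_poly_rho_torus[OF s] prod_2 prod_3 X)
  ultimately show "char_poly_rho (complex_of_real (real qq powr (3/2))) s =
      Polynomial.monom 1 6 - Polynomial.monom (Phi s a5) 5 + Polynomial.monom (Phi s a4) 4
      - Polynomial.monom (Phi s a3) 3 + Polynomial.monom (Phi s a2) 2
      - Polynomial.monom (Phi s a1) 1 + Polynomial.monom (Phi s a0) 0"
    unfolding c by (simp only: prod_roots_tensor[OF A])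
qed

end

theorem theoremB:
  fixes \<mu> \<nu> :: "('k::nonarch_local_field) mat32 measure"
    and \<pi> :: 'k and q :: nat
    and H_GK (structure)
  assumes "uniformizer \<pi>"
    and "q = card (residue_field :: 'k set set)"
    and "haar_measure_on GL32 \<mu>" and "emeasure \<mu> GL32_integers = 1"
    and "haar_measure_on unipotent_group \<nu>"
    and "emeasure \<nu> (unipotent_radical \<inter> GL32_integers) = 1"
    and "H_GK = hecke_algebra GL32 \<mu> GL32_integers \<int>"
    and "P = UP H_GK"
    and "tg1 = double_coset_fun GL32 GL32_integers (diag (vector [\<pi>, 1, 1]), mat 1)"
    and "tg2 = double_coset_fun GL32 GL32_integers (diag (vector [\<pi>, \<pi>, 1]), mat 1)"
    and "tg3 = double_coset_fun GL32 GL32_integers (diag (vector [\<pi>, \<pi>, \<pi>]), mat 1)"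
    and "th1 = double_coset_fun GL32 GL32_integers (mat 1, diag (vector [\<pi>, 1]))"
    and "th2 = double_coset_fun GL32 GL32_integers (mat 1, diag (vector [\<pi>, \<pi>]))"
  shows "(\<exists>!H. is_hecke_polynomial \<mu> \<nu> \<pi> H) \<and>
    (\<forall>H. is_hecke_polynomial \<mu> \<nu> \<pi> H \<longrightarrow>
      H = up_ring.monom P \<one> 6
        \<ominus>\<^bsub>P\<^esub> up_ring.monom P (tg2 \<otimes> tg3 [^] (-1::int) \<otimes> th1 \<otimes> th2 [^] (-1::int)) 5
        \<oplus>\<^bsub>P\<^esub> up_ring.monom P
            ([q] \<cdot> (tg1 \<otimes> tg3 [^] (-1::int) \<otimes> th1 [^] (2::nat) \<otimes> th2 [^] (-2::int)
                  \<oplus> tg2 [^] (2::nat) \<otimes> tg3 [^] (-2::int) \<otimes> th2 [^] (-1::int)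
                  \<ominus> [(2 * q)] \<cdot> (tg1 \<otimes> tg3 [^] (-1::int) \<otimes> th2 [^] (-1::int)))) 4
        \<ominus>\<^bsub>P\<^esub> up_ring.monom P
            ([(q ^ 2)] \<cdot> (tg1 \<otimes> tg2 \<otimes> tg3 [^] (-2::int) \<otimes> th1 \<otimes> th2 [^] (-2::int)
                  \<oplus> [q] \<cdot> (tg3 [^] (-1::int) \<otimes> th1 [^] (3::nat) \<otimes> th2 [^] (-3::int))
                  \<ominus> [(3 * q ^ 2)] \<cdot> (tg3 [^] (-1::int) \<otimes> th1 \<otimes> th2 [^] (-2::int)))) 3
        \<oplus>\<^bsub>P\<^esub> up_ring.monom P
            ([(q ^ 4)] \<cdot> (tg2 \<otimes> tg3 [^] (-2::int) \<otimes> th1 [^] (2::nat) \<otimes> th2 [^] (-3::int)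
                  \<oplus> tg1 [^] (2::nat) \<otimes> tg3 [^] (-2::int) \<otimes> th2 [^] (-2::int)
                  \<ominus> [(2 * q)] \<cdot> (tg2 \<otimes> tg3 [^] (-2::int) \<otimes> th2 [^] (-2::int)))) 2
        \<ominus>\<^bsub>P\<^esub> up_ring.monom P
            ([(q ^ 6)] \<cdot> (tg1 \<otimes> tg3 [^] (-2::int) \<otimes> th1 \<otimes> th2 [^] (-3::int))) 1
        \<oplus>\<^bsub>P\<^esub> up_ring.monom P ([(q ^ 9)] \<cdot> (tg3 [^] (-2::int) \<otimes> th2 [^] (-3::int))) 0
      \<and> H \<in> carrier P)"
proof -
  obtain T :: "'k set" where T: "0 \<in> T" "\<And>x. \<exists>!t. t \<in> T \<and> x - t \<in> integers"
    "card {t \<in> T. \<pi> * t \<in> integers} = card (residue_field :: 'k set set)"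
    by (rule ex_fractional_reps[OF assms(1)]) (rule that)
  interpret S: hecke_setup \<pi> T \<mu>
    by unfold_locales (use assms T in auto)
  have q: "q = card S.Q"
    using assms(2) by (simp add: S.card_Q)
  have H: "H_GK = S.H"
    using assms(7) by (simp add: S.H_def)
  have ops: "tg1 = S.dc (S.tau (vector [1, 0, 0], 0))" "tg2 = S.dc (S.tau (vector [1, 1, 0], 0))"
    "tg3 = S.dc (S.tau (vector [1, 1, 1], 0))" "th1 = S.dc (S.tau (0, vector [1, 0]))"
    "th2 = S.dc (S.tau (0, vector [1, 1]))"
    unfolding assms(9-13) S.tau_ex S.tau_ey by (simp_all add: diag_eq_mat3 diag_eq_mat2)
  \<comment> \<open>The closure statements come bundled with a point of the torus but do not depend
    on it; the trivial point serves.\<close>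
  have one_torus: "(mat 1, mat 1) \<in> (torus :: complex mat32 set)"
    by (simp add: torus_def mat_def[of 1] carrier_GL32') (simp flip: mat_def)
  note closed = S.char_poly_rho_eq(1-6)[OF one_torus ops]
  note coeffs = S.Phi_coeff_degree_6[OF closed _ refl]
  \<comment> \<open>Being a Hecke polynomial is equivalent to being equal to the displayed integral
    polynomial, which gives existence, uniqueness, the formula and integrality together.\<close>
  note key = S.is_hecke_polynomial_iff[OF assms(5,6) coeffs(1)[OF one_torus],
      OF trans[OF coeffs(2) arg_cong[where f = "\<lambda>p. Polynomial.coeff p n" for n,
        OF S.char_poly_rho_eq(7)[OF _ ops, symmetric]]]]
  have unique: "(\<exists>!X. Q X) \<and> (\<forall>X. Q X \<longrightarrow> X = F \<and> X \<in> C)"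
    if "\<And>X. Q X = (X = F)" "F \<in> C" for Q and F :: "nat \<Rightarrow> 'k mat32 \<Rightarrow> complex" and C
    using that by simp
  show ?thesis
    unfolding q assms(8) H by (rule unique[OF key coeffs(1)[OF one_torus]])
qed

end
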